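(* Let $P$ be a finite $d$-complete poset with $d$-complete coloring $c:P\to I$, and let $F$ be an order filter of $P$. Let $\boldsymbol z=(z_i)_{i\in I}$ be indeterminates. Then the multivariate generating function of $(P\setminus F)$-partitions, where $P\setminus F$ is viewed as an induced subposet of $P$, is given by $$\sum_{\sigma\in\mathcal A(P\setminus F)}\boldsymbol z^\sigma=\sum_{D\in\mathcal E_P(F)}\frac{\prod_{v\in B(D)}\boldsymbol z[H_P(v)]}{\prod_{v\in P\setminus D}\bigl(1-\boldsymbol z[H_P(v)]\bigr)},$$ where $D$ runs over all excited diagrams of $F$ in $P$.
   Context: **$d$-complete posets.** For $k\ge 3$, the double-tailed diamond $d_k(1)$ is the poset on $2k-2$ elements $u_1,\dots,u_{k-2},x,y,v_{k-2},\dots,v_1$ with covering relations $u_1\gtrdot u_2\gtrdot\cdots\gtrdot u_{k-2}$, $u_{k-2}\gtrdot x\gtrdot v_{k-2}$, $u_{k-2}\gtrdot y\gtrdot v_{k-2}$, $v_{k-2}\gtrdot\cdots\gtrdot v_1$ ($a\gtrdot b$ means $a$ covers $b$). In a poset $P$, an interval $[v,u]=\{x\in P: v\le x\le u\}$ is a $d_k$-interval if it is isomorphic to $d_k(1)$; then $v$, $u$ are its bottom and top, and its two incomparable elements are its sides. A convex subset of $P$ is a $d_k^-$-convex set if it is isomorphic to $d_k(1)$ with its top element removed. $P$ is $d$-complete if for every $k\ge3$: (D1) if $I$ is a $d_k^-$-convex set, there is an element $u$ such that $u$ covers the maximal elements of $I$ and $I\cup\{u\}$ is a $d_k$-interval;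 (D2) if $I=[v,u]$ is a $d_k$-interval and $u$ covers $u'$ in $P$, then $u'\in I$; (D3) there are no $d_k^-$-convex sets which differ only in the minimal elements. In a $d$-complete poset, an element is the top of at most one $d_k$-interval (over all $k$). **Coloring.** The top forest $\Gamma$ of $P$ is the full subgraph of the Hasse diagram on all $x\in P$ such that every $y\ge x$ is covered by at most one other element. Let $I$ be a set with $\#I=\#\Gamma$ and fix a bijection $c:\Gamma\to I$ (we identify nodes of $\Gamma$ with $I$). It is known that $c$ extends uniquely to a map $c:P\to I$, the $d$-complete coloring, such that: incomparable elements have different colors; if an interval is a chain then its elements have distinct colors; if $[v,u]$ is a $d_k$-interval then $c(v)=c(u)$. **Hook monomials.** $\boldsymbol z[H_P(u)]$ is defined inductively: if $u$ is not the top of any $d_k$-interval, $\boldsymbol z[H_P(u)]=\prod_{w\le u}z_{c(w)}$; if $u$ is the top of a $d_k$-interval $[v,u]$ with sides $x,y$, then $\boldsymbol z[H_P(u)]=\boldsymbol z[H_P(x)]\,\boldsymbol z[H_P(y)]/\boldsymbol z[H_P(v)]$. **$P$-partitions.** For a poset $Q$, $\mathcal A(Q)$ is the set of order-reversing maps $\sigma:Q\to\mathbb N=\{0,1,2,\dots\}$ ($x\le y$ implies $\sigma(x)\ge\sigma(y)$). For $\sigma\in\mathcal A(P\setminus F)$, $\boldsymbol z^\sigma=\prod_{v\in P\setminus F}z_{c(v)}^{\sigma(v)}$. An order filter of $P$ is a subset $F$ such that $x<y$ and $x\in F$ imply $y\in F$ (the empty set is allowed). **Excited diagrams.** For $i\in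 I$ let $N_i$ be the set of $x\in P$ whose color $c(x)$ is adjacent to $i$ in $\Gamma$. For $D\subset P$ and $u\in D$, $u$ is $D$-active if there is $v\in P\setminus D$ with $v<u$, $c(v)=c(u)$, $[v,u]$ a $d_k$-interval for some $k$, and $[v,u]\cap D\cap N_{c(u)}=\emptyset$. In that case put $\alpha_u(D)=(D\setminus\{u\})\cup\{v\}$ (an elementary excitation). $\mathcal E_P(F)$ is the set of subsets of $P$ obtained from $F$ by finite (possibly empty) sequences of elementary excitations; its elements are the excited diagrams of $F$ in $P$. The set $B(D)$ of excited peaks of $D\in\mathcal E_P(F)$ is defined recursively by $B(F)=\emptyset$ and $B(\alpha_u(D))=\bigl(B(D)\setminus([v,u]\cap N_{c(u)})\bigr)\cup\{u\}$ for $u$ a $D$-active element and $[v,u]$ the $d_k$-interval with top $u$; it does not depend on the sequence of excitations used to reach $D$. *)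

theory Defs
  imports
    "HOL-Library.Multiset"
    "HOL-Library.FuncSet"
    "HOL-Computational_Algebra.Polynomial_Factorial"
begin

section \<open>Formal power series in a family of indeterminates\<close>

text \<open>
  A monomial in the indeterminates indexed by \<open>'i\<close> is a finite multiset of indices, the
  multiplicity of an index being its exponent; a formal power series assigns a coefficient to
  every monomial.
\<close>

typedef ('i, 'a) mfps = "UNIV :: ('i multiset \<Rightarrow> 'a) set"
  morphisms mfps_coeff Abs_mfps
  by simp

lemma mfps_coeff_Abs [simp]: "mfps_coeff (Abs_mfps f) = f"
  by (simp add: Abs_mfps_inverse)

lemma mfps_eqI: "(\<And>M. mfps_coeff f M = mfps_coeff g M) \<Longrightarrow> f = g"
  by (metis ext mfps_coeff_inject)

lemma finite_splittings: "finite {(A, B). A + B = (M :: 'i multiset)}"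
proof (rule finite_subset)
  have "finite {A. A \<subseteq># M}"
  proof (induction M)
    case empty
    show ?case by simp
  next
    case (add x M)
    have "{A. A \<subseteq># add_mset x M} \<subseteq> {A. A \<subseteq># M} \<union> add_mset x ` {A. A \<subseteq># M}"
    proof
      fix A assume "A \<in> {A. A \<subseteq># add_mset x M}"
      hence A: "A \<subseteq># add_mset x M" by simp
      show "A \<in> {A. A \<subseteq># M} \<union> add_mset x ` {A. A \<subseteq># M}"
      proof (cases "x \<in># A")
        case True
        then obtain B where B: "A = add_mset x B" by (metis insert_DiffM)
        with A have "B \<subseteq># M" by simp
        with B show ?thesis by blast
      next
        case False
        with A have "A \<subseteq># M"
          by (metis diff_single_trivial diff_subset_eq_self subset_eq_diff_conv
              subset_mset.order_trans add_mset_add_single add_mset_remove_trivial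
              subset_mset.diff_add subset_mset.add_diff_assoc2)
        thus ?thesis by blast
      qed
    qed
    with add.IH show ?case by (meson finite_UnI finite_imageI finite_subset)
  qed
  thus "finite ((\<lambda>A. (A, M - A)) ` {A. A \<subseteq># M})" by simp
  show "{(A, B). A + B = M} \<subseteq> (\<lambda>A. (A, M - A)) ` {A. A \<subseteq># M}" by auto
qed

instantiation mfps :: (type, comm_ring_1) comm_ring_1
begin

definition "0 = Abs_mfps (\<lambda>_. 0)"
definition "1 = Abs_mfps (\<lambda>M. if M = {#} then 1 else 0)"
definition "f + g = Abs_mfps (\<lambda>M. mfps_coeff f M + mfps_coeff g M)"
definition "f - g = Abs_mfps (\<lambda>M. mfps_coeff f M - mfps_coeff g M)"
definition "- f = Abs_mfps (\<lambda>M. - mfps_coeff f M)"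
definition "f * g =
  Abs_mfps (\<lambda>M. \<Sum>(A, B) \<in> {(A, B). A + B = M}. mfps_coeff f A * mfps_coeff g B)"

lemma mfps_coeff_simps [simp]:
  "mfps_coeff 0 M = 0"
  "mfps_coeff 1 M = (if M = {#} then 1 else 0)"
  "mfps_coeff (f + g) M = mfps_coeff f M + mfps_coeff g M"
  "mfps_coeff (f - g) M = mfps_coeff f M - mfps_coeff g M"
  "mfps_coeff (- f) M = - mfps_coeff f M"
  by (simp_all add: zero_mfps_def one_mfps_def plus_mfps_def minus_mfps_def uminus_mfps_def)

lemma mfps_coeff_mult:
  "mfps_coeff (f * g) M = (\<Sum>(A, B) \<in> {(A, B). A + B = M}. mfps_coeff f A * mfps_coeff g B)"
  by (simp add: times_mfps_def)

instance
proof
  fix a b c :: "('a, 'b) mfps"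
  show "a * b = b * a"
  proof (rule mfps_eqI, unfold mfps_coeff_mult)
    fix M :: "'a multiset"
    show "(\<Sum>(A, B) \<in> {(A, B). A + B = M}. mfps_coeff a A * mfps_coeff b B) =
          (\<Sum>(A, B) \<in> {(A, B). A + B = M}. mfps_coeff b A * mfps_coeff a B)"
      by (rule sum.reindex_bij_witness[of _ "\<lambda>(A, B). (B, A)" "\<lambda>(A, B). (B, A)"])
         (auto simp: add.commute mult.commute)
  qed
  show "a * b * c = a * (b * c)"
  proof (rule mfps_eqI)
    fix M :: "'a multiset"
    let ?S = "\<lambda>M :: 'a multiset. {(A, B). A + B = M}"
    let ?a = "mfps_coeff a" and ?b = "mfps_coeff b" and ?c = "mfps_coeff c"
    have fin: "finite (?S M)" for M by (rule finite_splittings)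
    have "mfps_coeff (a * b * c) M =
        (\<Sum>p\<in>?S M. \<Sum>q\<in>?S (fst p). ?a (fst q) * ?b (snd q) * ?c (snd p))"
      by (simp add: mfps_coeff_mult sum_distrib_right case_prod_beta)
    also have "\<dots> = (\<Sum>(p, q)\<in>(SIGMA p:?S M. ?S (fst p)). ?a (fst q) * ?b (snd q) * ?c (snd p))"
      by (rule sum.Sigma) (simp_all add: fin)
    also have "\<dots> = (\<Sum>(p, q)\<in>(SIGMA p:?S M. ?S (snd p)). ?a (fst p) * (?b (fst q) * ?c (snd q)))"
      by (rule sum.reindex_bij_witness[of _
            "\<lambda>((A, _), (B, C)). ((A + B, C), (A, B))" "\<lambda>((_, C), (A, B)). ((A, B + C), (B, C))"])
         (auto simp: add.assoc mult.assoc)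
    also have "\<dots> = (\<Sum>p\<in>?S M. \<Sum>q\<in>?S (snd p). ?a (fst p) * (?b (fst q) * ?c (snd q)))"
      by (rule sum.Sigma[symmetric]) (simp_all add: fin)
    also have "\<dots> = mfps_coeff (a * (b * c)) M"
      by (simp add: mfps_coeff_mult sum_distrib_left case_prod_beta)
    finally show "mfps_coeff (a * b * c) M = mfps_coeff (a * (b * c)) M" .
  qed
  show "1 * a = a"
  proof (rule mfps_eqI)
    fix M :: "'a multiset"
    have "mfps_coeff (1 * a) M = (\<Sum>(A, B)\<in>{({#}, M)}. mfps_coeff 1 A * mfps_coeff a B)"
      unfolding mfps_coeff_mult
      by (rule sum.mono_neutral_right) (use finite_splittings in \<open>auto split: if_splits\<close>)
    thus "mfps_coeff (1 * a) M = mfps_coeff a M" by simp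
  qed
  show "(a + b) * c = a * c + b * c"
    by (rule mfps_eqI)
       (simp add: mfps_coeff_mult case_prod_beta ring_distribs sum.distrib)
  show "(0 :: ('a, 'b) mfps) \<noteq> 1"
    by (metis mfps_coeff_simps(1,2) zero_neq_one)
qed (auto intro: mfps_eqI simp: algebra_simps)

end

instance mfps :: (type, idom) idom
proof
  fix f g :: "('a, 'b) mfps"
  assume "f \<noteq> 0" "g \<noteq> 0"
  define supp where "supp h = {M. mfps_coeff h M \<noteq> 0}" for h :: "('a, 'b) mfps"
  have ne: "supp f \<noteq> {}" "supp g \<noteq> {}"
    using \<open>f \<noteq> 0\<close> \<open>g \<noteq> 0\<close> by (auto simp: supp_def intro: mfps_eqI)
  obtain r :: "'a rel" where r: "well_order_on UNIV r"
    using well_order_on by blast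
  define s where "s = r - Id"
  have wf: "wf s" using r by (simp add: s_def well_order_on_def)
  have lin: "linear_order_on UNIV r" using r by (simp add: well_order_on_def)
  have irr: "irrefl s" by (auto simp: s_def irrefl_def)
  have tr: "trans s"
    using lin unfolding s_def
    by (metis order_on_defs(1) order_on_defs(2) order_on_defs(3) trans_diff_Id)
  have tot: "total s"
    using lin by (auto simp: s_def linear_order_on_def total_on_def)
  let ?m = "mult s"
  have wfm: "wf ?m" using wf by (rule wf_mult)
  have trm: "trans ?m" by (rule trans_mult[OF tr])
  have totm: "total ?m" by (rule total_mult[OF tot tr])
  have add: "(X + Z, Y + Z) \<in> ?m \<longleftrightarrow> (X, Y) \<in> ?m" for X Y Z
    by (rule mult_cancel[OF tr irrefl_on_subset[OF irr]]) simp
  obtain A0 where A0: "A0 \<in> supp f" "\<And>A. (A, A0) \<in> ?m \<Longrightarrow> A \<notin> supp f"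
    using wfE_min'[OF wfm ne(1)] by metis
  obtain B0 where B0: "B0 \<in> supp g" "\<And>B. (B, B0) \<in> ?m \<Longrightarrow> B \<notin> supp g"
    using wfE_min'[OF wfm ne(2)] by metis
  have uniq: "A = A0 \<and> B = B0" if "A \<in> supp f" "B \<in> supp g" "A + B = A0 + B0" for A B
  proof (rule ccontr)
    assume neq: "\<not> (A = A0 \<and> B = B0)"
    hence "A \<noteq> A0" "B \<noteq> B0" using that(3) by auto
    hence "(A0, A) \<in> ?m" "(B0, B) \<in> ?m"
      using totm A0(2) B0(2) that(1,2) by (auto simp: total_on_def)
    hence "(A0 + B0, A + B0) \<in> ?m" "(B0 + A, B + A) \<in> ?m"
      by (simp_all add: add)
    hence "(A0 + B0, A + B) \<in> ?m"
      using trm by (metis add.commute transD)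
    thus False using that(3) wfm by simp
  qed
  have "mfps_coeff (f * g) (A0 + B0) =
      (\<Sum>(A, B)\<in>{(A0, B0)}. mfps_coeff f A * mfps_coeff g B)"
    unfolding mfps_coeff_mult
    by (rule sum.mono_neutral_right) (use finite_splittings uniq in \<open>auto simp: supp_def\<close>)
  also have "\<dots> \<noteq> 0" using A0(1) B0(1) by (simp add: supp_def)
  finally show "f * g \<noteq> 0" by auto
qed

definition mfps_var :: "'i \<Rightarrow> ('i, 'a::comm_ring_1) mfps" where
  "mfps_var i = Abs_mfps (\<lambda>M. if M = {#i#} then 1 else 0)"

text \<open>
  Formal infinite sums: a family is summable if each monomial occurs in only finitely many
  members; the sum is then taken coefficientwise.
\<close>

definition mfps_summable :: "('b \<Rightarrow> ('i, 'a::comm_ring_1) mfps) \<Rightarrow> 'b set \<Rightarrow> bool" where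
  "mfps_summable f S \<longleftrightarrow> (\<forall>M. finite {s \<in> S. mfps_coeff (f s) M \<noteq> 0})"

definition mfps_infsum :: "('b \<Rightarrow> ('i, 'a::comm_ring_1) mfps) \<Rightarrow> 'b set \<Rightarrow> ('i, 'a) mfps" where
  "mfps_infsum f S =
    Abs_mfps (\<lambda>M. \<Sum>s \<in> {s \<in> S. mfps_coeff (f s) M \<noteq> 0}. mfps_coeff (f s) M)"

text \<open>
  The indeterminates as elements of the fraction field of the power series ring, where quotients
  of monomials and of their differences make sense.
\<close>

definition zvar :: "'i \<Rightarrow> ('i, int) mfps fract" where
  "zvar i = to_fract (mfps_var i)"


section \<open>Posets\<close>

text \<open>
  A poset is a subset \<open>P\<close> of a partially ordered type, with the induced order; this covers all
  posets up to isomorphism.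
\<close>

definition covers :: "'a::order set \<Rightarrow> 'a \<Rightarrow> 'a \<Rightarrow> bool" where
  "covers P y x \<longleftrightarrow> x \<in> P \<and> y \<in> P \<and> x < y \<and> \<not> (\<exists>z\<in>P. x < z \<and> z < y)"

definition interval :: "'a::order set \<Rightarrow> 'a \<Rightarrow> 'a \<Rightarrow> 'a set" where
  "interval P v u = {x \<in> P. v \<le> x \<and> x \<le> u}"

definition convex_subset :: "'a::order set \<Rightarrow> 'a set \<Rightarrow> bool" where
  "convex_subset P S \<longleftrightarrow> S \<subseteq> P \<and> (\<forall>x\<in>S. \<forall>y\<in>S. interval P x y \<subseteq> S)"

definition maximal_elements :: "'a::order set \<Rightarrow> 'a set" where
  "maximal_elements S = {x \<in> S. \<not> (\<exists>y\<in>S. x < y)}"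

definition minimal_elements :: "'a::order set \<Rightarrow> 'a set" where
  "minimal_elements S = {x \<in> S. \<not> (\<exists>y\<in>S. y < x)}"

definition incomparable :: "'a::order \<Rightarrow> 'a \<Rightarrow> bool" where
  "incomparable x y \<longleftrightarrow> \<not> x \<le> y \<and> \<not> y \<le> x"

definition order_filter :: "'a::order set \<Rightarrow> 'a set \<Rightarrow> bool" where
  "order_filter P F \<longleftrightarrow> F \<subseteq> P \<and> (\<forall>x\<in>F. \<forall>y\<in>P. x < y \<longrightarrow> y \<in> F)"

definition poset_iso :: "'a::order set \<Rightarrow> 'b set \<Rightarrow> ('b \<Rightarrow> 'b \<Rightarrow> bool) \<Rightarrow> bool" where
  "poset_iso A B le \<longleftrightarrow>
    (\<exists>f. bij_betw f A B \<and> (\<forall>x\<in>A. \<forall>y\<in>A. x \<le> y \<longleftrightarrow> le (f x) (f y)))"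

definition P_partitions :: "'a::order set \<Rightarrow> ('a \<Rightarrow> nat) set" where
  "P_partitions Q = {\<sigma> \<in> Q \<rightarrow>\<^sub>E UNIV. antimono_on Q \<sigma>}"


section \<open>Double-tailed diamonds and d-complete posets\<close>

datatype diamond_node = dU nat | dX | dY | dV nat

definition diamond :: "nat \<Rightarrow> diamond_node set" where
  "diamond k = dU ` {1..k-2} \<union> {dX, dY} \<union> dV ` {1..k-2}"

inductive diamond_covers :: "nat \<Rightarrow> diamond_node \<Rightarrow> diamond_node \<Rightarrow> bool" for k where
  "1 \<le> i \<Longrightarrow> i < k - 2 \<Longrightarrow> diamond_covers k (dU i) (dU (i + 1))"
| "diamond_covers k (dU (k - 2)) dX"
| "diamond_covers k dX (dV (k - 2))"
| "diamond_covers k (dU (k - 2)) dY"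
| "diamond_covers k dY (dV (k - 2))"
| "1 \<le> i \<Longrightarrow> i < k - 2 \<Longrightarrow> diamond_covers k (dV (i + 1)) (dV i)"

definition diamond_le :: "nat \<Rightarrow> diamond_node \<Rightarrow> diamond_node \<Rightarrow> bool" where
  "diamond_le k a b \<longleftrightarrow> (diamond_covers k)\<^sup>*\<^sup>* b a"

definition dk_interval :: "'a::order set \<Rightarrow> nat \<Rightarrow> 'a \<Rightarrow> 'a \<Rightarrow> bool" where
  "dk_interval P k v u \<longleftrightarrow>
    v \<in> P \<and> u \<in> P \<and> v \<le> u \<and> poset_iso (interval P v u) (diamond k) (diamond_le k)"

definition d_interval :: "'a::order set \<Rightarrow> 'a \<Rightarrow> 'a \<Rightarrow> bool" where
  "d_interval P v u \<longleftrightarrow> (\<exists>k\<ge>3. dk_interval P k v u)"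

definition sides :: "'a::order set \<Rightarrow> 'a \<Rightarrow> 'a \<Rightarrow> 'a \<Rightarrow> 'a \<Rightarrow> bool" where
  "sides P v u x y \<longleftrightarrow> x \<in> interval P v u \<and> y \<in> interval P v u \<and> incomparable x y"

definition dk_minus_convex :: "'a::order set \<Rightarrow> nat \<Rightarrow> 'a set \<Rightarrow> bool" where
  "dk_minus_convex P k S \<longleftrightarrow>
    convex_subset P S \<and> poset_iso S (diamond k - {dU 1}) (diamond_le k)"

definition d_complete :: "'a::order set \<Rightarrow> bool" where
  "d_complete P \<longleftrightarrow> (\<forall>k\<ge>3.
    (\<forall>S. dk_minus_convex P k S \<longrightarrow>
      (\<exists>u\<in>P. (\<forall>m\<in>maximal_elements S. covers P u m) \<and>
        (\<exists>v w. dk_interval P k v w \<and> insert u S = interval P v w))) \<and>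
    (\<forall>v u u'. dk_interval P k v u \<and> covers P u u' \<longrightarrow> u' \<in> interval P v u) \<and>
    \<not> (\<exists>S T. dk_minus_convex P k S \<and> dk_minus_convex P k T \<and> S \<noteq> T \<and>
      S - minimal_elements S = T - minimal_elements T))"


section \<open>The d-complete coloring\<close>

definition top_forest :: "'a::order set \<Rightarrow> 'a set" where
  "top_forest P = {x \<in> P. \<forall>y\<in>P. x \<le> y \<longrightarrow> (\<exists>\<^sub>\<le>\<^sub>1z. covers P z y)}"

definition top_forest_adjacent :: "'a::order set \<Rightarrow> 'a \<Rightarrow> 'a \<Rightarrow> bool" where
  "top_forest_adjacent P x y \<longleftrightarrow>
    x \<in> top_forest P \<and> y \<in> top_forest P \<and> (covers P x y \<or> covers P y x)"

definition d_complete_coloring :: "'a::order set \<Rightarrow> 'i set \<Rightarrow> ('a \<Rightarrow> 'i) \<Rightarrow> bool" where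
  "d_complete_coloring P I c \<longleftrightarrow>
    c \<in> P \<rightarrow> I \<and>
    bij_betw c (top_forest P) I \<and>
    (\<forall>x\<in>P. \<forall>y\<in>P. incomparable x y \<longrightarrow> c x \<noteq> c y) \<and>
    (\<forall>v\<in>P. \<forall>u\<in>P. Complete_Partial_Order.chain (\<le>) (interval P v u)
      \<longrightarrow> inj_on c (interval P v u)) \<and>
    (\<forall>v u. d_interval P v u \<longrightarrow> c v = c u)"

text \<open>The set \<open>N\<^sub>i\<close>; colors are adjacent if the corresponding nodes of the top forest are.\<close>

definition color_nbhd :: "'a::order set \<Rightarrow> ('a \<Rightarrow> 'i) \<Rightarrow> 'i \<Rightarrow> 'a set" where
  "color_nbhd P c i = {x \<in> P. \<exists>s t. top_forest_adjacent P s t \<and> c s = c x \<and> c t = i}"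


section \<open>Hook monomials\<close>

text \<open>
  The recursion is given as a relation. In a finite d-complete poset it is functional, because an
  element is the top of at most one \<open>d\<^sub>k\<close>-interval.
\<close>

inductive is_hook_monomial ::
  "'a::order set \<Rightarrow> ('a \<Rightarrow> 'i) \<Rightarrow> ('i \<Rightarrow> 'f::field) \<Rightarrow> 'a \<Rightarrow> 'f \<Rightarrow> bool"
  for P c z where
  "u \<in> P \<Longrightarrow> \<not> (\<exists>v. d_interval P v u) \<Longrightarrow>
    is_hook_monomial P c z u (\<Prod>w \<in> {w \<in> P. w \<le> u}. z (c w))"
| "d_interval P v u \<Longrightarrow> sides P v u x y \<Longrightarrow>
    is_hook_monomial P c z x hx \<Longrightarrow> is_hook_monomial P c z y hy \<Longrightarrow>
    is_hook_monomial P c z v hv \<Longrightarrow>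
    is_hook_monomial P c z u (hx * hy / hv)"

definition hook_monomial ::
  "'a::order set \<Rightarrow> ('a \<Rightarrow> 'i) \<Rightarrow> ('i \<Rightarrow> 'f::field) \<Rightarrow> 'a \<Rightarrow> 'f" where
  "hook_monomial P c z u = (THE h. is_hook_monomial P c z u h)"


section \<open>Excited diagrams\<close>

text \<open>\<open>excitable P c D u v\<close>: \<open>u\<close> is \<open>D\<close>-active, as witnessed by the \<open>d\<^sub>k\<close>-interval \<open>[v, u]\<close>.\<close>

definition excitable :: "'a::order set \<Rightarrow> ('a \<Rightarrow> 'i) \<Rightarrow> 'a set \<Rightarrow> 'a \<Rightarrow> 'a \<Rightarrow> bool" where
  "excitable P c D u v \<longleftrightarrow>
    u \<in> D \<and> v \<in> P - D \<and> v < u \<and> c v = c u \<and> d_interval P v u \<and>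
    interval P v u \<inter> D \<inter> color_nbhd P c (c u) = {}"

definition excitation :: "'a \<Rightarrow> 'a \<Rightarrow> 'a set \<Rightarrow> 'a set" where
  "excitation u v D = insert v (D - {u})"

inductive_set excited_diagrams ::
  "'a::order set \<Rightarrow> ('a \<Rightarrow> 'i) \<Rightarrow> 'a set \<Rightarrow> 'a set set"
  for P c F where
  "F \<in> excited_diagrams P c F"
| "D \<in> excited_diagrams P c F \<Longrightarrow> excitable P c D u v \<Longrightarrow>
    excitation u v D \<in> excited_diagrams P c F"

text \<open>
  \<open>has_excited_peaks P c F D B\<close>: some sequence of elementary excitations leading from \<open>F\<close> to \<open>D\<close>
  produces the set of peaks \<open>B\<close>. In a finite d-complete poset \<open>B\<close> depends only on \<open>D\<close>.
\<close>

inductive has_excited_peaks ::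
  "'a::order set \<Rightarrow> ('a \<Rightarrow> 'i) \<Rightarrow> 'a set \<Rightarrow> 'a set \<Rightarrow> 'a set \<Rightarrow> bool"
  for P c F where
  "has_excited_peaks P c F F {}"
| "has_excited_peaks P c F D B \<Longrightarrow> excitable P c D u v \<Longrightarrow>
    has_excited_peaks P c F (excitation u v D)
      (insert u (B - (interval P v u \<inter> color_nbhd P c (c u))))"

definition excited_peaks ::
  "'a::order set \<Rightarrow> ('a \<Rightarrow> 'i) \<Rightarrow> 'a set \<Rightarrow> 'a set \<Rightarrow> 'a set" where
  "excited_peaks P c F D = (THE B. has_excited_peaks P c F D B)"

end

theory Submission
  imports Defs
begin

text \<open>
  Put \<open>\<phi>(F) = \<Sum>\<^sub>A (-1)\<^bsup>|A|\<^esup> X(F \<union> A)\<close>, where \<open>A\<close> runs over the sets of maximal elements of \<open>P - F\<close>.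
  Inclusion-exclusion over the maximal elements at which a partition vanishes shows that the
  generating function satisfies \<open>\<phi>(F) = z[P - F] X(F)\<close>, and this relation determines \<open>X\<close> from \<open>X(P)\<close>.
  After multiplication by the product of all \<open>1 - z[H\<^sub>P(v)]\<close>, the sum over excited diagrams satisfies the
  same relation, a Chevalley formula. This is proved by removing a minimal element \<open>q\<close> of \<open>P\<close>, of
  color \<open>i\<close> say: the hook monomials of \<open>P\<close> are those of \<open>P - {q}\<close> evaluated at the reflected
  variables \<open>z\<^sub>i \<mapsto> 1/z\<^sub>i\<close>, \<open>z\<^sub>j \<mapsto> z\<^sub>i z\<^sub>j\<close> for \<open>j\<close> adjacent to \<open>i\<close>; and if \<open>F\<close> has a minimal element \<open>f\<close> of
  color \<open>i\<close>, an excited diagram of \<open>F\<close> is one of \<open>F - {f}\<close> together with a position for \<open>f\<close>, the weights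
  of these positions telescoping. The transformation of the hook monomials says that they are positive roots;
  its nontrivial case excludes, by a positivity argument with imaginary roots, that a principal ideal
  fails to be minuscule for the fundamental weight of its top.
\<close>

text \<open>The induction removes q from a filter \<open>G\<close> of a fixed \<open>P\<close>, not
  from \<open>P\<close> itself: the top forest of \<open>P - {q}\<close> may lose a node, and the
  set of colors would change with it. Hence excited sums and hook monomials carry \<open>G\<close>
  as a parameter. They also carry an arbitrary point \<open>z\<close> without zero coordinates over
  a field, because each removal replaces \<open>z\<close> by its reflection. The indeterminates
  enter only at the end, where their multiplicative independence ensures that no hook monomial is 1.
  Diamonds fit this induction badly, since u may cease to be the top of an interval when q
  disappears. Excited diagrams are therefore treated in a \<open>minuscule_heap\<close>, which knows
  only colors and counts of neighbours; a d-complete poset is shown to be one. The bridge from hook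
  monomials to roots is hard when u is the lowest element of its color in \<open>G\<close>. Its hook
  monomial is then the product over a principal ideal, and for q in this ideal the reflection must
  exactly compensate the loss of q. This needs exactly one neighbour above the highest occurrence of
  the color of q in the ideal, a global fact.\<close>

section \<open>Order filters and minuscule heaps\<close>

text \<open>In a d-complete poset these pairs are the bottoms and tops of the d_k-intervals
  (\<open>d_interval_iff_color_succ\<close>). This form mentions only order and color, so diamonds
  can stay out of the combinatorics of excited diagrams.\<close>

definition color_succ :: "'a::order set \<Rightarrow> ('a \<Rightarrow> 'i) \<Rightarrow> 'a \<Rightarrow> 'a \<Rightarrow> bool" where
  "color_succ P c v u \<longleftrightarrow>
    v \<in> P \<and> u \<in> P \<and> v < u \<and> c v = c u \<and> (\<forall>w\<in>P. v < w \<and> w < u \<longrightarrow> c w \<noteq> c u)"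

lemma finite_upper_cover:
  fixes P :: "'a::order set"
  assumes "finite P" "x \<in> P" "y \<in> P" "x < y"
  obtains z where "covers P z x" "z \<le> y"
proof -
  let ?S = "{w \<in> P. x < w \<and> w \<le> y}"
  have "finite ?S" "?S \<noteq> {}" using assms by auto
  then obtain z where z: "z \<in> ?S" "\<And>b. b \<in> ?S \<Longrightarrow> b \<le> z \<Longrightarrow> z = b"
    using finite_has_minimal[of ?S] by blast
  have "\<not> (x < w \<and> w < z)" if "w \<in> P" for w
  proof
    assume w: "x < w \<and> w < z"
    then have "w \<in> ?S" using that z(1) by (auto intro: less_imp_le[OF order.strict_trans2])
    with z(2)[of w, OF _ less_imp_le] w show False by auto
  qed
  then have "covers P z x" using z(1) assms(2) by (auto simp: covers_def)
  with z that show thesis by blast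
qed

lemma finite_lower_cover:
  fixes P :: "'a::order set"
  assumes "finite P" "x \<in> P" "y \<in> P" "x < y"
  obtains z where "covers P y z" "x \<le> z"
proof -
  let ?S = "{w \<in> P. x \<le> w \<and> w < y}"
  have "finite ?S" "?S \<noteq> {}" using assms by auto
  then obtain z where z: "z \<in> ?S" "\<And>b. b \<in> ?S \<Longrightarrow> z \<le> b \<Longrightarrow> z = b"
    using finite_has_maximal[of ?S] by blast
  have "\<not> (z < w \<and> w < y)" if "w \<in> P" for w
  proof
    assume w: "z < w \<and> w < y"
    then have "w \<in> ?S" using that z(1) by (auto intro: less_imp_le[OF order.strict_trans1])
    with z(2)[of w, OF _ less_imp_le] w show False by auto
  qed
  then have "covers P y z" using z(1) assms(3) by (auto simp: covers_def)
  with z that show thesis by blast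
qed

lemma order_filter_self: "order_filter P P"
  by (auto simp: order_filter_def)

lemma order_filterD: "order_filter P F \<Longrightarrow> x \<in> F \<Longrightarrow> y \<in> P \<Longrightarrow> x \<le> y \<Longrightarrow> y \<in> F"
  unfolding order_filter_def by (cases "x = y") auto

lemma order_filter_subset: "order_filter P F \<Longrightarrow> F \<subseteq> P"
  by (simp add: order_filter_def)

lemma order_filterI:
  "F \<subseteq> P \<Longrightarrow> (\<And>x y. x \<in> F \<Longrightarrow> y \<in> P \<Longrightarrow> x < y \<Longrightarrow> y \<in> F) \<Longrightarrow> order_filter P F"
  by (auto simp: order_filter_def)

lemma order_filter_remove_minimal:
  "order_filter P F \<Longrightarrow> q \<in> minimal_elements F \<Longrightarrow> order_filter P (F - {q})"
  by (auto simp: order_filter_def minimal_elements_def)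

lemma order_filter_union_maximal:
  assumes "order_filter P G" "order_filter P F" "A \<subseteq> maximal_elements (G - F)"
  shows "order_filter P (F \<union> A)"
  using assms unfolding order_filter_def maximal_elements_def by blast

text \<open>These are the axioms for the heap of a dominant minuscule element of a simply laced Weyl
  group with Dynkin diagram \<open>adj\<close>. The 2 in \<open>color_succ_card\<close> makes each
  simple reflection lower the weight by exactly one simple root; the bound in
  \<open>color_top_card\<close> makes the weight itself dominant.\<close>

locale minuscule_heap =
  fixes P :: "'a::order set" and c :: "'a \<Rightarrow> 'i" and adj :: "'i \<Rightarrow> 'i \<Rightarrow> bool"
  assumes finite_P: "finite P"
    and adj_sym: "adj i j \<Longrightarrow> adj j i"
    and adj_irrefl: "\<not> adj i i"
    and near_comparable: "x \<in> P \<Longrightarrow> y \<in> P \<Longrightarrow> c x = c y \<or> adj (c x) (c y) \<Longrightarrow> x \<le> y \<or> y \<le> x"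
    and covers_adj: "covers P y x \<Longrightarrow> adj (c x) (c y)"
    and color_succ_card: "color_succ P c v u \<Longrightarrow> card {n \<in> P. v < n \<and> n < u \<and> adj (c n) (c v)} = 2"
    and color_top_card: "p \<in> P \<Longrightarrow> (\<And>w. w \<in> P \<Longrightarrow> p < w \<Longrightarrow> c w \<noteq> c p) \<Longrightarrow>
      card {n \<in> P. p < n \<and> adj (c n) (c p)} \<le> 1"
begin

lemma finite_sub: "A \<subseteq> P \<Longrightarrow> finite A"
  using finite_P finite_subset by blast

lemma adj_commute: "adj i j \<longleftrightarrow> adj j i"
  using adj_sym by blast

lemma adj_neq: "adj (c x) (c y) \<Longrightarrow> x \<noteq> y"
  using adj_irrefl by auto

lemma comparable_same: "x \<in> P \<Longrightarrow> y \<in> P \<Longrightarrow> c x = c y \<Longrightarrow> x < y \<or> x = y \<or> y < x"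
  using near_comparable[of x y] by (auto simp: order_le_less)

lemma comparable_adj: "x \<in> P \<Longrightarrow> y \<in> P \<Longrightarrow> adj (c x) (c y) \<Longrightarrow> x < y \<or> y < x"
  using near_comparable[of x y] adj_neq[of x y] by (auto simp: order_le_less)

lemma obtain_color_top:
  assumes "A \<subseteq> P" "w \<in> A" "c w = i"
  obtains p where "p \<in> A" "c p = i" "\<And>w. w \<in> A \<Longrightarrow> c w = i \<Longrightarrow> w \<le> p"
proof -
  have "finite {w\<in>A. c w = i}" "{w\<in>A. c w = i} \<noteq> {}" using assms finite_sub by auto
  then obtain p where p: "p \<in> {w\<in>A. c w = i}" "\<And>b. b \<in> {w\<in>A. c w = i} \<Longrightarrow> p \<le> b \<Longrightarrow> p = b"
    using finite_has_maximal[of "{w\<in>A. c w = i}"] by blast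
  have "w \<le> p" if "w \<in> A" "c w = i" for w
    using near_comparable[of w p] p that assms(1) by blast
  with p that show thesis by blast
qed

lemma obtain_color_bottom:
  assumes "A \<subseteq> P" "w \<in> A" "c w = i"
  obtains p where "p \<in> A" "c p = i" "\<And>w. w \<in> A \<Longrightarrow> c w = i \<Longrightarrow> p \<le> w"
proof -
  have "finite {w\<in>A. c w = i}" "{w\<in>A. c w = i} \<noteq> {}" using assms finite_sub by auto
  then obtain p where p: "p \<in> {w\<in>A. c w = i}" "\<And>b. b \<in> {w\<in>A. c w = i} \<Longrightarrow> b \<le> p \<Longrightarrow> p = b"
    using finite_has_minimal[of "{w\<in>A. c w = i}"] by blast
  have "p \<le> w" if "w \<in> A" "c w = i" for w
    using near_comparable[of w p] p that assms(1) by blast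
  with p that show thesis by blast
qed

lemma obtain_color_succ_above:
  assumes "v \<in> P" "w \<in> P" "v < w" "c v = c w"
  obtains u where "color_succ P c v u" "u \<le> w"
proof -
  obtain u where u: "u \<in> {u\<in>P. v < u}" "c u = c v"
      "\<And>w. w \<in> {u\<in>P. v < u} \<Longrightarrow> c w = c v \<Longrightarrow> u \<le> w"
    using obtain_color_bottom[of "{u\<in>P. v < u}" w "c v"] assms by auto
  have "color_succ P c v u" unfolding color_succ_def
    using u assms by (auto dest: leD)
  with u assms that show thesis by auto
qed

lemma obtain_color_succ_below:
  assumes "v \<in> P" "w \<in> P" "v < w" "c v = c w"
  obtains u where "color_succ P c u w" "v \<le> u"
proof -
  obtain u where u: "u \<in> {u\<in>P. u < w}" "c u = c w"
      "\<And>x. x \<in> {u\<in>P. u < w} \<Longrightarrow> c x = c w \<Longrightarrow> x \<le> u"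
    using obtain_color_top[of "{u\<in>P. u < w}" v "c w"] assms by auto
  have "color_succ P c u w" unfolding color_succ_def
    using u assms by (auto dest: leD)
  with u assms that show thesis by auto
qed

text \<open>The occurrences of the color cut the stretch from q to p into gaps. Neighbours are
  comparable with every occurrence, so each falls into a gap, and a gap holds two of them by
  \<open>color_succ_card\<close>. The induction peels off the top gap.\<close>

lemma card_adj_between:
  assumes "q \<in> P" "p \<in> P" "c q = c p" "q \<le> p"
  shows "card {n\<in>P. q < n \<and> n < p \<and> adj (c n) (c p)} = 2 * card {w\<in>P. c w = c p \<and> q \<le> w \<and> w < p}"
  using assms
proof (induction "card {w\<in>P. c w = c p \<and> q \<le> w \<and> w < p}" arbitrary: p rule: less_induct)
  case (less p)
  show ?case
  proof (cases "q = p")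
    case True
    then have "{n\<in>P. q < n \<and> n < p \<and> adj (c n) (c p)} = {}"
      "{w\<in>P. c w = c p \<and> q \<le> w \<and> w < p} = {}" by auto
    then show ?thesis by (simp only: card.empty)
  next
    case False
    then have "q < p" using less.prems by auto
    then obtain u where u: "color_succ P c u p" "q \<le> u"
      using obtain_color_succ_below[of q p] less.prems by auto
    have uP: "u \<in> P" "u < p" "c u = c p" using u by (auto simp: color_succ_def)
    have "w < u" if "w \<in> P" "c w = c p" "w < p" "w \<noteq> u" for w
      using u(1) uP that comparable_same[of w u] by (auto simp: color_succ_def)
    then have S: "{w\<in>P. c w = c p \<and> q \<le> w \<and> w < p} = insert u {w\<in>P. c w = c u \<and> q \<le> w \<and> w < u}"
      using u(2) uP by auto
    have card_S: "card {w\<in>P. c w = c p \<and> q \<le> w \<and> w < p} = Suc (card {w\<in>P. c w = c u \<and> q \<le> w \<and> w < u})"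
      unfolding S by (rule card_insert_disjoint) (auto intro: finite_sub)
    have IH: "card {n\<in>P. q < n \<and> n < u \<and> adj (c n) (c u)} = 2 * card {w\<in>P. c w = c u \<and> q \<le> w \<and> w < u}"
      by (rule less.hyps) (use card_S u uP less.prems in auto)
    have N: "{n\<in>P. q < n \<and> n < p \<and> adj (c n) (c p)} =
        {n\<in>P. q < n \<and> n < u \<and> adj (c n) (c u)} \<union> {n\<in>P. u < n \<and> n < p \<and> adj (c n) (c u)}"
    proof (intro set_eqI iffI)
      fix n assume n: "n \<in> {n\<in>P. q < n \<and> n < p \<and> adj (c n) (c p)}"
      then have "n < u \<or> u < n" using comparable_adj[of n u] uP by auto
      with n uP show "n \<in> {n\<in>P. q < n \<and> n < u \<and> adj (c n) (c u)} \<union> {n\<in>P. u < n \<and> n < p \<and> adj (c n) (c u)}"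
        by auto
    qed (use u(2) uP in auto)
    have "card {n\<in>P. q < n \<and> n < p \<and> adj (c n) (c p)} =
        card {n\<in>P. q < n \<and> n < u \<and> adj (c n) (c u)} + card {n\<in>P. u < n \<and> n < p \<and> adj (c n) (c u)}"
      unfolding N by (rule card_Un_disjoint) (auto intro: finite_sub)
    then show ?thesis using IH card_S color_succ_card[OF u(1)] by simp
  qed
qed

definition convex :: "'a set \<Rightarrow> bool" where
  "convex K \<longleftrightarrow> K \<subseteq> P \<and> (\<forall>x\<in>K. \<forall>y\<in>K. \<forall>w\<in>P. x \<le> w \<and> w \<le> y \<longrightarrow> w \<in> K)"

lemma convex_Diff: "order_filter P G \<Longrightarrow> order_filter P F \<Longrightarrow> convex (G - F)"
  unfolding convex_def using order_filter_subset[of P G] order_filterD[of P G] order_filterD[of P F]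
  by blast

text \<open>If the color occurs r times, the stretch from q to p accounts for 2(r - 1) neighbours,
  and the others lie above p or below q. In terms of \<open>cartan\<close>, the sum of simple roots
  over K has product 2 minus the last two counts with the root of i. The 2 stands on the left
  because counts are naturals.\<close>

lemma card_adj_convex:
  assumes K: "convex K" and pq: "p \<in> K" "q \<in> K" "c p = i" "c q = i"
    and top: "\<And>w. w \<in> K \<Longrightarrow> c w = i \<Longrightarrow> w \<le> p"
    and bot: "\<And>w. w \<in> K \<Longrightarrow> c w = i \<Longrightarrow> q \<le> w"
  shows "card {n\<in>K. adj (c n) i} + 2 =
    2 * card {w\<in>K. c w = i} + card {n\<in>K. adj (c n) i \<and> p < n} + card {n\<in>K. adj (c n) i \<and> n < q}"
proof -
  have KP: "K \<subseteq> P" using K by (simp add: convex_def)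
  have fin: "finite A" if "A \<subseteq> K" for A using finite_sub KP that by blast
  have qp: "q \<le> p" using top pq by auto
  have N: "{n\<in>K. adj (c n) i} = {n\<in>P. q < n \<and> n < p \<and> adj (c n) (c p)} \<union>
      ({n\<in>K. adj (c n) i \<and> p < n} \<union> {n\<in>K. adj (c n) i \<and> n < q})" (is "_ = ?A \<union> (?B \<union> ?C)")
  proof (intro set_eqI iffI)
    fix n assume n: "n \<in> {n\<in>K. adj (c n) i}"
    then have "n < p \<or> p < n" "n < q \<or> q < n"
      using comparable_adj[of n p] comparable_adj[of n q] pq KP by auto
    then show "n \<in> ?A \<union> (?B \<union> ?C)" using n pq KP by auto
  next
    fix n assume "n \<in> ?A \<union> (?B \<union> ?C)"
    then consider "n \<in> ?A" | "n \<in> K" "adj (c n) i" by blast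
    then show "n \<in> {n\<in>K. adj (c n) i}"
    proof cases
      case 1
      then have "n \<in> K" using K pq unfolding convex_def by (metis (mono_tags, lifting) mem_Collect_eq order.strict_implies_order)
      with 1 pq show ?thesis by auto
    qed auto
  qed
  have AK: "?A \<subseteq> K" using N by blast
  have "card {n\<in>K. adj (c n) i} = card ?A + card (?B \<union> ?C)"
    unfolding N by (rule card_Un_disjoint) (use AK fin in auto)
  also have "card (?B \<union> ?C) = card ?B + card ?C"
    by (rule card_Un_disjoint) (use qp fin in auto)
  finally have 1: "card {n\<in>K. adj (c n) i} = card ?A + (card ?B + card ?C)" .
  have W: "{w\<in>K. c w = i} = insert p {w\<in>P. c w = c p \<and> q \<le> w \<and> w < p}"
  proof (intro set_eqI iffI)
    fix w assume "w \<in> {w\<in>K. c w = i}"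
    then show "w \<in> insert p {w\<in>P. c w = c p \<and> q \<le> w \<and> w < p}"
      using top[of w] bot[of w] KP pq by (auto simp: order_le_less)
  next
    fix w assume w: "w \<in> insert p {w\<in>P. c w = c p \<and> q \<le> w \<and> w < p}"
    then have "w \<in> K" using K pq unfolding convex_def by (metis (mono_tags, lifting) insert_iff mem_Collect_eq order.strict_implies_order)
    with w pq show "w \<in> {w\<in>K. c w = i}" by auto
  qed
  have 2: "card {w\<in>K. c w = i} = Suc (card {w\<in>P. c w = c p \<and> q \<le> w \<and> w < p})"
    unfolding W by (rule card_insert_disjoint) (auto intro: finite_sub)
  show ?thesis using 1 2 card_adj_between[of q p] pq KP qp by auto
qed

end

section \<open>Weights along filters\<close>

context minuscule_heap
begin

definition cartan :: "'i \<Rightarrow> 'i \<Rightarrow> int" where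
  "cartan i j = (if i = j then 2 else if adj i j then - 1 else 0)"

lemma cartan_commute: "cartan i j = cartan j i"
  by (auto simp: cartan_def adj_commute)

lemma sum_cartan:
  assumes "K \<subseteq> P"
  shows "(\<Sum>w\<in>K. cartan (c w) j) = 2 * int (card {w\<in>K. c w = j}) - int (card {w\<in>K. adj (c w) j})"
proof -
  have "finite K" using assms finite_sub by blast
  then show ?thesis
  proof (induction K)
    case (insert x K)
    have 1: "{w\<in>insert x K. c w = j} = (if c x = j then insert x {w\<in>K. c w = j} else {w\<in>K. c w = j})"
      and 2: "{w\<in>insert x K. adj (c w) j} = (if adj (c x) j then insert x {w\<in>K. adj (c w) j} else {w\<in>K. adj (c w) j})"
      by auto
    show ?case unfolding 1 2 using insert adj_irrefl by (auto simp: cartan_def)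
  qed simp
qed

text \<open>With \<open>\<lambda>\<close> the dominant weight for which the Weyl group element of the heap \<open>P\<close> is minuscule,
  \<open>level\<close> gives the coordinates of \<open>\<lambda>\<close> and \<open>weight F\<close> those of \<open>w\<^sub>F \<lambda>\<close>.\<close>

definition level :: "'i \<Rightarrow> int" where
  "level j = 1 - int (card {n\<in>P. adj (c n) j \<and> (\<forall>w\<in>P. c w = j \<longrightarrow> w < n)})"

definition weight :: "'a set \<Rightarrow> 'i \<Rightarrow> int" where
  "weight F j = level j - (\<Sum>w\<in>F. cartan (c w) j)"

lemma level_top:
  assumes "g \<in> P" "\<And>w. w \<in> P \<Longrightarrow> c w = c g \<Longrightarrow> w \<le> g"
  shows "level (c g) = 1 - int (card {n\<in>P. adj (c n) (c g) \<and> g < n})"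
proof -
  have "{n\<in>P. adj (c n) (c g) \<and> (\<forall>w\<in>P. c w = c g \<longrightarrow> w < n)} = {n\<in>P. adj (c n) (c g) \<and> g < n}"
    using assms by (auto intro: order.strict_trans1)
  then show ?thesis by (simp add: level_def)
qed

text \<open>This turns \<open>color_top_card\<close> into dominance of the weight.\<close>

lemma level_nonneg:
  assumes "w \<in> P"
  shows "0 \<le> level (c w)"
proof -
  obtain g where g: "g \<in> P" "c g = c w" "\<And>x. x \<in> P \<Longrightarrow> c x = c w \<Longrightarrow> x \<le> g"
    using obtain_color_top[of P w] assms by blast
  have "card {n \<in> P. g < n \<and> adj (c n) (c g)} \<le> 1"
    by (rule color_top_card) (use g in \<open>auto dest: leD\<close>)
  moreover have "{n \<in> P. g < n \<and> adj (c n) (c g)} = {n \<in> P. adj (c n) (c g) \<and> g < n}" by auto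
  ultimately show ?thesis using level_top[of g] g by simp
qed

text \<open>On the principal filter of p, \<open>card_adj_convex\<close> balances occurrences of j
  against neighbours. Those in F all lie above p, so they can be traded for the neighbours above p
  outside F. For p maximal in P - F the value is 1, which is the minuscule property.\<close>

lemma weight_color_top:
  assumes F: "order_filter P F" and p: "p \<in> P - F" "c p = j"
    and top: "\<And>w. w \<in> P - F \<Longrightarrow> c w = j \<Longrightarrow> w \<le> p"
  shows "weight F j = 1 - int (card {n\<in>P - F. adj (c n) j \<and> p < n})"
proof -
  have FP: "F \<subseteq> P" using F order_filter_subset by blast
  obtain g where g: "g \<in> P" "c g = j" "\<And>x. x \<in> P \<Longrightarrow> c x = j \<Longrightarrow> x \<le> g"
    using obtain_color_top[of P p j] p by blast
  let ?K = "{w\<in>P. p \<le> w}"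
  have "convex ?K" by (auto simp: convex_def intro: order.trans)
  then have "card {n\<in>?K. adj (c n) j} + 2 = 2 * card {w\<in>?K. c w = j} +
      card {n\<in>?K. adj (c n) j \<and> g < n} + card {n\<in>?K. adj (c n) j \<and> n < p}"
    by (rule card_adj_convex) (use g p in auto)
  moreover have "card {n\<in>?K. adj (c n) j \<and> n < p} = 0" by (auto simp: card_eq_0_iff)
  moreover have "card {n\<in>?K. adj (c n) j \<and> g < n} = card {n\<in>P. adj (c n) j \<and> g < n}"
    using g(3)[of p] p by (intro arg_cong[of _ _ card]) (auto intro: order.trans less_imp_le)
  moreover have "card {w\<in>?K. c w = j} = Suc (card {w\<in>F. c w = j})"
  proof -
    have "p < w" if "w \<in> F" "c w = j" for w
    proof -
      have "w \<noteq> p" "w \<in> P" "p \<in> P" "p \<notin> F" using that p FP by auto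
      moreover have "\<not> w \<le> p" using order_filterD[OF F that(1), of p] p by auto
      ultimately show ?thesis using near_comparable[of w p] that(2) p(2) by (simp add: less_le)
    qed
    then have "{w\<in>?K. c w = j} = insert p {w\<in>F. c w = j}"
    proof (intro set_eqI iffI)
      fix w assume "w \<in> {w\<in>?K. c w = j}"
      then show "w \<in> insert p {w\<in>F. c w = j}" using top[of w] by auto
    qed (use p FP in \<open>auto intro: less_imp_le\<close>)
    then show ?thesis using p FP finite_sub[OF FP] by auto
  qed
  moreover have "card {n\<in>?K. adj (c n) j} = card {n\<in>F. adj (c n) j} + card {n\<in>P - F. adj (c n) j \<and> p < n}"
  proof -
    have "p < n" if "n \<in> F" "adj (c n) j" for n
      using comparable_adj[of n p] that p(1) p(2) subsetD[OF FP that(1)]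
        order_filterD[OF F that(1), of p, OF _ less_imp_le] by auto
    then have "{n\<in>?K. adj (c n) j} = {n\<in>F. adj (c n) j} \<union> {n\<in>P - F. adj (c n) j \<and> p < n}"
      using p FP adj_irrefl by (auto simp: order_le_less)
    then show ?thesis using FP by (auto intro!: card_Un_disjoint finite_sub)
  qed
  ultimately have "int (card {n\<in>F. adj (c n) j}) + int (card {n\<in>P - F. adj (c n) j \<and> p < n}) =
      2 * int (card {w\<in>F. c w = j}) + int (card {n\<in>P. adj (c n) j \<and> g < n})"
    by linarith
  then show ?thesis
    using sum_cartan[OF FP, of j] level_top[of g] g by (simp add: weight_def)
qed

text \<open>A minimal counterexample \<open>G - F\<close> is, as a sum of simple roots, a positive imaginary root:
  it has nonpositive product with every simple root. Its product with \<open>weight F\<close> then increases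
  with \<open>F\<close>, starting from a nonnegative value.\<close>

lemma sum_weight_pos:
  assumes "order_filter P F" "order_filter P G" "F \<subseteq> G" "F \<noteq> G"
  shows "0 < (\<Sum>w\<in>G - F. weight F (c w))"
  using assms
proof (induction "card (G - F)" arbitrary: F G rule: less_induct)
  case (less F G)
  note F = less.prems(1) and G = less.prems(2)
  define K where "K = G - F"
  have FP: "F \<subseteq> P" and GP: "G \<subseteq> P" using F G order_filter_subset by blast+
  have KP: "K \<subseteq> P" and finK: "finite K" and K0: "K \<noteq> {}"
    using GP less.prems finite_sub[of K] by (auto simp: K_def)
  have convK: "convex K" unfolding K_def using F G by (rule convex_Diff[rotated])
  show ?case
  proof (rule ccontr)
    assume "\<not> ?thesis"
    then have L: "(\<Sum>w\<in>K. weight F (c w)) \<le> 0" by (simp add: K_def)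
    have nonpos: "(\<Sum>w\<in>K. cartan (c w) j) \<le> 0" for j
    proof (cases "\<exists>w\<in>K. c w = j")
      case False
      then have "{w\<in>K. c w = j} = {}" by auto
      then show ?thesis using sum_cartan[OF KP, of j] by (simp only: card.empty)
    next
      case True
      then obtain w0 where w0: "w0 \<in> K" "c w0 = j" by blast
      obtain p where p: "p \<in> K" "c p = j" "\<And>w. w \<in> K \<Longrightarrow> c w = j \<Longrightarrow> w \<le> p"
        using obtain_color_top[OF KP w0] by metis
      obtain q where q: "q \<in> K" "c q = j" "\<And>w. w \<in> K \<Longrightarrow> c w = j \<Longrightarrow> q \<le> w"
        using obtain_color_bottom[OF KP w0] by metis
      define d where "d = card {n\<in>K. adj (c n) j \<and> p < n}"
      define n where "n = card {n\<in>K. adj (c n) j \<and> n < q}"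
      have ip: "(\<Sum>w\<in>K. cartan (c w) j) = 2 - int d - int n"
        using card_adj_convex[OF convK p(1) q(1) p(2) q(2) p(3) q(3)] sum_cartan[OF KP, of j]
        unfolding d_def n_def by linarith
      have topPF: "w \<le> p" if "w \<in> P - F" "c w = j" for w
      proof (rule ccontr)
        assume "\<not> w \<le> p"
        then have "p < w" using comparable_same[of w p] that p(2) subsetD[OF KP p(1)] by auto
        then have "w \<in> K" using p(1) that order_filterD[OF G, of p w, OF _ _ less_imp_le] by (auto simp: K_def)
        with p(3) that \<open>\<not> w \<le> p\<close> show False by blast
      qed
      have "{n\<in>P - F. adj (c n) j \<and> p < n} = {n\<in>K. adj (c n) j \<and> p < n}"
        using p(1) GP order_filterD[OF G, of p, OF _ _ less_imp_le] by (auto simp: K_def)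
      then have wt: "weight F j = 1 - int d"
        using weight_color_top[OF F _ p(2) topPF] p(1) KP by (auto simp: d_def K_def)
      show ?thesis
      proof (rule ccontr)
        assume "\<not> ?thesis"
        then have dn: "d + n \<le> 1" using ip by linarith
        show False
        \<comment> \<open>The product with the root of j is 1 or 2. Taking one occurrence of j out
          of K, at the bottom if n = 0 and otherwise at the top, gives a smaller
          counterexample.\<close>
        proof (cases "n = 0")
          case True
          then have noN: "\<not> (x < q \<and> adj (c x) j)" if "x \<in> K" for x
            using that finK by (auto simp: n_def)
          have "q \<in> minimal_elements G"
          proof -
            have False if w: "w \<in> G" "w < q" for w
            proof -
              obtain z where z: "covers P q z" "w \<le> z"
                using finite_lower_cover[OF finite_P, of w q] w GP q KP by blast
              then have "z \<in> G" "z \<notin> F" "z < q"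
                using order_filterD[OF G w(1), of z] order_filterD[OF F, of z q, OF _ _ less_imp_le] q(1)
                by (auto simp: covers_def K_def)
              with noN[of z] covers_adj[OF z(1)] q(2) show False by (auto simp: K_def)
            qed
            then show ?thesis using q(1) by (auto simp: minimal_elements_def K_def)
          qed
          then have G1: "order_filter P (G - {q})" using order_filter_remove_minimal[OF G] by blast
          have K1: "G - {q} - F = K - {q}" by (auto simp: K_def)
          have sumK: "(\<Sum>w\<in>K. weight F (c w)) = weight F j + (\<Sum>w\<in>K - {q}. weight F (c w))"
            using sum.remove[OF finK q(1), of "\<lambda>w. weight F (c w)"] q(2) by simp
          have "K - {q} \<noteq> {}"
          proof
            assume e: "K - {q} = {}"
            then have "{n\<in>K. adj (c n) j \<and> p < n} = {}" using p(1) by auto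
            then have "d = 0" unfolding d_def by (simp only: card.empty)
            with sumK[unfolded e] L wt show False by simp
          qed
          then have "F \<noteq> G - {q}" using K1 by blast
          moreover have "card (G - {q} - F) < card (G - F)"
            unfolding K1 K_def[symmetric] by (rule psubset_card_mono) (use finK q in auto)
          moreover have "F \<subseteq> G - {q}" using less.prems q by (auto simp: K_def)
          ultimately have "0 < (\<Sum>w\<in>G - {q} - F. weight F (c w))"
            using less.hyps F G1 by blast
          with sumK L wt dn show False unfolding K1 by linarith
        next
          case False
          then have nd: "n = 1" "d = 0" using dn by auto
          then have noN: "\<not> (p < x \<and> adj (c x) j)" if "x \<in> K" for x
            using that finK by (auto simp: d_def)
          have maxp: "w \<in> F" if w: "w \<in> P" "p < w" for w
          proof (rule ccontr)
            assume "w \<notin> F"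
            obtain z where z: "covers P z p" "z \<le> w"
              using finite_upper_cover[OF finite_P, of p w] w p(1) KP by blast
            then have "z \<in> G" "z \<notin> F" "p < z"
              using order_filterD[OF G, of p z, OF _ _ less_imp_le] order_filterD[OF F, of z w] p(1) \<open>w \<notin> F\<close> w
              by (auto simp: covers_def K_def)
            with noN[of z] covers_adj[OF z(1)] p(2) adj_sym show False by (auto simp: K_def)
          qed
          have F1: "order_filter P (insert p F)"
            using F p(1) KP maxp by (auto simp: order_filter_def)
          have K1: "G - insert p F = K - {p}" by (auto simp: K_def)
          have "{n\<in>K. adj (c n) j \<and> n < q} \<noteq> {}"
            using nd(1) unfolding n_def by (metis card.empty zero_neq_one)
          then have "K - {p} \<noteq> {}" using p(2) adj_irrefl by auto
          then have "insert p F \<noteq> G" using K1 by blast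
          moreover have "card (G - insert p F) < card (G - F)"
            unfolding K1 K_def[symmetric] by (rule psubset_card_mono) (use finK p in auto)
          moreover have "insert p F \<subseteq> G" using less.prems p by (auto simp: K_def)
          ultimately have pos: "0 < (\<Sum>w\<in>K - {p}. weight (insert p F) (c w))"
            using less.hyps[OF _ F1 G] K1 by simp
          \<comment> \<open>Adding p to F subtracts \<open>cartan k j\<close> from the weights.
            Since K - {p} has product 1 - 2 = -1 with the root of j, the sum gains 1, which makes up
            for the lost term \<open>weight F j\<close> = 1. So the sum keeps its nonpositive
            value.\<close>
          have "weight (insert p F) k = weight F k - cartan k j" for k
            using p FP finite_sub[OF FP] cartan_commute by (simp add: weight_def K_def)
          then have "(\<Sum>w\<in>K - {p}. weight (insert p F) (c w)) =
              (\<Sum>w\<in>K - {p}. weight F (c w)) - (\<Sum>w\<in>K - {p}. cartan (c w) j)"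
            by (simp add: sum_subtractf)
          moreover have "(\<Sum>w\<in>K. weight F (c w)) = weight F j + (\<Sum>w\<in>K - {p}. weight F (c w))"
            "(\<Sum>w\<in>K. cartan (c w) j) = cartan j j + (\<Sum>w\<in>K - {p}. cartan (c w) j)"
            using sum.remove[OF finK p(1), of "\<lambda>w. weight F (c w)"]
              sum.remove[OF finK p(1), of "\<lambda>w. cartan (c w) j"] p(2) by simp_all
          ultimately show False using pos L wt ip nd by (simp add: cartan_def)
        qed
      qed
    qed
    have "(\<Sum>w\<in>K. weight F (c w)) = (\<Sum>w\<in>K. level (c w)) - (\<Sum>w\<in>K. \<Sum>a\<in>F. cartan (c a) (c w))"
      by (simp add: weight_def sum_subtractf)
    also have "(\<Sum>w\<in>K. \<Sum>a\<in>F. cartan (c a) (c w)) = (\<Sum>a\<in>F. \<Sum>w\<in>K. cartan (c w) (c a))"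
      by (subst sum.swap) (simp add: cartan_commute)
    finally have Leq: "(\<Sum>w\<in>K. weight F (c w)) =
      (\<Sum>w\<in>K. level (c w)) + (\<Sum>a\<in>F. - (\<Sum>w\<in>K. cartan (c w) (c a)))" by (simp add: sum_negf)
    have lev: "0 \<le> (\<Sum>w\<in>K. level (c w))" using KP level_nonneg by (intro sum_nonneg) auto
    have neg: "0 \<le> (\<Sum>a\<in>F. - (\<Sum>w\<in>K. cartan (c w) (c a)))"
      using nonpos by (intro sum_nonneg) (simp del: sum_negf)
    \<comment> \<open>Strictness needs one nonzero term. It is found at a maximal g among the top
      occurrences in P of the colors of K. With no neighbour above g, the level there is 1.
      Otherwise a neighbour above g has a color outside K by the choice of g, hence lies in F, and K
      has negative product with its root.\<close>
    let ?T = "{g\<in>P. c g \<in> c ` K \<and> (\<forall>w\<in>P. c w = c g \<longrightarrow> w \<le> g)}"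
    have in_T: "\<exists>g\<in>?T. w \<le> g" if "w \<in> P" "c w \<in> c ` K" for w
    proof -
      obtain g where g: "g \<in> P" "c g = c w" "\<And>x. x \<in> P \<Longrightarrow> c x = c w \<Longrightarrow> x \<le> g"
        using obtain_color_top[of P w "c w"] \<open>w \<in> P\<close> by blast
      with that show ?thesis by (intro bexI[of _ g]) auto
    qed
    obtain w1 where "w1 \<in> K" using K0 by blast
    then have "finite ?T" "?T \<noteq> {}" using finite_sub[of ?T] in_T[of w1] KP by blast+
    then obtain g where g: "g \<in> ?T" "\<And>b. b \<in> ?T \<Longrightarrow> g \<le> b \<Longrightarrow> g = b"
      using finite_has_maximal[of ?T] by blast
    then obtain w0 where w0: "w0 \<in> K" "c w0 = c g" by auto
    show False
    proof (cases "\<exists>n\<in>P. adj (c n) (c g) \<and> g < n")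
      case False
      then have "{n\<in>P. adj (c n) (c g) \<and> g < n} = {}" by blast
      then have "level (c w0) = 1" unfolding w0(2) using level_top[of g] g(1) by (simp only: card.empty) simp
      then have "1 \<le> (\<Sum>w\<in>K. level (c w))"
        using member_le_sum[of w0 K "\<lambda>w. level (c w)"] w0 finK level_nonneg KP by fastforce
      with Leq L neg show False by linarith
    next
      case True
      then obtain n where n: "n \<in> P" "adj (c n) (c g)" "g < n" by blast
      have nK: "c n \<notin> c ` K"
      proof
        assume "c n \<in> c ` K"
        then obtain g' where g': "g' \<in> ?T" "n \<le> g'" using in_T n(1) by blast
        with g(2)[of g', OF g'(1) less_imp_le] order.strict_trans2[OF n(3) g'(2)] show False by auto
      qed
      have "w0 < n" using w0 g(1) n(3) KP by auto
      then have "n \<in> F" using nK order_filterD[OF G, of w0 n, OF _ _ less_imp_le] w0(1) n(1) by (auto simp: K_def)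
      have "{w\<in>K. c w = c n} = {}" using nK by (auto simp: image_iff)
      moreover have "w0 \<in> {w\<in>K. adj (c w) (c n)}" using w0 n(2) adj_sym by auto
      then have "card {w\<in>K. adj (c w) (c n)} > 0" using finK card_gt_0_iff by fastforce
      ultimately have "(\<Sum>w\<in>K. cartan (c w) (c n)) < 0"
        using sum_cartan[OF KP, of "c n"] by (simp only: card.empty)
      moreover have "- (\<Sum>w\<in>K. cartan (c w) (c n)) \<le> (\<Sum>a\<in>F. - (\<Sum>w\<in>K. cartan (c w) (c a)))"
        by (rule member_le_sum[OF \<open>n \<in> F\<close>]) (use nonpos finite_sub[OF FP] in auto)
      ultimately show False using Leq L lev by linarith
    qed
  qed
qed

end

section \<open>Excited diagrams of a heap\<close>

text \<open>The least element contributes the difference between the products without and with its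
  own factor. The sum is the total weight of one element moving down a chain, with 1 - h at the
  place where it stops and h at the places above that it has left.\<close>

lemma sum_telescope_chain:
  fixes h :: "'a::order \<Rightarrow> 'b::comm_ring_1"
  assumes "finite V" "\<And>x y. x \<in> V \<Longrightarrow> y \<in> V \<Longrightarrow> x \<le> y \<or> y \<le> x"
  shows "(\<Sum>e\<in>V. (1 - h e) * (\<Prod>b\<in>{b\<in>V. e < b}. h b)) = 1 - (\<Prod>b\<in>V. h b)"
  using assms
proof (induction "card V" arbitrary: V rule: less_induct)
  case (less V)
  show ?case
  proof (cases "V = {}")
    case False
    then obtain m where m: "m \<in> V" "\<And>b. b \<in> V \<Longrightarrow> b \<le> m \<Longrightarrow> m = b"
      using finite_has_minimal[of V] less.prems by blast
    define W where "W = V - {m}"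
    have W: "V = insert m W" "m \<notin> W" "finite W" using m less.prems by (auto simp: W_def)
    have lt: "m < b" if "b \<in> W" for b
      using less.prems(2)[of m b] m(2)[of b] m(1) that by (auto simp: W_def order_le_less)
    have "(\<Sum>e\<in>W. (1 - h e) * (\<Prod>b\<in>{b\<in>W. e < b}. h b)) = 1 - (\<Prod>b\<in>W. h b)"
      by (rule less.hyps) (use less.prems W in auto)
    moreover have "{b\<in>V. e < b} = {b\<in>W. e < b}" if "e \<in> W" for e
      using lt[OF that] W by auto
    moreover have "{b\<in>V. m < b} = W" using lt W by auto
    ultimately have "(\<Sum>e\<in>V. (1 - h e) * (\<Prod>b\<in>{b\<in>V. e < b}. h b)) =
        (1 - h m) * (\<Prod>b\<in>W. h b) + (1 - (\<Prod>b\<in>W. h b))"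
      unfolding W(1) using W(2,3) by simp
    then show ?thesis unfolding W(1) using W(2,3) by (simp add: algebra_simps)
  qed simp
qed

context minuscule_heap
begin

text \<open>Passing to the subposet G is replaced by restricting the targets of excitations to G,
  while colors and \<open>color_succ\<close> still refer to P. For G = P these are the diagrams of
  the theorem (\<open>excited_diagrams_eq\<close>).\<close>

inductive_set excited :: "'a set \<Rightarrow> 'a set \<Rightarrow> 'a set set" for G F where
  base: "F \<in> excited G F"
| step: "D \<in> excited G F \<Longrightarrow> color_succ P c v u \<Longrightarrow> u \<in> D \<Longrightarrow> v \<in> G - D \<Longrightarrow>
    (\<And>n. n \<in> D \<Longrightarrow> v \<le> n \<Longrightarrow> n \<le> u \<Longrightarrow> \<not> adj (c n) (c u)) \<Longrightarrow>
    insert v (D - {u}) \<in> excited G F"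

text \<open>The positions that a new element of color \<open>i\<close>, minimal in the filter, may take below \<open>D\<close>.\<close>

definition slots :: "'a set \<Rightarrow> 'a set \<Rightarrow> 'i \<Rightarrow> 'a set" where
  "slots G D i = {e\<in>G. c e = i \<and> (\<forall>w\<in>D. c w = i \<or> adj (c w) i \<longrightarrow> e < w)}"

text \<open>An intrinsic description of the excited peaks, which makes their independence of the sequence
  of excitations evident: \<open>b\<close> is a peak if the next element of \<open>D\<close> below it that is not of a commuting
  color has the color of \<open>b\<close>.\<close>

definition peaks :: "'a set \<Rightarrow> 'a set" where
  "peaks D = {b\<in>P - D. \<exists>d\<in>D. d < b \<and> c d = c b \<and>
    (\<forall>w\<in>D. d \<le> w \<and> w \<le> b \<and> (c w = c b \<or> adj (c w) (c b)) \<longrightarrow> w = d)}"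

lemma excited_subset: "D \<in> excited G F \<Longrightarrow> F \<subseteq> G \<Longrightarrow> D \<subseteq> G"
  by (induction rule: excited.induct) auto

lemma finite_excited: "F \<subseteq> G \<Longrightarrow> G \<subseteq> P \<Longrightarrow> finite (excited G F)"
  using excited_subset finite_sub[of G] by (meson PowI finite_Pow_iff finite_subset subsetI)

lemma slots_not_in: "e \<in> slots G D i \<Longrightarrow> e \<notin> D"
  by (auto simp: slots_def)

text \<open>Excitations only lower elements, so a slot at a later stage was already a slot at the
  start. There a slot above f would belong to F - {f} and thus lie strictly below itself.\<close>

lemma slots_le:
  assumes "order_filter P F" "f \<in> minimal_elements F" "G \<subseteq> P" "D \<in> excited G (F - {f})"
    "e \<in> slots G D (c f)"
  shows "e \<le> f"
  using assms(4,5)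
proof (induction arbitrary: e rule: excited.induct)
  case base
  show ?case
  proof (rule ccontr)
    assume "\<not> e \<le> f"
    have eP: "e \<in> P" "c e = c f" "f \<in> P"
      using base assms(2,3) order_filter_subset[OF assms(1)] by (auto simp: slots_def minimal_elements_def)
    with \<open>\<not> e \<le> f\<close> have "f < e" using comparable_same[of e f] by auto
    then have "e \<in> F - {f}" using order_filterD[OF assms(1), of f e] assms(2) eP
      by (auto simp: minimal_elements_def)
    with base show False by (auto simp: slots_def)
  qed
next
  case (step D v u)
  have "e \<in> slots G D (c f)"
    unfolding slots_def
  proof (intro CollectI conjI ballI impI)
    fix w assume w: "w \<in> D" "c w = c f \<or> adj (c w) (c f)"
    show "e < w"
    proof (cases "w = u")
      case True
      have "c v = c u" "v < u" using step(2) by (auto simp: color_succ_def)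
      then have "e < v" using w True step.prems by (auto simp: slots_def)
      with \<open>v < u\<close> True show ?thesis by auto
    qed (use step.prems w in \<open>auto simp: slots_def\<close>)
  qed (use step.prems in \<open>auto simp: slots_def\<close>)
  then show ?case by (rule step.IH)
qed

text \<open>The element f descends through the occurrences of its color down to e. Nothing is in its
  way, since all elements of F - {f} of its color or an adjacent one lie above f.\<close>

lemma excited_insert_slot_base:
  assumes F: "order_filter P F" and f: "f \<in> minimal_elements F" and G: "order_filter P G" "F \<subseteq> G"
    and e: "e \<in> slots G (F - {f}) (c f)"
  shows "insert e (F - {f}) \<in> excited G F"
  using e
proof (induction "card {w\<in>P. e < w}" arbitrary: e rule: less_induct)
  case (less e)
  have FP: "F \<subseteq> P" and GP: "G \<subseteq> P" using F G order_filter_subset by auto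
  have fF: "f \<in> F" and min: "\<And>w. w \<in> F \<Longrightarrow> \<not> w < f" using f by (auto simp: minimal_elements_def)
  have eG: "e \<in> G" "c e = c f" using less.prems by (auto simp: slots_def)
  have ef: "e \<le> f" using slots_le[OF F f GP excited.base] less.prems by blast
  show ?case
  proof (cases "e = f")
    case True
    then show ?thesis using excited.base[of F G] fF by (simp add: insert_absorb)
  next
    case False
    then have "e < f" using ef by simp
    then obtain u where u: "color_succ P c e u" "u \<le> f"
      using obtain_color_succ_above[of e f] eG fF FP GP by blast
    have uP: "u \<in> P" "e < u" "c u = c f" using u eG by (auto simp: color_succ_def)
    have above: "f < w" if "w \<in> F - {f}" "c w = c f \<or> adj (c w) (c f)" for w
      using near_comparable[of w f] min[of w] that fF FP by (auto simp: order_le_less)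
    have "u \<in> slots G (F - {f}) (c f)"
      unfolding slots_def using u(2) uP above order_filterD[OF G(1) eG(1), of u]
      by (auto intro: order.strict_trans1)
    moreover have "card {w\<in>P. u < w} < card {w\<in>P. e < w}"
      by (rule psubset_card_mono) (use uP finite_P in auto)
    ultimately have IH: "insert u (F - {f}) \<in> excited G F" using less.hyps by blast
    have "u \<notin> F - {f}" using above[of u] u(2) uP less_le_not_le[of f u] by auto
    moreover have "e \<notin> F - {f}" using above[of e] \<open>e < f\<close> eG less_le_not_le[of e f] by auto
    moreover have "insert e (insert u (F - {f}) - {u}) \<in> excited G F"
    proof (rule excited.step[OF IH u(1)])
      show "\<not> adj (c n) (c u)" if "n \<in> insert u (F - {f})" "e \<le> n" "n \<le> u" for n
        using that above[of n] u(2) uP adj_irrefl by auto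
    qed (use eG \<open>e \<notin> F - {f}\<close> uP in auto)
    ultimately show ?thesis by simp
  qed
qed

text \<open>Excitations can be reordered so that f goes to its final position e before anything else
  moves. A slot of a later stage is one of every earlier stage, and e lies below the target v of any
  move of an adjacent color, hence outside the stretch that has to be free.\<close>

lemma excited_insert_slot:
  assumes F: "order_filter P F" and f: "f \<in> minimal_elements F" and G: "order_filter P G" "F \<subseteq> G"
    and D: "D \<in> excited G (F - {f})" and e: "e \<in> slots G D (c f)"
  shows "insert e D \<in> excited G F"
  using D e
proof (induction rule: excited.induct)
  case base
  then show ?case using excited_insert_slot_base[OF F f G] by blast
next
  case (step D v u)
  have GP: "G \<subseteq> P" using G order_filter_subset by auto
  have vu: "c v = c u" "v < u" using step(2) by (auto simp: color_succ_def)
  have lt: "e < w" if "w \<in> D" "c w = c f \<or> adj (c w) (c f)" for w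
  proof (cases "w = u")
    case True
    then have "e < v" using that step.prems vu by (auto simp: slots_def)
    with vu True show ?thesis by auto
  qed (use step.prems that in \<open>auto simp: slots_def\<close>)
  have eG: "e \<in> G" "c e = c f" using step.prems by (auto simp: slots_def)
  then have "e \<in> slots G D (c f)" using lt by (auto simp: slots_def)
  then have IH: "insert e D \<in> excited G F" by (rule step.IH)
  have e': "e \<notin> D" "e \<noteq> v" using lt eG step.prems by (auto simp: slots_def)
  have "insert v (insert e D - {u}) \<in> excited G F"
  proof (rule excited.step[OF IH step(2)])
    show "\<not> adj (c n) (c u)" if "n \<in> insert e D" "v \<le> n" "n \<le> u" for n
    proof (cases "n = e")
      case True
      show ?thesis
      proof
        assume "adj (c n) (c u)"
        then have "e < v" using True eG vu adj_sym step.prems by (auto simp: slots_def)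
        with that True show False by auto
      qed
    qed (use step that in auto)
  qed (use step e' in auto)
  moreover have "insert v (insert e D - {u}) = insert e (insert v (D - {u}))"
    using e' step(3) by auto
  ultimately show ?case by simp
qed

text \<open>The descendant e of f remains a slot. Its own moves lower it further, and an element u
  of its color or an adjacent one cannot jump over it: e would then lie between v and u, against
  consecutiveness or activity.\<close>

lemma excited_remove_slot:
  assumes F: "order_filter P F" and f: "f \<in> minimal_elements F" and G: "order_filter P G" "F \<subseteq> G"
    and D: "D \<in> excited G F"
  shows "\<exists>D'\<in>excited G (F - {f}). \<exists>e\<in>slots G D' (c f). D = insert e D'"
  using D
proof (induction rule: excited.induct)
  case base
  have fF: "f \<in> F" and min: "\<And>w. w \<in> F \<Longrightarrow> \<not> w < f" using f by (auto simp: minimal_elements_def)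
  have "f < w" if "w \<in> F - {f}" "c w = c f \<or> adj (c w) (c f)" for w
    using near_comparable[of w f] min[of w] that fF order_filter_subset[OF F] by (auto simp: order_le_less)
  then have "f \<in> slots G (F - {f}) (c f)" using fF G by (auto simp: slots_def)
  moreover have "F = insert f (F - {f})" using fF by auto
  ultimately show ?case using excited.base by blast
next
  case (step D v u)
  have GP: "G \<subseteq> P" using G order_filter_subset by auto
  have vu: "c v = c u" "v < u" using step(2) by (auto simp: color_succ_def)
  obtain D' e where D': "D' \<in> excited G (F - {f})" "e \<in> slots G D' (c f)" "D = insert e D'"
    using step.IH by blast
  have eG: "e \<in> G" "c e = c f" "e \<notin> D'" and lt: "\<And>w. w \<in> D' \<Longrightarrow> c w = c f \<or> adj (c w) (c f) \<Longrightarrow> e < w"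
    using D'(2) by (auto simp: slots_def)
  show ?case
  proof (cases "u = e")
    case True
    have "v \<in> slots G D' (c f)"
      using step(4) vu eG lt True by (auto simp: slots_def intro: order.strict_trans[of v e])
    moreover have "insert v (D - {u}) = insert v D'" using D' eG True by auto
    ultimately show ?thesis using D'(1) by blast
  next
    case False
    have "insert v (D' - {u}) \<in> excited G (F - {f})"
      by (rule excited.step[OF D'(1) step(2)]) (use step D' False in auto)
    moreover have "e < v" if near: "c u = c f \<or> adj (c u) (c f)"
    proof -
      have eu: "e < u" using lt[of u] near step(3) D' False by auto
      have ve: "v \<noteq> e" using step(4) D' by auto
      have "\<not> v < e"
      proof
        assume ve: "v < e"
        have "e \<in> P" "e \<in> D" using eG GP D' by auto
        from near show False
        proof
          assume "c u = c f"
          then show False using step(2) \<open>e \<in> P\<close> ve eu eG by (simp add: color_succ_def)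
        next
          assume "adj (c u) (c f)"
          then show False using step(5)[OF \<open>e \<in> D\<close> less_imp_le less_imp_le] ve eu eG adj_sym by auto
        qed
      qed
      moreover have "e \<in> P" "v \<in> P" "c e = c v \<or> adj (c e) (c v)"
        using near vu(1) eG step(4) GP adj_sym[of "c u" "c f"] by auto
      ultimately show ?thesis using near_comparable[of e v] ve by (simp add: order_le_less)
    qed
    then have "e \<in> slots G (insert v (D' - {u})) (c f)"
      using eG lt vu by (auto simp: slots_def)
    moreover have "insert v (D - {u}) = insert e (insert v (D' - {u}))" using D' False by auto
    ultimately show ?thesis by blast
  qed
qed

section \<open>Peaks and weighted sums of excited diagrams\<close>

lemma peaks_subset: "order_filter P G \<Longrightarrow> D \<subseteq> G \<Longrightarrow> peaks D \<subseteq> G"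
  unfolding peaks_def using order_filterD[of P G] by (blast dest: less_imp_le)

text \<open>With e as witness, b is a peak iff no element of D of color i or an adjacent one lies
  below b, and by comparability this makes b a slot. Old peaks survive: a witness d whose color is
  near i lies above e, so e does not come between d and its peak.\<close>

lemma peaks_insert_slot:
  assumes G: "order_filter P G" and D: "D \<subseteq> G" and e: "e \<in> slots G D i"
  shows "peaks (insert e D) = peaks D \<union> {b\<in>slots G D i. e < b}"
proof (intro set_eqI iffI)
  have GP: "G \<subseteq> P" using G order_filter_subset by auto
  have eG: "e \<in> G" "c e = i" "e \<notin> D" and lt: "\<And>w. w \<in> D \<Longrightarrow> c w = i \<or> adj (c w) i \<Longrightarrow> e < w"
    using e by (auto simp: slots_def)
  fix b
  {
    assume "b \<in> peaks (insert e D)"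
    then obtain d where b: "b \<in> P" "b \<noteq> e" "b \<notin> D" and d: "d \<in> insert e D" "d < b" "c d = c b"
      and all: "\<And>w. w \<in> insert e D \<Longrightarrow> d \<le> w \<Longrightarrow> w \<le> b \<Longrightarrow> c w = c b \<or> adj (c w) (c b) \<Longrightarrow> w = d"
      by (auto simp: peaks_def)
    show "b \<in> peaks D \<union> {b\<in>slots G D i. e < b}"
    proof (cases "d = e")
      case True
      have "b < w" if w: "w \<in> D" "c w = i \<or> adj (c w) i" for w
        using all[of w] lt[OF w] near_comparable[of w b] w b d eG True D GP
        by (auto simp: order_le_less)
      then have "b \<in> slots G D i" using order_filterD[OF G eG(1), of b] b d eG True
        by (auto simp: slots_def)
      with d True show ?thesis by auto
    next
      case False
      then have "b \<in> peaks D" using b d all by (auto simp: peaks_def)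
      then show ?thesis by simp
    qed
  next
    assume b: "b \<in> peaks D \<union> {b\<in>slots G D i. e < b}"
    show "b \<in> peaks (insert e D)"
    proof (cases "b \<in> peaks D")
      case True
      then obtain d where b: "b \<in> P" "b \<notin> D" and d: "d \<in> D" "d < b" "c d = c b"
        and all: "\<And>w. w \<in> D \<Longrightarrow> d \<le> w \<Longrightarrow> w \<le> b \<Longrightarrow> c w = c b \<or> adj (c w) (c b) \<Longrightarrow> w = d"
        by (auto simp: peaks_def)
      have no: "\<not> (d \<le> e \<and> (c e = c b \<or> adj (c e) (c b)))"
        using lt[OF d(1)] d eG adj_sym by auto
      then have "b \<noteq> e" using d by auto
      then show ?thesis using b d all no unfolding peaks_def by auto
    next
      case False
      then have b: "b \<in> G" "c b = i" "e < b" "b \<notin> D" "\<And>w. w \<in> D \<Longrightarrow> c w = i \<or> adj (c w) i \<Longrightarrow> b < w"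
        using b by (auto simp: slots_def)
      then have "b \<in> P - insert e D" using GP by auto
      moreover have "w = e" if "w \<in> insert e D" "w \<le> b" "c w = c b \<or> adj (c w) (c b)" for w
        using b(2) b(5)[of w] that leD[of w b] by blast
      ultimately show ?thesis using b(2,3) eG(2) unfolding peaks_def
        by (auto intro!: bexI[of _ e])
    qed
  }
qed

lemma peaks_disjoint_slots: "peaks D \<inter> slots G D i = {}"
  by (auto simp: peaks_def slots_def dest: order.asym)

text \<open>This is the term of the formula times the product of 1 - h over P, which leaves the
  factors over D. No division occurs, and the weight does not depend on G, so sums over G and G -
  {q} can be compared term by term.\<close>

definition excited_weight :: "('a \<Rightarrow> 'f::comm_ring_1) \<Rightarrow> 'a set \<Rightarrow> 'f" where
  "excited_weight h D = (\<Prod>b\<in>peaks D. h b) * (\<Prod>d\<in>D. 1 - h d)"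

definition excited_sum :: "'a set \<Rightarrow> ('a \<Rightarrow> 'f::comm_ring_1) \<Rightarrow> 'a set \<Rightarrow> 'f" where
  "excited_sum G h F = (\<Sum>D\<in>excited G F. excited_weight h D)"

lemma excited_weight_cong:
  assumes "order_filter P G" "D \<subseteq> G" "\<And>u. u \<in> G \<Longrightarrow> h u = h' u"
  shows "excited_weight h D = excited_weight h' D"
proof -
  have "(\<Prod>b\<in>peaks D. h b) = (\<Prod>b\<in>peaks D. h' b)"
    using peaks_subset[OF assms(1,2)] assms(3) by (intro prod.cong refl) blast
  moreover have "(\<Prod>d\<in>D. 1 - h d) = (\<Prod>d\<in>D. 1 - h' d)"
    using assms(2,3) by (intro prod.cong refl) auto
  ultimately show ?thesis by (simp only: excited_weight_def)
qed

lemma excited_sum_cong: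
  assumes "order_filter P G" "F \<subseteq> G" "\<And>u. u \<in> G \<Longrightarrow> h u = h' u"
  shows "excited_sum G h F = excited_sum G h' F"
  unfolding excited_sum_def
proof (rule sum.cong[OF refl])
  fix D assume "D \<in> excited G F"
  then show "excited_weight h D = excited_weight h' D"
    by (intro excited_weight_cong[OF assms(1) excited_subset[OF _ assms(2)]] assms(3))
qed

text \<open>A diagram determines its slot, since two different slots would each lie strictly below
  the other. The sum over the slots of a fixed D telescopes to the bracket.\<close>

lemma excited_sum_remove_minimal:
  assumes F: "order_filter P F" and f: "f \<in> minimal_elements F" and G: "order_filter P G" "F \<subseteq> G"
  shows "excited_sum G h F =
    (\<Sum>D\<in>excited G (F - {f}). excited_weight h D * (1 - (\<Prod>e\<in>slots G D (c f). h e)))"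
proof -
  have GP: "G \<subseteq> P" using G order_filter_subset by auto
  have FfG: "F - {f} \<subseteq> G" using G by auto
  let ?S = "SIGMA D:excited G (F - {f}). slots G D (c f)"
  have fin_slots: "finite (slots G D i)" for D i
    using finite_sub[OF GP] by (auto simp: slots_def)
  have D: "D \<subseteq> G" "finite D" if "D \<in> excited G (F - {f})" for D
    using excited_subset[OF that FfG] finite_sub[of D] GP by auto
  have "bij_betw (\<lambda>(D, e). insert e D) ?S (excited G F)"
    unfolding bij_betw_def
  proof
    show "inj_on (\<lambda>(D, e). insert e D) ?S"
    proof (intro inj_onI, clarify)
      fix D e D' e'
      assume e: "e \<in> slots G D (c f)" and e': "e' \<in> slots G D' (c f)" and eq: "insert e D = insert e' D'"
      have "e = e'"
      proof (rule ccontr)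
        assume "e \<noteq> e'"
        then have "e \<in> D'" "e' \<in> D" using eq by auto
        then have "e < e'" "e' < e" using e e' by (auto simp: slots_def)
        then show False by auto
      qed
      moreover have "D = D'" using eq slots_not_in[OF e] slots_not_in[OF e'] \<open>e = e'\<close> by auto
      ultimately show "D = D' \<and> e = e'" by simp
    qed
    show "(\<lambda>(D, e). insert e D) ` ?S = excited G F"
      using excited_insert_slot[OF F f G] excited_remove_slot[OF F f G] by (fastforce simp: image_iff)
  qed
  then have "excited_sum G h F = (\<Sum>(D, e)\<in>?S. excited_weight h (insert e D))"
    unfolding excited_sum_def by (subst sum.reindex_bij_betw[symmetric]) (auto simp: case_prod_unfold)
  also have "\<dots> = (\<Sum>D\<in>excited G (F - {f}). \<Sum>e\<in>slots G D (c f). excited_weight h (insert e D))"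
    by (rule sum.Sigma[symmetric]) (use finite_excited[OF FfG GP] fin_slots in auto)
  also have "\<dots> = (\<Sum>D\<in>excited G (F - {f}). excited_weight h D * (1 - (\<Prod>e\<in>slots G D (c f). h e)))"
  proof (rule sum.cong[OF refl])
    fix D assume DE: "D \<in> excited G (F - {f})"
    have "excited_weight h (insert e D) =
        excited_weight h D * ((1 - h e) * (\<Prod>b\<in>{b\<in>slots G D (c f). e < b}. h b))"
      if e: "e \<in> slots G D (c f)" for e
    proof -
      have "finite (peaks D)" using finite_P by (auto simp: peaks_def)
      then have "(\<Prod>b\<in>peaks (insert e D). h b) = (\<Prod>b\<in>peaks D. h b) * (\<Prod>b\<in>{b\<in>slots G D (c f). e < b}. h b)"
        unfolding peaks_insert_slot[OF G(1) D(1)[OF DE] e] using peaks_disjoint_slots[of D G "c f"] fin_slots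
        by (intro prod.union_disjoint) auto
      then show ?thesis using slots_not_in[OF e] D(2)[OF DE]
        by (simp add: excited_weight_def mult_ac)
    qed
    then have "(\<Sum>e\<in>slots G D (c f). excited_weight h (insert e D)) = excited_weight h D *
        (\<Sum>e\<in>slots G D (c f). (1 - h e) * (\<Prod>b\<in>{b\<in>slots G D (c f). e < b}. h b))"
      by (simp add: sum_distrib_left)
    also have "(\<Sum>e\<in>slots G D (c f). (1 - h e) * (\<Prod>b\<in>{b\<in>slots G D (c f). e < b}. h b)) =
        1 - (\<Prod>e\<in>slots G D (c f). h e)"
    proof (rule sum_telescope_chain[OF fin_slots])
      fix x y assume "x \<in> slots G D (c f)" "y \<in> slots G D (c f)"
      then have "x \<in> P" "y \<in> P" "c x = c y" using GP by (auto simp: slots_def)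
      then show "x \<le> y \<or> y \<le> x" using near_comparable[of x y] by blast
    qed
    finally show "(\<Sum>e\<in>slots G D (c f). excited_weight h (insert e D)) =
        excited_weight h D * (1 - (\<Prod>e\<in>slots G D (c f). h e))" .
  qed
  finally show ?thesis .
qed

text \<open>Nothing in G lies below q, so an element that has reached q stays there. A diagram
  avoiding q has therefore never visited q on the way.\<close>

lemma excited_remove_minimal:
  assumes q: "q \<in> minimal_elements G" and F: "F \<subseteq> G - {q}"
  shows "excited (G - {q}) F = {D\<in>excited G F. q \<notin> D}"
proof (intro set_eqI iffI)
  fix D assume D: "D \<in> excited (G - {q}) F"
  then have "D \<in> excited G F"
    by (induction rule: excited.induct) (auto intro: excited.intros)
  with excited_subset[OF D F] show "D \<in> {D\<in>excited G F. q \<notin> D}" by auto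
next
  fix D assume "D \<in> {D\<in>excited G F. q \<notin> D}"
  then have "D \<in> excited G F" "q \<notin> D" by auto
  then show "D \<in> excited (G - {q}) F"
  proof (induction rule: excited.induct)
    case (step D v u)
    have "v < u" "v \<in> G" using step by (auto simp: color_succ_def)
    then have "u \<noteq> q" using q by (auto simp: minimal_elements_def)
    then have "q \<notin> D" "v \<noteq> q" using step.prems by auto
    with step show ?case by (intro excited.step) auto
  qed (rule excited.base)
qed

text \<open>The element q of F has no place to go: its only slot is q, and there is none once an
  element of F - {q} has descended to q. Hence only the diagrams of F - {q} that avoid q
  contribute.\<close>

lemma excited_sum_minimal_in:
  assumes F: "order_filter P F" and G: "order_filter P G" "F \<subseteq> G"
    and q: "q \<in> minimal_elements G" "q \<in> F"
  shows "excited_sum G h F = (1 - h q) * excited_sum (G - {q}) h (F - {q})"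
proof -
  have GP: "G \<subseteq> P" using G order_filter_subset by auto
  have qF: "q \<in> minimal_elements F" using q G by (auto simp: minimal_elements_def)
  have FqG: "F - {q} \<subseteq> G - {q}" using G by auto
  have slot: "slots G D (c q) = (if q \<in> D then {} else {q})" if D: "D \<in> excited G (F - {q})" for D
  proof (cases "q \<in> D")
    case True
    then show ?thesis using q by (auto simp: slots_def minimal_elements_def)
  next
    case False
    have "D \<subseteq> G" using excited_subset[OF D] G by auto
    then have "q < w" if "w \<in> D" "c w = c q \<or> adj (c w) (c q)" for w
      using near_comparable[of w q] that False q GP by (auto simp: minimal_elements_def order_le_less)
    moreover have "e = q" if "e \<in> slots G D (c q)" for e
      using slots_le[OF F qF GP D that] that q by (auto simp: slots_def minimal_elements_def order_le_less)
    ultimately show ?thesis using False q by (auto simp: slots_def minimal_elements_def)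
  qed
  have "excited_sum G h F =
      (\<Sum>D\<in>excited G (F - {q}). if q \<notin> D then (1 - h q) * excited_weight h D else 0)"
    unfolding excited_sum_remove_minimal[OF F qF G]
    by (rule sum.cong[OF refl]) (simp add: slot mult.commute)
  also have "\<dots> = (\<Sum>D\<in>excited (G - {q}) (F - {q}). (1 - h q) * excited_weight h D)"
    unfolding excited_remove_minimal[OF q(1) FqG]
    using finite_excited[of "F - {q}" G] G GP by (intro sum.inter_filter[symmetric]) auto
  finally show ?thesis by (simp add: excited_sum_def sum_distrib_left)
qed

text \<open>A diagram containing q leaves no slot. For the others q is an additional slot, and with
  S the product over the slots in G - {q} the bracket becomes 1 - h q S = h q (1 - S) + (1 - h q).
  The first term reassembles F, the second keeps F - {f}.\<close>

lemma excited_sum_minimal_slot: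
  assumes F: "order_filter P F" and f: "f \<in> minimal_elements F" and G: "order_filter P G" "F \<subseteq> G"
    and q: "q \<in> minimal_elements G" "q \<notin> F" "c q = c f"
  shows "excited_sum G h F =
    h q * excited_sum (G - {q}) h F + (1 - h q) * excited_sum (G - {q}) h (F - {f})"
proof -
  have GP: "G \<subseteq> P" using G order_filter_subset by auto
  have FG: "F \<subseteq> G - {q}" "F - {f} \<subseteq> G - {q}" using G q by auto
  have G': "order_filter P (G - {q})" using order_filter_remove_minimal[OF G(1) q(1)] .
  have slot1: "slots G D (c f) = {}" if "q \<in> D" for D
    using that q by (auto simp: slots_def minimal_elements_def)
  have slot2: "(\<Prod>e\<in>slots G D (c f). h e) = h q * (\<Prod>e\<in>slots (G - {q}) D (c f). h e)"
    if D: "D \<in> excited G (F - {f})" "q \<notin> D" for D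
  proof -
    have "D \<subseteq> G" using excited_subset[OF D(1)] G by auto
    then have "q < w" if "w \<in> D" "c w = c q \<or> adj (c w) (c q)" for w
      using near_comparable[of w q] that D(2) q GP by (auto simp: minimal_elements_def order_le_less)
    then have "slots G D (c f) = insert q (slots (G - {q}) D (c f))"
      using q by (auto simp: slots_def minimal_elements_def)
    then show ?thesis using finite_sub[OF GP] by (simp add: slots_def)
  qed
  let ?E = "excited (G - {q}) (F - {f})"
  have "excited_sum G h F = (\<Sum>D\<in>excited G (F - {f}).
      if q \<notin> D then excited_weight h D * (1 - h q * (\<Prod>e\<in>slots (G - {q}) D (c f). h e)) else 0)"
    unfolding excited_sum_remove_minimal[OF F f G]
    by (rule sum.cong[OF refl]) (simp add: slot1 slot2)
  also have "\<dots> = (\<Sum>D\<in>?E. excited_weight h D * (1 - h q * (\<Prod>e\<in>slots (G - {q}) D (c f). h e)))"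
    unfolding excited_remove_minimal[OF q(1) FG(2)]
    using finite_excited[of "F - {f}" G] G GP by (intro sum.inter_filter[symmetric]) auto
  also have "\<dots> = (\<Sum>D\<in>?E. h q * (excited_weight h D * (1 - (\<Prod>e\<in>slots (G - {q}) D (c f). h e))) +
      (1 - h q) * excited_weight h D)"
    by (rule sum.cong[OF refl]) (simp add: algebra_simps)
  finally show ?thesis
    unfolding excited_sum_remove_minimal[OF F f G' FG(1)]
    by (simp add: excited_sum_def sum_distrib_left sum.distrib)
qed

text \<open>Invariant: every element of D of the color of q has a neighbour in D below it. In F a
  lower cover provides it; an excitation preserves it, because a neighbour below u is either already
  below v or would block the move. A minimal element of G cannot satisfy it, so q is never
  reached.\<close>

lemma excited_sum_minimal_none:
  assumes F: "order_filter P F" and G: "order_filter P G" "F \<subseteq> G"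
    and q: "q \<in> minimal_elements G" "q \<notin> F"
    and no: "\<And>f. f \<in> minimal_elements F \<Longrightarrow> c f \<noteq> c q"
  shows "excited_sum G h F = excited_sum (G - {q}) h F"
proof -
  have FP: "F \<subseteq> P" using F order_filter_subset by auto
  have "\<forall>e\<in>D. c e = c q \<longrightarrow> (\<exists>n\<in>D. adj (c n) (c q) \<and> n < e)" if "D \<in> excited G F" for D
    using that
  proof (induction rule: excited.induct)
    case base
    show ?case
    proof (intro ballI impI)
      fix e assume e: "e \<in> F" "c e = c q"
      then obtain w where w: "w \<in> F" "w < e" using no[of e] by (auto simp: minimal_elements_def)
      then obtain z where z: "covers P e z" "w \<le> z"
        using finite_lower_cover[OF finite_P, of w e] e FP by blast
      then have "z \<in> F" using order_filterD[OF F w(1)] by (auto simp: covers_def)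
      then show "\<exists>n\<in>F. adj (c n) (c q) \<and> n < e"
        using z covers_adj[OF z(1)] e by (auto simp: covers_def)
    qed
  next
    case (step D v u)
    have vu: "c v = c u" "v < u" "v \<in> P" using step(2) by (auto simp: color_succ_def)
    have DP: "D \<subseteq> P" using excited_subset[OF step(1) G(2)] G order_filter_subset by blast
    show ?case
    proof (intro ballI impI)
      fix e assume e: "e \<in> insert v (D - {u})" "c e = c q"
      show "\<exists>n\<in>insert v (D - {u}). adj (c n) (c q) \<and> n < e"
      proof (cases "e = v")
        case True
        then obtain n where n: "n \<in> D" "adj (c n) (c q)" "n < u"
          using step.IH step(3) vu e by metis
        have "n \<noteq> u" using n by auto
        have "\<not> v \<le> n" using step(5)[of n, OF _ _ less_imp_le] n True vu e by auto
        then have "n < v" using comparable_adj[of n v] n True e vu DP by (auto simp: order_le_less)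
        then show ?thesis using n True \<open>n \<noteq> u\<close> by blast
      next
        case False
        then obtain n where n: "n \<in> D" "adj (c n) (c q)" "n < e" using step.IH e by auto
        show ?thesis
        proof (cases "n = u")
          case True
          then show ?thesis using n vu by (intro bexI[of _ v]) auto
        qed (use n in auto)
      qed
    qed
  qed
  then have "q \<notin> D" if "D \<in> excited G F" for D
    using that q(1) excited_subset[OF that G(2)] unfolding minimal_elements_def by blast
  then have "excited (G - {q}) F = excited G F"
    using excited_remove_minimal[OF q(1), of F] G q(2) by auto
  then show ?thesis by (simp add: excited_sum_def)
qed

end

section \<open>Reflections and the Chevalley relation\<close>

lemma maximal_elements_remove_minimal:
  assumes "q \<in> minimal_elements G"
  shows "maximal_elements (G - F - {q}) = maximal_elements (G - F) - {q}"
  using assms by (auto simp: maximal_elements_def minimal_elements_def)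

lemma signed_sum_Pow_split:
  fixes g :: "'a set \<Rightarrow> 'b::comm_ring_1"
  assumes "finite M" "p \<in> M"
  shows "(\<Sum>A\<in>Pow M. (- 1) ^ card A * g A) = (\<Sum>A\<in>Pow (M - {p}). (- 1) ^ card A * (g A - g (insert p A)))"
proof -
  have M: "Pow M = Pow (M - {p}) \<union> insert p ` Pow (M - {p})"
    using assms Pow_insert[of p "M - {p}"] by (simp add: insert_absorb)
  have "(\<Sum>A\<in>Pow M. (- 1) ^ card A * g A) =
      (\<Sum>A\<in>Pow (M - {p}). (- 1) ^ card A * g A) + (\<Sum>A\<in>insert p ` Pow (M - {p}). (- 1) ^ card A * g A)"
    unfolding M by (rule sum.union_disjoint) (use assms in auto)
  also have "(\<Sum>A\<in>insert p ` Pow (M - {p}). (- 1) ^ card A * g A) =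
      (\<Sum>A\<in>Pow (M - {p}). (- 1) ^ card (insert p A) * g (insert p A))"
    by (rule sum.reindex[unfolded o_def]) (auto simp: inj_on_def)
  also have "\<dots> = (\<Sum>A\<in>Pow (M - {p}). - ((- 1) ^ card A * g (insert p A)))"
  proof (rule sum.cong[OF refl])
    fix A assume "A \<in> Pow (M - {p})"
    then have "card (insert p A) = Suc (card A)"
      using assms finite_subset[of A M] by (intro card_insert_disjoint) auto
    then show "(- 1) ^ card (insert p A) * g (insert p A) = - ((- 1) ^ card A * g (insert p A))"
      by simp
  qed
  finally show ?thesis by (simp add: sum_negf sum_subtractf right_diff_distrib)
qed

context minuscule_heap
begin

definition reflect :: "'i \<Rightarrow> ('i \<Rightarrow> 'f::field) \<Rightarrow> 'i \<Rightarrow> 'f" where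
  "reflect i z j = (if j = i then inverse (z i) else if adj j i then z i * z j else z j)"

definition monomial :: "('i \<Rightarrow> 'f::field) \<Rightarrow> 'a set \<Rightarrow> 'f" where
  "monomial z Q = (\<Prod>w\<in>Q. z (c w))"

lemma reflect_nonzero: "(\<And>j. z j \<noteq> 0) \<Longrightarrow> reflect i z j \<noteq> 0"
  by (simp add: reflect_def)

lemma reflect_self: "reflect i z i = inverse (z i)"
  by (simp add: reflect_def)

text \<open>The reflection subtracts from the exponent of z i the product of the exponent vector
  with the root of i, that is, twice the number of occurrences minus the number of neighbours.
  Splitting this between the two sides keeps the exponents natural.\<close>

lemma monomial_reflect:
  assumes "finite Q" "z i \<noteq> 0"
  shows "monomial (reflect i z) Q * z i ^ (2 * card {w\<in>Q. c w = i}) =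
    monomial z Q * z i ^ card {w\<in>Q. adj (c w) i}"
  using assms(1)
proof (induction Q)
  case (insert x Q)
  have 1: "{w\<in>insert x Q. c w = i} = (if c x = i then insert x {w\<in>Q. c w = i} else {w\<in>Q. c w = i})"
    and 2: "{w\<in>insert x Q. adj (c w) i} =
      (if adj (c x) i then insert x {w\<in>Q. adj (c w) i} else {w\<in>Q. adj (c w) i})"
    by auto
  have IH: "monomial (reflect i z) Q * z i ^ (2 * card {w\<in>Q. c w = i}) =
    monomial z Q * z i ^ card {w\<in>Q. adj (c w) i}" by (rule insert.IH)
  have m: "monomial y (insert x Q) = y (c x) * monomial y Q" for y
    using insert.hyps by (simp add: monomial_def)
  consider "c x = i" | "c x \<noteq> i" "adj (c x) i" | "c x \<noteq> i" "\<not> adj (c x) i" by blast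
  then show ?case
  proof cases
    case 1
    have "monomial (reflect i z) (insert x Q) * z i ^ (2 * card {w\<in>insert x Q. c w = i}) =
        inverse (z i) * monomial (reflect i z) Q * (z i ^ 2 * z i ^ (2 * card {w\<in>Q. c w = i}))"
      unfolding m \<open>{w\<in>insert x Q. c w = i} = _\<close> using 1 insert.hyps
      by (simp add: reflect_self power2_eq_square)
    also have "\<dots> = z i * (monomial (reflect i z) Q * z i ^ (2 * card {w\<in>Q. c w = i}))"
      using assms(2) by (simp add: power2_eq_square)
    finally show ?thesis unfolding IH m 2 using 1 adj_irrefl by simp
  next
    case 2
    have "monomial (reflect i z) (insert x Q) * z i ^ (2 * card {w\<in>insert x Q. c w = i}) =
        z i * z (c x) * (monomial (reflect i z) Q * z i ^ (2 * card {w\<in>Q. c w = i}))"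
      unfolding m 1 using 2 by (simp add: reflect_def)
    then show ?thesis unfolding IH m \<open>{w\<in>insert x Q. adj (c w) i} = _\<close> using 2 insert.hyps by simp
  next
    case 3
    have "monomial (reflect i z) (insert x Q) * z i ^ (2 * card {w\<in>insert x Q. c w = i}) =
        z (c x) * (monomial (reflect i z) Q * z i ^ (2 * card {w\<in>Q. c w = i}))"
      unfolding m 1 using 3 by (simp add: reflect_def)
    then show ?thesis unfolding IH m 2 using 3 by simp
  qed
qed (simp add: monomial_def)

text \<open>Let d be the number of neighbours above p. No element of G lies below q, so G - F has
  product 2 - d with the root of i, and reflection divides the monomial by that power of z i.
  Dropping q, whose reflected variable is inverse, restores one factor. The net exponent is d -
  1.\<close>

lemma monomial_reflect_remove_minimal:
  fixes z :: "'i \<Rightarrow> 'f::field"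
  assumes F: "order_filter P F" and G: "order_filter P G" "F \<subseteq> G"
    and q: "q \<in> minimal_elements G" "q \<notin> F" and z: "z (c q) \<noteq> 0"
    and p: "p \<in> G - F" "c p = c q" "\<And>w. w \<in> G - F \<Longrightarrow> c w = c q \<Longrightarrow> w \<le> p"
  shows "monomial (reflect (c q) z) (G - F - {q}) * z (c q) =
    z (c q) ^ card {n\<in>G - F. adj (c n) (c q) \<and> p < n} * monomial z (G - F)"
proof -
  define K i where "K = G - F" and "i = c q"
  have GP: "G \<subseteq> P" using G order_filter_subset by blast
  have KP: "K \<subseteq> P" and finK: "finite K" using GP finite_sub[of K] by (auto simp: K_def)
  have qK: "q \<in> K" using q by (auto simp: K_def minimal_elements_def)
  have bot: "q \<le> w" if "w \<in> K" "c w = i" for w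
    using comparable_same[of q w] that q subsetD[OF KP qK] subsetD[OF KP that(1)] by (auto simp: K_def i_def minimal_elements_def)
  have low: "card {n\<in>K. adj (c n) i \<and> n < q} = 0"
    using q by (auto simp: K_def card_eq_0_iff minimal_elements_def)
  define r d N where "r = card {w\<in>K. c w = i}" and "d = card {n\<in>K. adj (c n) i \<and> p < n}"
    and "N = card {n\<in>K. adj (c n) i}"
  have "card {n\<in>K. adj (c n) i} + 2 =
      2 * card {w\<in>K. c w = i} + card {n\<in>K. adj (c n) i \<and> p < n} + card {n\<in>K. adj (c n) i \<and> n < q}"
    by (rule card_adj_convex) (use convex_Diff[OF G(1) F] p qK bot in \<open>auto simp: K_def i_def\<close>)
  then have N: "N + 2 = 2 * r + d"
    using low unfolding N_def r_def d_def by linarith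
  have "monomial (reflect i z) K = inverse (z i) * monomial (reflect i z) (K - {q})"
    using prod.remove[OF finK qK, of "\<lambda>w. reflect i z (c w)"] by (simp add: monomial_def i_def reflect_self)
  then have "monomial (reflect i z) (K - {q}) = z i * monomial (reflect i z) K"
    using z by (simp add: i_def)
  then have "(monomial (reflect i z) (K - {q}) * z i) * z i ^ (2 * r) = z i ^ 2 * (monomial z K * z i ^ N)"
    using monomial_reflect[OF finK, of z i] z by (simp add: r_def N_def i_def power2_eq_square)
  also have "\<dots> = monomial z K * z i ^ (N + 2)" by (simp add: power_add power2_eq_square)
  also have "\<dots> = (z i ^ d * monomial z K) * z i ^ (2 * r)" unfolding N by (simp add: power_add)
  finally show ?thesis using z by (simp add: K_def i_def d_def)
qed

text \<open>Here p and f are consecutive. As f is minimal in the filter F, the neighbours between p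
  and f are exactly the neighbours above p in G - F.\<close>

lemma slot_pair_count:
  assumes F: "order_filter P F" and G: "order_filter P G" "F \<subseteq> G"
    and p: "p \<in> G - F" "c p = i" "\<And>w. w \<in> G - F \<Longrightarrow> c w = i \<Longrightarrow> w \<le> p"
    and f: "f \<in> minimal_elements F" "c f = i"
  shows "card {n\<in>G - F. adj (c n) i \<and> p < n} = 2"
proof -
  have FP: "F \<subseteq> P" and GP: "G \<subseteq> P" using F G order_filter_subset by auto
  have fF: "f \<in> F" and min: "\<And>w. w \<in> F \<Longrightarrow> \<not> w < f" using f by (auto simp: minimal_elements_def)
  have fP: "f \<in> P" "p \<in> P" using fF FP p GP by auto
  have pf: "p < f"
    using comparable_same[of p f] fP p(1,2) f(2) fF order_filterD[OF F fF, of p, OF _ less_imp_le] by auto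
  have "color_succ P c p f"
    unfolding color_succ_def
  proof (intro conjI ballI impI)
    fix w assume w: "w \<in> P" "p < w \<and> w < f"
    show "c w \<noteq> c f"
    proof
      assume "c w = c f"
      moreover have "w \<in> G - F" using w min order_filterD[OF G(1), of p w, OF _ _ less_imp_le] p(1) by auto
      ultimately show False using p(3)[of w] f(2) w by (auto dest: leD)
    qed
  qed (use fP pf p f in auto)
  moreover have "{n\<in>G - F. adj (c n) i \<and> p < n} = {n\<in>P. p < n \<and> n < f \<and> adj (c n) (c p)}"
  proof (intro set_eqI iffI)
    fix n assume n: "n \<in> {n\<in>G - F. adj (c n) i \<and> p < n}"
    then have "n \<in> P" "adj (c n) (c f)" using GP f by auto
    then have "n < f"
      using comparable_adj[of n f] fP n order_filterD[OF F fF, of n, OF _ less_imp_le] by auto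
    then show "n \<in> {n\<in>P. p < n \<and> n < f \<and> adj (c n) (c p)}" using n \<open>n \<in> P\<close> p by auto
  next
    fix n assume n: "n \<in> {n\<in>P. p < n \<and> n < f \<and> adj (c n) (c p)}"
    then show "n \<in> {n\<in>G - F. adj (c n) i \<and> p < n}"
      using order_filterD[OF G(1), of p n, OF _ _ less_imp_le] min p by auto
  qed
  ultimately show ?thesis using color_succ_card[of p f] by simp
qed

text \<open>With two neighbours above it, p is not the top of its color in P. The next occurrence f
  lies in F, and the only two neighbours between p and f are outside F. So no lower cover of f is in
  F, and f would be minimal there.\<close>

lemma no_slot_count:
  assumes F: "order_filter P F" and G: "order_filter P G" "F \<subseteq> G"
    and p: "p \<in> G - F" "c p = i" "\<And>w. w \<in> G - F \<Longrightarrow> c w = i \<Longrightarrow> w \<le> p"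
    and no: "\<And>f. f \<in> minimal_elements F \<Longrightarrow> c f \<noteq> i"
  shows "card {n\<in>G - F. adj (c n) i \<and> p < n} \<le> 1"
proof (rule ccontr)
  let ?S = "{n\<in>G - F. adj (c n) i \<and> p < n}"
  assume S: "\<not> card ?S \<le> 1"
  have FP: "F \<subseteq> P" and GP: "G \<subseteq> P" using F G order_filter_subset by auto
  have pP: "p \<in> P" using p GP by auto
  show False
  proof (cases "\<exists>w\<in>P. p < w \<and> c w = c p")
    case False
    then have "card {n\<in>P. p < n \<and> adj (c n) (c p)} \<le> 1" using color_top_card[OF pP] by blast
    moreover have "card ?S \<le> card {n\<in>P. p < n \<and> adj (c n) (c p)}"
      by (rule card_mono) (use GP p finite_P in auto)
    ultimately show False using S by simp
  next
    case True
    then obtain f where f: "color_succ P c p f" using obtain_color_succ_above[OF pP] by metis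
    then have fP: "f \<in> P" "p < f" "c f = i" using p by (auto simp: color_succ_def)
    then have "f \<in> G" using order_filterD[OF G(1), of p f] p by auto
    then have fF: "f \<in> F" using p(3)[of f] fP by (auto dest: leD)
    let ?T = "{n\<in>P. p < n \<and> n < f \<and> adj (c n) (c p)}"
    have "n < f" if n: "n \<in> ?S" for n
    proof -
      have "n \<in> P" "adj (c n) (c f)" using n GP fP by auto
      then show ?thesis
        using comparable_adj[of n f] fP n order_filterD[OF F fF, of n, OF _ less_imp_le] by auto
    qed
    then have "?S \<subseteq> ?T" using GP p by auto
    moreover have "finite ?T" using finite_P by auto
    moreover have "card ?T = 2" using color_succ_card[OF f] .
    ultimately have ST: "?S = ?T" using S by (intro card_seteq) auto
    have "f \<in> minimal_elements F"
      unfolding minimal_elements_def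
    proof (intro CollectI conjI fF notI)
      assume "\<exists>y\<in>F. y < f"
      then obtain w where w: "w \<in> F" "w < f" by blast
      obtain z where z: "covers P f z" "w \<le> z"
        using finite_lower_cover[OF finite_P, of w f] w FP fP by blast
      have zP: "z \<in> P" "z < f" "adj (c z) (c p)" using z covers_adj[OF z(1)] fP p by (auto simp: covers_def)
      have "z \<in> F" using order_filterD[OF F w(1) zP(1) z(2)] .
      have "\<not> z < p" using order_filterD[OF F \<open>z \<in> F\<close> pP, OF less_imp_le] p(1) by auto
      then have "p < z" using comparable_adj[OF zP(1) pP zP(3)] by auto
      then have "z \<in> ?T" using zP by auto
      then show False using ST \<open>z \<in> F\<close> by blast
    qed
    with no fP show False by blast
  qed
qed

lemma color_top_maximal_iff:
  assumes F: "order_filter P F" and G: "order_filter P G"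
    and p: "p \<in> G - F" "c p = i"
  shows "p \<in> maximal_elements (G - F) \<longleftrightarrow> card {n\<in>G - F. adj (c n) i \<and> p < n} = 0"
proof -
  have GP: "G \<subseteq> P" using G order_filter_subset by auto
  have "p \<in> maximal_elements (G - F)" if e: "{n\<in>G - F. adj (c n) i \<and> p < n} = {}"
    unfolding maximal_elements_def
  proof (intro CollectI conjI p notI)
    assume "\<exists>y\<in>G - F. p < y"
    then obtain y where y: "y \<in> G - F" "p < y" by blast
    obtain z where z: "covers P z p" "z \<le> y"
      using finite_upper_cover[OF finite_P, of p y] y p GP by blast
    then have zP: "z \<in> P" "p < z" by (auto simp: covers_def)
    have "z \<in> G" using order_filterD[OF G, of p z] p zP by auto
    moreover have "z \<notin> F" using order_filterD[OF F, of z y] y z GP by auto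
    ultimately have "z \<in> {n\<in>G - F. adj (c n) i \<and> p < n}"
      using covers_adj[OF z(1)] adj_sym p zP by auto
    with e show False by blast
  qed
  moreover have "finite {n\<in>G - F. adj (c n) i \<and> p < n}" using finite_sub[OF GP] by auto
  ultimately show ?thesis by (auto simp: maximal_elements_def)
qed

text \<open>For q outside F the exponent d - 1 of \<open>monomial_reflect_remove_minimal\<close>
  selects the case: d = 2 if F has a minimal element of color i, otherwise d = 1 or, when p is
  maximal in G - F, d = 0. The matching recursion of the excited sum supplies the compensating power
  of z i.\<close>

lemma signed_excited_sum_step:
  fixes z :: "'i \<Rightarrow> 'f::field"
  assumes F: "order_filter P F" and G: "order_filter P G" "F \<subseteq> G"
    and q: "q \<in> minimal_elements G" and z: "z (c q) \<noteq> 0" and hq: "h q = z (c q)"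
    and IH: "\<And>F. order_filter P F \<Longrightarrow> F \<subseteq> G - {q} \<Longrightarrow>
      (\<Sum>A\<in>Pow (maximal_elements (G - {q} - F)). (- 1) ^ card A * excited_sum (G - {q}) h (F \<union> A)) =
      monomial (reflect (c q) z) (G - {q} - F) * excited_sum (G - {q}) h F"
  shows "(\<Sum>A\<in>Pow (maximal_elements (G - F)). (- 1) ^ card A * excited_sum G h (F \<union> A)) =
    monomial z (G - F) * excited_sum G h F"
proof -
  define i where "i = c q"
  define M where "M = maximal_elements (G - F)"
  define X where "X = excited_sum (G - {q}) h"
  have FP: "F \<subseteq> P" and GP: "G \<subseteq> P" using F G order_filter_subset by auto
  have MG: "M \<subseteq> G - F" by (auto simp: M_def maximal_elements_def)
  have finM: "finite M" using MG GP finite_sub[of M] by auto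
  have qG: "q \<in> G" "q \<in> P" and qmin: "\<And>w. w \<in> G \<Longrightarrow> \<not> w < q"
    using q GP by (auto simp: minimal_elements_def)
  have FA: "order_filter P (F \<union> A)" "F \<union> A \<subseteq> G" if "A \<subseteq> M" for A
    using order_filter_union_maximal[OF G(1) F] that MG G(2) by (auto simp: M_def)
  have comm: "G - {q} - F = G - F - {q}" by auto
  show ?thesis
  proof (cases "q \<in> F")
    case True
    have Fq: "order_filter P (F - {q})" "F - {q} \<subseteq> G - {q}"
      using order_filter_remove_minimal[OF F, of q] True q G(2) by (auto simp: minimal_elements_def)
    have K: "G - {q} - (F - {q}) = G - F" using True by auto
    \<comment> \<open>An element of G - F is not comparable with q, which is minimal in G and lies
      in the filter F. So its color is neither i nor adjacent to i.\<close>
    have "reflect i z (c w) = z (c w)" if "w \<in> G - F" for w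
    proof -
      have "\<not> (c w = i \<or> adj (c w) i)"
      proof
        assume "c w = i \<or> adj (c w) i"
        then have "w \<le> q \<or> q \<le> w" using near_comparable[of w q] that GP qG by (auto simp: i_def)
        then have "q \<le> w" using qmin[of w] that by (auto simp: order_le_less)
        then show False using order_filterD[OF F True, of w] that GP by auto
      qed
      then show ?thesis by (simp add: reflect_def)
    qed
    then have mon: "monomial (reflect i z) (G - F) = monomial z (G - F)"
      unfolding monomial_def by (intro prod.cong) auto
    have "excited_sum G h (F \<union> A) = (1 - h q) * X ((F - {q}) \<union> A)" if "A \<in> Pow M" for A
    proof -
      have eq: "(F - {q}) \<union> A = F \<union> A - {q}" using that MG True by auto
      have "A \<subseteq> M" using that by simp
      then show ?thesis
        unfolding X_def eq by (intro excited_sum_minimal_in FA G(1) q) (use True in auto)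
    qed
    then have "(\<Sum>A\<in>Pow M. (- 1) ^ card A * excited_sum G h (F \<union> A)) =
        (1 - h q) * (\<Sum>A\<in>Pow M. (- 1) ^ card A * X ((F - {q}) \<union> A))"
      by (simp add: sum_distrib_left mult_ac)
    also have "\<dots> = (1 - h q) * (monomial z (G - F) * X (F - {q}))"
      using IH[OF Fq] unfolding K X_def M_def i_def[symmetric] mon by simp
    finally show ?thesis
      unfolding M_def excited_sum_minimal_in[OF F G q True] X_def by (simp add: mult_ac)
  next
    case False
    have qK: "q \<in> G - F" and Fsub: "F \<subseteq> G - {q}" using False qG G(2) by auto
    obtain p where p: "p \<in> G - F" "c p = i" "\<And>w. w \<in> G - F \<Longrightarrow> c w = i \<Longrightarrow> w \<le> p"
      using obtain_color_top[of "G - F" q i] qK GP unfolding i_def by (metis Diff_subset subset_trans)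
    have pP: "p \<in> P" using p GP by auto
    define d where "d = card {n\<in>G - F. adj (c n) i \<and> p < n}"
    define Mz where "Mz = monomial z (G - F)"
    define Mz' where "Mz' = monomial (reflect i z) (G - F - {q})"
    have W: "Mz' * z i = z i ^ d * Mz"
      unfolding Mz_def Mz'_def d_def i_def
      by (rule monomial_reflect_remove_minimal[where z = z, OF F G q False z]) (use p in \<open>auto simp: i_def\<close>)
    have zi: "z i \<noteq> 0" "h q = z i" using z hq by (auto simp: i_def)
    have pM: "p \<in> M \<longleftrightarrow> d = 0"
      unfolding M_def d_def by (rule color_top_maximal_iff[OF F G(1) p(1,2)])
    have M_top: "w = p" if "w \<in> M" "c w = i" for w
    proof -
      have "w \<le> p" using p(3)[of w] that MG by auto
      moreover have "\<not> w < p" using that p(1) by (auto simp: M_def maximal_elements_def)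
      ultimately show ?thesis by (simp add: order_le_less)
    qed
    have maxK: "maximal_elements (G - {q} - F) = M - {q}"
      unfolding comm M_def by (rule maximal_elements_remove_minimal[OF q])
    have IHF: "(\<Sum>A\<in>Pow (M - {q}). (- 1) ^ card A * X (F \<union> A)) = Mz' * X F"
      using IH[OF F Fsub] unfolding maxK by (simp only: X_def comm i_def Mz'_def)
    have none: "excited_sum G h (F \<union> A) = X (F \<union> A)"
      if A: "A \<subseteq> M" "p \<notin> A" and no: "\<And>f. f \<in> minimal_elements (F \<union> A) \<Longrightarrow> f \<in> F \<Longrightarrow> c f \<noteq> i" for A
      unfolding X_def
    proof (rule excited_sum_minimal_none[OF FA(1)[OF A(1)] G(1) FA(2)[OF A(1)] q])
      have "q \<noteq> p \<Longrightarrow> q \<notin> A" using M_top[of q] A by (auto simp: i_def)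
      then show "q \<notin> F \<union> A" using A(2) False by auto
      fix f assume "f \<in> minimal_elements (F \<union> A)"
      then show "c f \<noteq> c q"
        using no[of f] M_top[of f] A by (auto simp: i_def minimal_elements_def)
    qed
    show ?thesis
    proof (cases "\<exists>f\<in>minimal_elements F. c f = i")
      case no_f: False
      have d1: "d \<le> 1" unfolding d_def
        by (rule no_slot_count[OF F G p]) (use no_f in auto)
      have minF: "f \<in> minimal_elements F" if "f \<in> minimal_elements (F \<union> A)" "f \<in> F" for f A
        using that by (auto simp: minimal_elements_def)
      have none': "excited_sum G h (F \<union> A) = X (F \<union> A)" if "A \<subseteq> M" "p \<notin> A" for A
        using none[OF that] minF no_f by blast
      have EF: "excited_sum G h F = X F" using none'[of "{}"] by simp
      show ?thesis
      proof (cases "d = 0")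
        case False
        then have "p \<notin> M" using pM by simp
        moreover have "M - {q} = M" using M_top[of q] calculation by (auto simp: i_def)
        moreover have "excited_sum G h (F \<union> A) = X (F \<union> A)" if "A \<in> Pow M" for A
          using none'[of A] that calculation(1) by auto
        ultimately have "(\<Sum>A\<in>Pow M. (- 1) ^ card A * excited_sum G h (F \<union> A)) = Mz' * X F"
          using IHF by (simp only: cong: sum.cong)
        moreover have "Mz' = Mz" using W False d1 zi by (simp add: le_Suc_eq)
        ultimately show ?thesis unfolding M_def EF Mz_def by simp
      next
        case True
        then have pM': "p \<in> M" using pM by simp
        \<comment> \<open>If q = p, sets containing p do not occur in the sum for G - {q}. The value
          0 for them lets both subcases share one difference formula.\<close>
        define g where "g A = (if q = p \<and> q \<in> A then 0 else X (F \<union> A))" for A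
        have step: "excited_sum G h (F \<union> A) - excited_sum G h (F \<union> insert p A) = z i * (g A - g (insert p A))"
          if A: "A \<subseteq> M - {p}" for A
        proof -
          have A': "insert p A \<subseteq> M" "p \<notin> A" using A pM' by auto
          have eq: "F \<union> insert p A - {p} = F \<union> A" using A p(1) by auto
          have 1: "excited_sum G h (F \<union> A) = X (F \<union> A)" using none'[of A] A by auto
          have gA: "g A = X (F \<union> A)" using A by (auto simp: g_def)
          show ?thesis
          proof (cases "q = p")
            case True
            have "excited_sum G h (F \<union> insert p A) = (1 - z i) * X (F \<union> A)"
              using excited_sum_minimal_in[where h = h, OF FA(1)[OF A'(1)] G(1) FA(2)[OF A'(1)] q] eq True zi
              by (simp add: X_def)
            then show ?thesis using 1 gA True by (simp add: g_def algebra_simps)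
          next
            case False
            have "q \<notin> M" using M_top[of q] False by (auto simp: i_def)
            have "\<not> w < p" if w: "w \<in> F \<union> insert p A" for w
            proof (cases "w \<in> F")
              case True
              then show ?thesis using order_filterD[OF F True pP, OF less_imp_le] p(1) by auto
            next
              case False
              then have "w \<in> M" using w A' by auto
              then show ?thesis using p(1) by (auto simp: M_def maximal_elements_def)
            qed
            then have "p \<in> minimal_elements (F \<union> insert p A)" by (auto simp: minimal_elements_def)
            moreover have "q \<notin> F \<union> insert p A" using \<open>q \<notin> M\<close> A' qK by auto
            ultimately have "excited_sum G h (F \<union> insert p A) = z i * X (F \<union> insert p A) + (1 - z i) * X (F \<union> A)"
              using excited_sum_minimal_slot[where h = h, OF FA(1)[OF A'(1)] _ G(1) FA(2)[OF A'(1)] q, of p] eq zi p(2)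
              by (simp add: X_def i_def)
            then show ?thesis using 1 gA False by (simp add: g_def algebra_simps)
          qed
        qed
        have "(\<Sum>A\<in>Pow M. (- 1) ^ card A * excited_sum G h (F \<union> A)) =
            (\<Sum>A\<in>Pow (M - {p}). (- 1) ^ card A * (z i * (g A - g (insert p A))))"
          unfolding signed_sum_Pow_split[OF finM pM'] using step by (intro sum.cong) auto
        also have "\<dots> = z i * (\<Sum>A\<in>Pow (M - {p}). (- 1) ^ card A * (g A - g (insert p A)))"
          by (simp add: sum_distrib_left mult_ac)
        also have "(\<Sum>A\<in>Pow (M - {p}). (- 1) ^ card A * (g A - g (insert p A))) = Mz' * X F"
        proof (cases "q = p")
          case True
          then have "g A - g (insert p A) = X (F \<union> A)" if "A \<in> Pow (M - {p})" for A
            using that by (auto simp: g_def)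
          then have "(\<Sum>A\<in>Pow (M - {p}). (- 1) ^ card A * (g A - g (insert p A))) =
              (\<Sum>A\<in>Pow (M - {p}). (- 1) ^ card A * X (F \<union> A))"
            by (intro sum.cong) simp_all
          then show ?thesis using IHF True by simp
        next
          case False
          then have "M - {q} = M" using M_top[of q] by (auto simp: i_def)
          then show ?thesis
            using IHF False unfolding signed_sum_Pow_split[OF finM pM', symmetric] by (simp add: g_def)
        qed
        finally show ?thesis using W True unfolding M_def EF Mz_def[symmetric]
          by (simp add: mult_ac)
      qed
    next
      case True
      then obtain f where f: "f \<in> minimal_elements F" "c f = i" by blast
      have d2: "d = 2" unfolding d_def by (rule slot_pair_count[OF F G p f])
      have fF: "f \<in> F" "f \<in> G" "f \<in> P" and fmin: "\<And>w. w \<in> F \<Longrightarrow> \<not> w < f"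
        using f G FP by (auto simp: minimal_elements_def)
      have pnM: "p \<notin> M" using pM d2 by simp
      then have qnM: "q \<notin> M" using M_top[of q] by (auto simp: i_def)
      \<comment> \<open>For A inside M, f stays minimal in F together with A iff A lies in
        \<open>M0\<close>. Moreover f and \<open>M0\<close> make up the maximal elements of the
        complement of F - {f} in G - {q}, so the induction hypothesis for F - {f} runs over the same
        sets.\<close>
      define M0 where "M0 = {m\<in>M. \<not> m < f}"
      have fM0: "f \<notin> M0" "finite M0" using finM MG fF by (auto simp: M0_def)
      have Ff: "order_filter P (F - {f})" using order_filter_remove_minimal[OF F f(1)] .
      have FfG: "F - {f} \<subseteq> G - {q}" using Fsub by auto
      have K: "G - {q} - (F - {f}) = insert f (G - F - {q})" using fF qK by auto
      have max0: "maximal_elements (G - {q} - (F - {f})) = insert f M0"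
      proof (intro set_eqI iffI)
        fix m assume m: "m \<in> maximal_elements (G - {q} - (F - {f}))"
        show "m \<in> insert f M0"
        proof (cases "m = f")
          case False
          then have mK: "m \<in> G - F - {q}" using m by (auto simp: maximal_elements_def)
          have "\<not> m < f" using m fF qK by (auto simp: maximal_elements_def)
          moreover have "m \<in> maximal_elements (G - F - {q})"
            using m mK unfolding K by (auto simp: maximal_elements_def)
          ultimately show ?thesis
            unfolding maximal_elements_remove_minimal[OF q] by (auto simp: M0_def M_def)
        qed simp
      next
        fix m assume m: "m \<in> insert f M0"
        show "m \<in> maximal_elements (G - {q} - (F - {f}))"
        proof (cases "m = f")
          case True
          have "\<not> f < y" if "y \<in> G - F - {q}" for y
            using order_filterD[OF F fF(1), of y, OF _ less_imp_le] that GP by auto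
          then show ?thesis unfolding K using True by (auto simp: maximal_elements_def)
        next
          case False
          then show ?thesis unfolding K using m qnM by (auto simp: M0_def M_def maximal_elements_def)
        qed
      qed
      define g where "g A = X ((F - {f}) \<union> A)" for A
      have gf: "g (insert f A) = X (F \<union> A)" for A
        unfolding g_def by (rule arg_cong[of _ _ X]) (use fF in auto)
      have "insert f M0 - {f} = M0" using fM0 by auto
      then have IHf: "(\<Sum>A\<in>Pow M0. (- 1) ^ card A * (g A - X (F \<union> A))) =
          monomial (reflect i z) (insert f (G - F - {q})) * X (F - {f})"
        using IH[OF Ff FfG] signed_sum_Pow_split[of "insert f M0" f g] fM0
        unfolding max0 gf by (simp add: K g_def X_def i_def)
      have "monomial (reflect i z) (insert f (G - F - {q})) = inverse (z i) * Mz'"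
        using f finite_sub[of "G - F - {q}"] GP fF by (simp add: monomial_def Mz'_def reflect_self subset_iff)
      moreover have Mz': "Mz' = z i * Mz"
        using W zi d2 by (simp add: power2_eq_square)
      ultimately have Mf: "monomial (reflect i z) (insert f (G - F - {q})) = Mz" using zi by simp
      \<comment> \<open>The correction is present only for A inside \<open>M0\<close>. Its signed
        sum is therefore the hypothesis for F - {f}, with the sets split according to whether they
        contain f.\<close>
      have E: "excited_sum G h (F \<union> A) =
          X (F \<union> A) + (if A \<in> Pow M0 then (1 - z i) * (g A - X (F \<union> A)) else 0)"
        if A: "A \<in> Pow M" for A
      proof (cases "A \<in> Pow M0")
        case True
        have AM: "A \<subseteq> M" using A by auto
        have "\<not> w < f" if "w \<in> F \<union> A" for w using that fmin True by (auto simp: M0_def)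
        then have fm: "f \<in> minimal_elements (F \<union> A)" using fF by (auto simp: minimal_elements_def)
        have "q \<notin> F \<union> A" using qK qnM AM by auto
        moreover have "F \<union> A - {f} = (F - {f}) \<union> A" using fF AM MG by auto
        ultimately have "excited_sum G h (F \<union> A) = z i * X (F \<union> A) + (1 - z i) * g A"
          using excited_sum_minimal_slot[where h = h, OF FA(1)[OF AM] fm G(1) FA(2)[OF AM] q] zi f(2)
          by (simp add: X_def i_def g_def)
        then show ?thesis using True by (simp add: algebra_simps)
      next
        case False
        then obtain m where m: "m \<in> A" "m < f" using A by (auto simp: M0_def)
        have "c f' \<noteq> i" if f': "f' \<in> minimal_elements (F \<union> A)" "f' \<in> F" for f'
        proof
          assume "c f' = i"
          then have "f' < f \<or> f' = f \<or> f < f'" using comparable_same[of f' f] f' f fF FP by auto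
          then have "f' = f" using f' fmin fF by (auto simp: minimal_elements_def)
          then show False using f' m by (auto simp: minimal_elements_def)
        qed
        then have "excited_sum G h (F \<union> A) = X (F \<union> A)" using none[of A] A pnM by blast
        then show ?thesis using False by simp
      qed
      have "q \<notin> F" "F \<union> {} = F" using qK by auto
      have EF: "excited_sum G h F = z i * X F + (1 - z i) * X (F - {f})"
        using E[of "{}"] by (simp add: g_def algebra_simps)
      have "(\<Sum>A\<in>Pow M. (- 1) ^ card A * excited_sum G h (F \<union> A)) =
          (\<Sum>A\<in>Pow M. (- 1) ^ card A * X (F \<union> A) +
            (if A \<in> Pow M0 then (1 - z i) * ((- 1) ^ card A * (g A - X (F \<union> A))) else 0))"
        by (rule sum.cong[OF refl]) (simp add: E distrib_left mult_ac)
      also have "\<dots> = (\<Sum>A\<in>Pow M. (- 1) ^ card A * X (F \<union> A)) +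
          (\<Sum>A\<in>Pow M. if A \<in> Pow M0 then (1 - z i) * ((- 1) ^ card A * (g A - X (F \<union> A))) else 0)"
        by (rule sum.distrib)
      also have "(\<Sum>A\<in>Pow M. if A \<in> Pow M0 then (1 - z i) * ((- 1) ^ card A * (g A - X (F \<union> A))) else 0) =
          (\<Sum>A\<in>Pow M0. (1 - z i) * ((- 1) ^ card A * (g A - X (F \<union> A))))"
        using finM by (intro sum.mono_neutral_cong_right) (auto simp: M0_def)
      also have "\<dots> = (1 - z i) * (Mz * X (F - {f}))"
        unfolding sum_distrib_left[symmetric] IHf Mf ..
      also have "(\<Sum>A\<in>Pow M. (- 1) ^ card A * X (F \<union> A)) = z i * Mz * X F"
        using IHF qnM unfolding Mz' by simp
      finally show ?thesis unfolding M_def EF Mz_def[symmetric] by (simp add: algebra_simps)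
    qed
  qed
qed

end

section \<open>Double-tailed diamonds\<close>

text \<open>Closed form of \<open>diamond_le\<close>. The index counts from the outer ends of the
  tails, so k does not appear: a larger k only adds nodes near the sides.\<close>

fun node_le :: "diamond_node \<Rightarrow> diamond_node \<Rightarrow> bool" where
  "node_le (dU i) (dU j) \<longleftrightarrow> j \<le> i"
| "node_le dX (dU j) \<longleftrightarrow> True"
| "node_le dY (dU j) \<longleftrightarrow> True"
| "node_le dX dX \<longleftrightarrow> True"
| "node_le dY dY \<longleftrightarrow> True"
| "node_le (dV i) (dV j) \<longleftrightarrow> i \<le> j"
| "node_le (dV i) _ \<longleftrightarrow> True"
| "node_le _ _ \<longleftrightarrow> False"

lemma node_le_refl: "node_le a a"
  by (cases a) auto

lemma node_le_antisym: "node_le a b \<Longrightarrow> node_le b a \<Longrightarrow> a = b"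
  by (cases a; cases b) auto

lemma node_le_trans: "node_le a b \<Longrightarrow> node_le b d \<Longrightarrow> node_le a d"
  by (cases a; cases b; cases d) auto

lemma in_diamond [simp]:
  "dU i \<in> diamond k \<longleftrightarrow> 1 \<le> i \<and> i \<le> k - 2"
  "dV i \<in> diamond k \<longleftrightarrow> 1 \<le> i \<and> i \<le> k - 2"
  "dX \<in> diamond k" "dY \<in> diamond k"
  by (auto simp: diamond_def)

lemma diamond_le_node_le:
  assumes "k \<ge> 3" "a \<in> diamond k" "b \<in> diamond k"
  shows "diamond_le k a b \<longleftrightarrow> node_le a b"
proof
  have "node_le a b" if "(diamond_covers k)\<^sup>*\<^sup>* b a" for a b
    using that
  proof (induction rule: rtranclp_induct)
    case (step y z)
    have "node_le z y" using step(2) by (cases rule: diamond_covers.cases) auto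
    then show ?case using step.IH node_le_trans by blast
  qed (rule node_le_refl)
  then show "diamond_le k a b \<Longrightarrow> node_le a b" by (simp add: diamond_le_def)
next
  let ?R = "(diamond_covers k)\<^sup>*\<^sup>*"
  have U: "?R (dU i) (dU j)" if "1 \<le> i" "i \<le> j" "j \<le> k - 2" for i j
    using that(2,3,1)
  proof (induction j rule: dec_induct)
    case (step n)
    then show ?case using diamond_covers.intros(1)[of n k] by (auto intro: rtranclp.rtrancl_into_rtrancl)
  qed simp
  have V: "?R (dV j) (dV i)" if "1 \<le> i" "i \<le> j" "j \<le> k - 2" for i j
    using that(2,3,1)
  proof (induction j rule: dec_induct)
    case (step n)
    then show ?case using diamond_covers.intros(6)[of n k] by (auto intro: converse_rtranclp_into_rtranclp)
  qed simp
  have k2: "1 \<le> k - 2" using assms(1) by simp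
  have UX: "?R (dU i) dX" "?R (dU i) dY" if "1 \<le> i" "i \<le> k - 2" for i
    using U[OF that(1,2) order.refl] diamond_covers.intros(2,4)[of k] by (auto intro: rtranclp.rtrancl_into_rtrancl)
  have XV: "?R dX (dV i)" "?R dY (dV i)" if "1 \<le> i" "i \<le> k - 2" for i
    using V[OF that(1,2) order.refl] diamond_covers.intros(3,5)[of k] by (auto intro: converse_rtranclp_into_rtranclp)
  have UV: "?R (dU i) (dV j)" if "1 \<le> i" "i \<le> k - 2" "1 \<le> j" "j \<le> k - 2" for i j
    using UX(1)[OF that(1,2)] XV(1)[OF that(3,4)] by (rule rtranclp_trans)
  show "node_le a b \<Longrightarrow> diamond_le k a b"
    using assms(2,3) unfolding diamond_le_def
    by (cases a; cases b) (auto intro: U V UX XV UV)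
qed

lemma poset_iso_inverse:
  assumes "bij_betw g B A" "\<And>a b. a \<in> B \<Longrightarrow> b \<in> B \<Longrightarrow> g a \<le> g b \<longleftrightarrow> le a b"
  shows "poset_iso A B le"
  unfolding poset_iso_def
proof (intro exI conjI ballI)
  show bij: "bij_betw (inv_into B g) A B" using assms(1) by (rule bij_betw_inv_into)
  fix x y assume "x \<in> A" "y \<in> A"
  then show "x \<le> y \<longleftrightarrow> le (inv_into B g x) (inv_into B g y)"
    using assms(2)[of "inv_into B g x" "inv_into B g y"] bij_betw_inv_into_right[OF assms(1)]
      bij_betwE[OF bij] by metis
qed

text \<open>The isomorphism of \<open>dk_interval\<close> in the opposite direction, which gives
  elements of P the names of nodes. The last condition says that nothing else lies between the
  images of bottom and top.\<close>

definition diamond_map :: "'a::order set \<Rightarrow> nat \<Rightarrow> (diamond_node \<Rightarrow> 'a) \<Rightarrow> bool" where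
  "diamond_map P k g \<longleftrightarrow>
    (\<forall>a\<in>diamond k. \<forall>b\<in>diamond k. g a \<le> g b \<longleftrightarrow> node_le a b) \<and>
    g ` diamond k = interval P (g (dV 1)) (g (dU 1))"

lemma dk_interval_iff:
  assumes k: "k \<ge> 3"
  shows "dk_interval P k v u \<longleftrightarrow> (\<exists>g. diamond_map P k g \<and> g (dV 1) = v \<and> g (dU 1) = u)"
proof
  assume dk: "dk_interval P k v u"
  then obtain f where f: "bij_betw f (interval P v u) (diamond k)"
    "\<And>x y. x \<in> interval P v u \<Longrightarrow> y \<in> interval P v u \<Longrightarrow> x \<le> y \<longleftrightarrow> diamond_le k (f x) (f y)"
    and vu: "v \<in> P" "u \<in> P" "v \<le> u"
    unfolding dk_interval_def poset_iso_def by blast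
  define g where "g = inv_into (interval P v u) f"
  have bg: "bij_betw g (diamond k) (interval P v u)" unfolding g_def by (rule bij_betw_inv_into[OF f(1)])
  have gI: "g a \<in> interval P v u" if "a \<in> diamond k" for a using bij_betwE[OF bg] that by blast
  have fg: "f (g a) = a" if "a \<in> diamond k" for a
    unfolding g_def using bij_betw_inv_into_right[OF f(1) that] .
  have le: "g a \<le> g b \<longleftrightarrow> node_le a b" if "a \<in> diamond k" "b \<in> diamond k" for a b
    using f(2)[OF gI[OF that(1)] gI[OF that(2)]] fg that diamond_le_node_le[OF k] by simp
  have V1: "dV 1 \<in> diamond k" and U1: "dU 1 \<in> diamond k" using k by auto
  have "v \<in> g ` diamond k" "u \<in> g ` diamond k"
    using vu bij_betw_imp_surj_on[OF bg] by (auto simp: interval_def)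
  moreover have "node_le (dV 1) a" "node_le a (dU 1)" if "a \<in> diamond k" for a
    using that by (cases a; auto)+
  ultimately have "g (dV 1) \<le> v" "u \<le> g (dU 1)" using le V1 U1 by auto
  moreover have "v \<le> g (dV 1)" "g (dU 1) \<le> u" using gI[OF V1] gI[OF U1] by (auto simp: interval_def)
  ultimately have eq: "g (dV 1) = v" "g (dU 1) = u" by auto
  then have "diamond_map P k g"
    using le bij_betw_imp_surj_on[OF bg] by (auto simp: diamond_map_def)
  with eq show "\<exists>g. diamond_map P k g \<and> g (dV 1) = v \<and> g (dU 1) = u" by blast
next
  assume "\<exists>g. diamond_map P k g \<and> g (dV 1) = v \<and> g (dU 1) = u"
  then obtain g where le: "\<And>a b. a \<in> diamond k \<Longrightarrow> b \<in> diamond k \<Longrightarrow> g a \<le> g b \<longleftrightarrow> node_le a b"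
    and im: "g ` diamond k = interval P v u" and vu: "g (dV 1) = v" "g (dU 1) = u"
    by (auto simp: diamond_map_def)
  have V1: "dV 1 \<in> diamond k" and U1: "dU 1 \<in> diamond k" using k by auto
  have "inj_on g (diamond k)"
    by (rule inj_onI) (metis le node_le_antisym order.refl)
  then have "bij_betw g (diamond k) (interval P v u)" using im by (simp add: bij_betw_def)
  then have "poset_iso (interval P v u) (diamond k) (diamond_le k)"
    by (rule poset_iso_inverse) (simp add: le diamond_le_node_le[OF k])
  moreover have "v \<in> interval P v u" "u \<in> interval P v u" using im V1 U1 vu by blast+
  ultimately show "dk_interval P k v u" by (auto simp: dk_interval_def interval_def)
qed

lemma dk_minus_convexI:
  assumes k: "k \<ge> 3"
    and le: "\<And>a b. a \<in> diamond k - {dU 1} \<Longrightarrow> b \<in> diamond k - {dU 1} \<Longrightarrow> g a \<le> g b \<longleftrightarrow> node_le a b"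
    and S: "g ` (diamond k - {dU 1}) = S" "convex_subset P S"
  shows "dk_minus_convex P k S"
proof -
  have "inj_on g (diamond k - {dU 1})"
    by (rule inj_onI) (metis le node_le_antisym order.refl)
  then have "bij_betw g (diamond k - {dU 1}) S" using S by (simp add: bij_betw_def)
  then have "poset_iso S (diamond k - {dU 1}) (diamond_le k)"
    by (rule poset_iso_inverse) (use le diamond_le_node_le[OF k] in auto)
  with S show ?thesis by (simp add: dk_minus_convex_def)
qed

lemma diamond_map_le:
  "diamond_map P k g \<Longrightarrow> a \<in> diamond k \<Longrightarrow> b \<in> diamond k \<Longrightarrow> g a \<le> g b \<longleftrightarrow> node_le a b"
  by (simp add: diamond_map_def)

lemma diamond_map_eq:
  "diamond_map P k g \<Longrightarrow> a \<in> diamond k \<Longrightarrow> b \<in> diamond k \<Longrightarrow> g a = g b \<longleftrightarrow> a = b"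
  by (metis diamond_map_le node_le_antisym order.refl)

lemma diamond_map_less:
  "diamond_map P k g \<Longrightarrow> a \<in> diamond k \<Longrightarrow> b \<in> diamond k \<Longrightarrow> g a < g b \<longleftrightarrow> node_le a b \<and> a \<noteq> b"
  by (simp add: less_le diamond_map_le diamond_map_eq)

lemma diamond_map_interval:
  assumes g: "diamond_map P k g" and ab: "a \<in> diamond k" "b \<in> diamond k"
  shows "interval P (g a) (g b) = g ` {d\<in>diamond k. node_le a d \<and> node_le d b}"
proof -
  have im: "g ` diamond k = interval P (g (dV 1)) (g (dU 1))" using g by (simp add: diamond_map_def)
  have bd: "g (dV 1) \<le> g a" "g b \<le> g (dU 1)" using ab im by (auto simp: interval_def)
  show ?thesis
  proof (intro set_eqI iffI)
    fix w assume w: "w \<in> interval P (g a) (g b)"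
    then have "w \<in> interval P (g (dV 1)) (g (dU 1))" using bd by (auto simp: interval_def)
    then obtain d where "d \<in> diamond k" "w = g d" using im by blast
    then show "w \<in> g ` {d\<in>diamond k. node_le a d \<and> node_le d b}"
      using w diamond_map_le[OF g] ab by (auto simp: interval_def)
  next
    fix w assume "w \<in> g ` {d\<in>diamond k. node_le a d \<and> node_le d b}"
    then obtain d where d: "d \<in> diamond k" "node_le a d" "node_le d b" "w = g d" by blast
    then have "g d \<in> P" using im by (auto simp: interval_def)
    then show "w \<in> interval P (g a) (g b)" using d diamond_map_le[OF g] ab by (auto simp: interval_def)
  qed
qed

lemma diamond_map_in: "diamond_map P k g \<Longrightarrow> a \<in> diamond k \<Longrightarrow> g a \<in> P"
  by (auto simp: diamond_map_def interval_def)

lemma diamond_map_surj: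
  assumes "diamond_map P k g" "w \<in> P" "g (dV 1) \<le> w" "w \<le> g (dU 1)"
  obtains a where "a \<in> diamond k" "w = g a"
proof -
  have "w \<in> g ` diamond k" using assms unfolding diamond_map_def interval_def by blast
  then show thesis using that by blast
qed

lemma diamond_map_covers:
  assumes g: "diamond_map P k g" and ab: "a \<in> diamond k" "b \<in> diamond k" "node_le a b" "a \<noteq> b"
    and no: "\<And>d. d \<in> diamond k \<Longrightarrow> node_le a d \<Longrightarrow> node_le d b \<Longrightarrow> d = a \<or> d = b"
  shows "covers P (g b) (g a)"
proof -
  have False if w: "w \<in> P" "g a < w" "w < g b" for w
  proof -
    have "w \<in> interval P (g a) (g b)" using w by (auto simp: interval_def)
    then obtain d where "d \<in> diamond k" "node_le a d" "node_le d b" "w = g d"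
      using diamond_map_interval[OF g ab(1,2)] by auto
    with no[of d] w show False by auto
  qed
  then show ?thesis
    using diamond_map_in[OF g] diamond_map_less[OF g] ab by (auto simp: covers_def)
qed

fun node_shift :: "nat \<Rightarrow> diamond_node \<Rightarrow> diamond_node" where
  "node_shift s (dU i) = dU (i + s)"
| "node_shift s (dV i) = dV (i + s)"
| "node_shift s dX = dX"
| "node_shift s dY = dY"

text \<open>Cutting s nodes off the outer end of each tail leaves a smaller diamond. Thus every pair
  \<open>dV i\<close>, \<open>dU i\<close> bounds a d_k-interval, which makes the two tails equally
  colored.\<close>

lemma diamond_map_shift:
  assumes g: "diamond_map P k g" and s: "s < k - 2"
  shows "diamond_map P (k - s) (g \<circ> node_shift s)"
proof -
  have sh: "node_shift s a \<in> diamond k" if "a \<in> diamond (k - s)" for a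
    using that s by (cases a) auto
  have le: "node_le (node_shift s a) (node_shift s b) \<longleftrightarrow> node_le a b" for a b
    by (cases a; cases b) auto
  have "node_shift s ` diamond (k - s) =
      {d\<in>diamond k. node_le (dV (1 + s)) d \<and> node_le d (dU (1 + s))}" (is "?L = ?R")
  proof (intro set_eqI iffI)
    fix d assume "d \<in> ?L"
    then obtain a where "a \<in> diamond (k - s)" "d = node_shift s a" by blast
    then show "d \<in> ?R" using sh s by (cases a) auto
  next
    fix d assume d: "d \<in> ?R"
    show "d \<in> ?L"
    proof (cases d)
      case (dU i)
      then show ?thesis using d by (intro image_eqI[of _ _ "dU (i - s)"]) auto
    next
      case (dV i)
      then show ?thesis using d by (intro image_eqI[of _ _ "dV (i - s)"]) auto
    next
      case dX
      then show ?thesis by (intro image_eqI[of _ _ dX]) auto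
    next
      case dY
      then show ?thesis by (intro image_eqI[of _ _ dY]) auto
    qed
  qed
  then have "(g \<circ> node_shift s) ` diamond (k - s) = interval P (g (dV (1 + s))) (g (dU (1 + s)))"
    using diamond_map_interval[OF g, of "dV (1 + s)" "dU (1 + s)"] s
    unfolding image_comp[symmetric] by simp
  then show ?thesis
    unfolding diamond_map_def using diamond_map_le[OF g] sh le by simp
qed

lemma diamond_map_d_interval:
  assumes g: "diamond_map P k g" and i: "1 \<le> i" "i \<le> k - 2"
  shows "d_interval P (g (dV i)) (g (dU i))"
proof -
  have "diamond_map P (k - (i - 1)) (g \<circ> node_shift (i - 1))"
    by (rule diamond_map_shift[OF g]) (use i in auto)
  then have "dk_interval P (k - (i - 1)) (g (dV i)) (g (dU i))"
    using i by (subst dk_interval_iff) (auto intro!: exI[of _ "g \<circ> node_shift (i - 1)"])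
  then show ?thesis using i unfolding d_interval_def by (intro exI[of _ "k - (i - 1)"]) auto
qed

lemma d_complete_D1:
  assumes "d_complete P" "finite P" "k \<ge> 3" "dk_minus_convex P k S" "q \<in> S" "\<And>s. s \<in> S \<Longrightarrow> q \<le> s"
  obtains u where "dk_interval P k q u" "S \<subseteq> interval P q u"
proof -
  obtain u v w where u: "u \<in> P" "\<And>m. m \<in> maximal_elements S \<Longrightarrow> covers P u m"
    and vw: "dk_interval P k v w" "insert u S = interval P v w"
    using assms(1,3,4) unfolding d_complete_def by metis
  have "S \<subseteq> P" using assms(4) by (simp add: dk_minus_convex_def convex_subset_def)
  then have "finite S" using assms(2) finite_subset by blast
  then obtain m where m: "m \<in> S" "\<And>b. b \<in> S \<Longrightarrow> m \<le> b \<Longrightarrow> m = b"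
    using finite_has_maximal[of S] assms(5) by blast
  then have "\<not> m < b" if "b \<in> S" for b using m(2)[OF that less_imp_le] by auto
  then have "m \<in> maximal_elements S" using m(1) by (auto simp: maximal_elements_def)
  then have "q < u" using u(2)[of m] assms(6)[OF m(1)] by (auto simp: covers_def)
  have "v \<in> interval P v w" using vw(1) by (auto simp: dk_interval_def interval_def)
  then have "v \<in> insert u S" using vw(2) by simp
  moreover have "v \<le> q" using vw(2) assms(5) by (auto simp: interval_def)
  ultimately have "v = q" using \<open>q < u\<close> assms(6) by (auto intro: order.antisym)
  with vw that show thesis by blast
qed

lemma d_complete_D2:
  assumes "d_complete P" "d_interval P v u" "covers P u x"
  shows "x \<in> interval P v u"
  using assms unfolding d_complete_def d_interval_def by blast

section \<open>Colored d-complete posets as minuscule heaps\<close>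

locale d_complete_poset =
  fixes P :: "'a::order set" and I :: "'i set" and c :: "'a \<Rightarrow> 'i"
  assumes finite: "finite P" and d_complete: "d_complete P" and coloring: "d_complete_coloring P I c"
begin

definition adj :: "'i \<Rightarrow> 'i \<Rightarrow> bool" where
  "adj i j \<longleftrightarrow> (\<exists>s t. top_forest_adjacent P s t \<and> c s = i \<and> c t = j)"

abbreviation "\<Gamma> \<equiv> top_forest P"

lemma top_forest_subset: "\<Gamma> \<subseteq> P"
  by (auto simp: top_forest_def)

lemma top_forest_up: "x \<in> \<Gamma> \<Longrightarrow> y \<in> P \<Longrightarrow> x \<le> y \<Longrightarrow> y \<in> \<Gamma>"
  by (auto simp: top_forest_def intro: order.trans)

lemma top_forest_cover_unique: "x \<in> \<Gamma> \<Longrightarrow> covers P y x \<Longrightarrow> covers P z x \<Longrightarrow> y = z"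
  by (auto simp: top_forest_def Uniq_def)

lemma top_forest_chain:
  assumes "x \<in> \<Gamma>" "a \<in> P" "x \<le> a" "b \<in> P" "x \<le> b"
  shows "a \<le> b \<or> b \<le> a"
  using assms(1,3,5)
proof (induction "card {w\<in>P. x < w}" arbitrary: x rule: less_induct)
  case (less x)
  have xP: "x \<in> P" using less.prems top_forest_subset by auto
  show ?case
  proof (cases "x = a \<or> x = b")
    case True
    then show ?thesis using less.prems by auto
  next
    case False
    then have "x < a" "x < b" using less.prems by auto
    obtain a' where a': "covers P a' x" "a' \<le> a"
      using finite_upper_cover[OF finite xP assms(2) \<open>x < a\<close>] by metis
    obtain b' where b': "covers P b' x" "b' \<le> b"
      using finite_upper_cover[OF finite xP assms(4) \<open>x < b\<close>] by metis
    have "b' = a'" using top_forest_cover_unique[OF less.prems(1) b'(1) a'(1)] .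
    have a'P: "a' \<in> P" "x < a'" using a' by (auto simp: covers_def)
    then have "a' \<in> \<Gamma>" using top_forest_up less.prems(1) by auto
    moreover have "card {w\<in>P. a' < w} < card {w\<in>P. x < w}"
      by (rule psubset_card_mono) (use a'P finite in auto)
    ultimately show ?thesis using less.hyps a'(2) b'(2) \<open>b' = a'\<close> by blast
  qed
qed

lemma top_forest_color_inj: "x \<in> \<Gamma> \<Longrightarrow> y \<in> \<Gamma> \<Longrightarrow> c x = c y \<Longrightarrow> x = y"
  using coloring unfolding d_complete_coloring_def bij_betw_def inj_on_def by blast

lemma color_in_top_forest: "x \<in> P \<Longrightarrow> \<exists>t\<in>\<Gamma>. c t = c x"
  using coloring unfolding d_complete_coloring_def bij_betw_def by (metis PiE imageE)

lemma incomparable_color: "x \<in> P \<Longrightarrow> y \<in> P \<Longrightarrow> c x = c y \<Longrightarrow> x \<le> y \<or> y \<le> x"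
  using coloring unfolding d_complete_coloring_def incomparable_def by blast

lemma chain_color:
  assumes "v \<in> P" "u \<in> P" "\<And>x y. x \<in> interval P v u \<Longrightarrow> y \<in> interval P v u \<Longrightarrow> x \<le> y \<or> y \<le> x"
  shows "inj_on c (interval P v u)"
  using coloring assms unfolding d_complete_coloring_def chain_def by blast

lemma d_interval_color: "d_interval P v u \<Longrightarrow> c v = c u"
  using coloring unfolding d_complete_coloring_def by blast

lemma top_forest_no_color_above:
  assumes "x \<in> \<Gamma>" "y \<in> P" "x < y"
  shows "c x \<noteq> c y"
proof -
  have xP: "x \<in> P" using assms top_forest_subset by auto
  have "inj_on c (interval P x y)"
    by (rule chain_color[OF xP assms(2)]) (use top_forest_chain[OF assms(1)] in \<open>auto simp: interval_def\<close>)
  moreover have "x \<in> interval P x y" "y \<in> interval P x y"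
    using assms xP by (auto simp: interval_def)
  ultimately show ?thesis using assms(3) by (auto dest: inj_onD)
qed

text \<open>Two covers of q are incomparable and nothing lies between them and q. The three elements
  form the diamond for k = 3 without its top, which (D1) completes.\<close>

lemma two_covers_d_interval:
  assumes "covers P a q" "covers P b q" "a \<noteq> b"
  obtains u where "dk_interval P 3 q u" "a \<in> interval P q u" "b \<in> interval P q u"
proof -
  define g where "g n = (case n of dX \<Rightarrow> a | dY \<Rightarrow> b | _ \<Rightarrow> q)" for n
  have ab: "q < a" "q < b" "a \<in> P" "b \<in> P" "q \<in> P" and nb: "\<And>w. w \<in> P \<Longrightarrow> q < w \<Longrightarrow> \<not> w < a \<and> \<not> w < b"
    using assms by (auto simp: covers_def)
  have inc: "\<not> a \<le> b" "\<not> b \<le> a" using nb[of a] nb[of b] ab assms(3) by (auto simp: order_le_less)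
  have D: "diamond 3 - {dU 1} = {dX, dY, dV 1}" by (auto simp: diamond_def)
  have "dk_minus_convex P 3 {a, b, q}"
  proof (rule dk_minus_convexI[where g = g])
    show "g ` (diamond 3 - {dU 1}) = {a, b, q}" unfolding D by (simp add: g_def)
    show "g x \<le> g y \<longleftrightarrow> node_le x y" if "x \<in> diamond 3 - {dU 1}" "y \<in> diamond 3 - {dU 1}" for x y
      using that ab inc unfolding D by (auto simp: g_def dest: leD)
    show "convex_subset P {a, b, q}"
      unfolding convex_subset_def interval_def using ab nb inc by (auto simp: order_le_less dest: order.strict_trans)
  qed simp
  then show thesis
    by (rule d_complete_D1[OF d_complete finite order.refl, of _ q]) (use ab that in auto)
qed

text \<open>Descent from the top of P. If q has two covers, k = 3 works. If it has a single cover r,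
  then r is outside the top forest too, and the d_k-interval above r with q added below is the
  diamond for k + 1 without its top; (D1) supplies the top.\<close>

lemma bottom_of_d_interval:
  assumes "q \<in> P" "q \<notin> \<Gamma>"
  shows "\<exists>k\<ge>3. \<exists>u. dk_interval P k q u"
  using assms
proof (induction "card {w\<in>P. q < w}" arbitrary: q rule: less_induct)
  case (less q)
  show ?case
  proof (cases "\<exists>a b. covers P a q \<and> covers P b q \<and> a \<noteq> b")
    case True
    then show ?thesis using two_covers_d_interval by (metis order.refl)
  next
    case False
    obtain y z z' where y: "y \<in> P" "q \<le> y" "covers P z y" "covers P z' y" "z \<noteq> z'"
      using less.prems by (auto simp: top_forest_def Uniq_def)
    then have "q < y" using False by (auto simp: order_le_less)
    then obtain r where r: "covers P r q" "r \<le> y"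
      using finite_upper_cover[OF finite less.prems(1) y(1)] by metis
    have rP: "r \<in> P" "q < r" using r by (auto simp: covers_def)
    have up: "r \<le> w" if w: "w \<in> P" "q < w" for w
      using finite_upper_cover[OF finite less.prems(1) w] r(1) False by metis
    have "r \<notin> \<Gamma>" using r(2) y top_forest_up top_forest_cover_unique by metis
    moreover have "card {w\<in>P. r < w} < card {w\<in>P. q < w}"
      by (rule psubset_card_mono) (use rP finite in auto)
    ultimately obtain k u where ku: "k \<ge> 3" "dk_interval P k r u" using less.hyps rP(1) by blast
    then obtain g where g: "diamond_map P k g" "g (dV 1) = r" "g (dU 1) = u"
      using dk_interval_iff by blast
    \<comment> \<open>All indices grow by one: q is the new end of the lower tail and the old top
      becomes \<open>dU 2\<close>. The value at \<open>dU 1\<close> is a placeholder outside the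
      domain.\<close>
    define h where "h n = (case n of dU i \<Rightarrow> g (dU (i - 1)) | dV i \<Rightarrow> if i = 1 then q else g (dV (i - 1))
      | dX \<Rightarrow> g dX | dY \<Rightarrow> g dY)" for n
    have im: "g ` diamond k = interval P r u" using g by (simp add: diamond_map_def)
    have qg: "q < g a" if "a \<in> diamond k" for a
    proof -
      have "g a \<in> interval P r u" using im that by blast
      then show ?thesis using rP(2) by (auto simp: interval_def)
    qed
    let ?D = "diamond (k + 1) - {dU 1}"
    have him: "h ` ?D = insert q (interval P r u)"
      and D_eq: "?D = insert (dV 1) (node_shift 1 ` diamond k)"
      and h_shift: "\<And>b. b \<in> diamond k \<Longrightarrow> h (node_shift 1 b) = g b"
    proof -
      show D: "?D = insert (dV 1) (node_shift 1 ` diamond k)"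
      proof (intro set_eqI iffI)
        fix a assume "a \<in> ?D"
        then show "a \<in> insert (dV 1) (node_shift 1 ` diamond k)"
        proof (cases a)
          case (dU i)
          then have "a = node_shift 1 (dU (i - 1))" "dU (i - 1) \<in> diamond k"
            using \<open>a \<in> ?D\<close> by auto
          then show ?thesis by blast
        next
          case (dV i)
          then have "a = dV 1 \<or> a = node_shift 1 (dV (i - 1)) \<and> dV (i - 1) \<in> diamond k"
            using \<open>a \<in> ?D\<close> by auto
          then show ?thesis by blast
        next
          case dX
          then have "a = node_shift 1 dX" "dX \<in> diamond k" by auto
          then show ?thesis by blast
        next
          case dY
          then have "a = node_shift 1 dY" "dY \<in> diamond k" by auto
          then show ?thesis by blast
        qed
      next
        fix a assume "a \<in> insert (dV 1) (node_shift 1 ` diamond k)"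
        then consider "a = dV 1" | b where "b \<in> diamond k" "a = node_shift 1 b" by blast
        then show "a \<in> ?D"
        proof cases
          case 2
          then show ?thesis using ku(1) by (cases b) auto
        qed (use ku(1) in auto)
      qed
      show hs: "h (node_shift 1 b) = g b" if "b \<in> diamond k" for b
        using that by (cases b) (auto simp: h_def)
      have "h (dV 1) = q" by (simp add: h_def)
      then show "h ` ?D = insert q (interval P r u)" unfolding D using im hs by (simp add: image_image)
    qed
    have S: "dk_minus_convex P (k + 1) (insert q (interval P r u))"
    proof (rule dk_minus_convexI[where g = h])
      have le: "node_le (node_shift 1 a) (node_shift 1 b) \<longleftrightarrow> node_le a b"
        "node_le (dV 1) (node_shift 1 a)" "a \<in> diamond k \<Longrightarrow> \<not> node_le (node_shift 1 a) (dV 1)" for a b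
        by (cases a; cases b; auto)+
      have hq: "h (dV 1) = q" by (simp add: h_def)
      show "h a \<le> h b \<longleftrightarrow> node_le a b" if ab: "a \<in> ?D" "b \<in> ?D" for a b
      proof -
        consider "a = dV 1" "b = dV 1"
          | b' where "a = dV 1" "b' \<in> diamond k" "b = node_shift 1 b'"
          | a' where "b = dV 1" "a' \<in> diamond k" "a = node_shift 1 a'"
          | a' b' where "a' \<in> diamond k" "b' \<in> diamond k" "a = node_shift 1 a'" "b = node_shift 1 b'"
          using ab unfolding D_eq by blast
        then show ?thesis
        proof cases
          case 1
          then show ?thesis by simp
        next
          case 2
          then show ?thesis using h_shift le(2) hq qg by (simp add: less_imp_le)
        next
          case 3
          then show ?thesis using h_shift le(3) hq qg[of a'] by (simp add: less_le_not_le)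
        next
          case 4
          then show ?thesis using h_shift le(1) diamond_map_le[OF g(1)] by simp
        qed
      qed
      have "w \<in> insert q (interval P r u)"
        if "x \<in> insert q (interval P r u)" "y \<in> insert q (interval P r u)" "w \<in> interval P x y" for x y w
      proof (cases "w = q")
        case False
        have "q \<le> x" using that(1) rP(2) by (auto simp: interval_def)
        then have "q < w" "w \<in> P" using that(3) False by (auto simp: interval_def order_le_less)
        moreover have "y \<noteq> q" using that(3) \<open>q < w\<close> by (auto simp: interval_def dest: leD)
        ultimately show ?thesis using that up by (auto simp: interval_def intro: order.trans)
      qed simp
      then show "convex_subset P (insert q (interval P r u))"
        using less.prems(1) by (auto simp: convex_subset_def interval_def)
    qed (use ku him in auto)
    obtain u' where "dk_interval P (k + 1) q u'"
      by (rule d_complete_D1[OF d_complete finite _ S, of q]) (use ku rP in \<open>auto simp: interval_def\<close>)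
    then show ?thesis using ku(1) by (intro exI[of _ "k + 1"]) auto
  qed
qed

lemma diamond_color_UV:
  "diamond_map P k g \<Longrightarrow> 1 \<le> i \<Longrightarrow> i \<le> k - 2 \<Longrightarrow> c (g (dV i)) = c (g (dU i))"
  using diamond_map_d_interval d_interval_color by blast

lemma diamond_color_chain:
  assumes g: "diamond_map P k g" and k: "k \<ge> 3" and s: "s = dX \<or> s = dY"
    and ab: "a \<in> diamond k" "b \<in> diamond k" "node_le s a" "node_le s b" "c (g a) = c (g b)"
  shows "a = b"
proof -
  have s': "s \<in> diamond k" "dU 1 \<in> diamond k" using s k by auto
  have top: "node_le d (dU 1)" if "node_le s d" "d \<in> diamond k" for d
    using that s by (cases d) auto
  have int: "interval P (g s) (g (dU 1)) = g ` {d\<in>diamond k. node_le s d \<and> node_le d (dU 1)}"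
    by (rule diamond_map_interval[OF g s'])
  have "inj_on c (interval P (g s) (g (dU 1)))"
  proof (rule chain_color)
    have chain: "node_le d e \<or> node_le e d" if "node_le s d" "node_le s e" for d e
      using that s by (cases d; cases e) auto
    fix x y assume "x \<in> interval P (g s) (g (dU 1))" "y \<in> interval P (g s) (g (dU 1))"
    then obtain d e where "x = g d" "y = g e" "d \<in> diamond k" "e \<in> diamond k" "node_le s d" "node_le s e"
      unfolding int by blast
    then show "x \<le> y \<or> y \<le> x" using diamond_map_le[OF g] chain[of d e] by blast
  qed (use diamond_map_in[OF g] s' in auto)
  then have "g a = g b" using ab top unfolding int by (auto dest: inj_onD)
  then show ?thesis using diamond_map_eq[OF g] ab by simp
qed

definition upper :: "diamond_node \<Rightarrow> diamond_node" where
  "upper a = (case a of dV i \<Rightarrow> dU i | _ \<Rightarrow> a)"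

lemma diamond_color_upper:
  assumes "diamond_map P k g" "a \<in> diamond k"
  shows "c (g a) = c (g (upper a))" "upper a \<in> diamond k"
  using assms diamond_color_UV[OF assms(1)] by (cases a; simp add: upper_def)+

text \<open>Replacing \<open>dV i\<close> by \<open>dU i\<close> does not change colors, so only the
  upper half matters. There the tail together with either side is a chain and has distinct colors,
  and the two sides are incomparable.\<close>

lemma diamond_color_eq:
  assumes g: "diamond_map P k g" and k: "k \<ge> 3" and ab: "a \<in> diamond k" "b \<in> diamond k"
  shows "c (g a) = c (g b) \<longleftrightarrow> upper a = upper b"
proof
  show "upper a = upper b \<Longrightarrow> c (g a) = c (g b)" using diamond_color_upper(1)[OF g] ab by metis
  assume "c (g a) = c (g b)"
  then have eq: "c (g (upper a)) = c (g (upper b))" using diamond_color_upper(1)[OF g] ab by simp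
  have D: "upper a \<in> diamond k" "upper b \<in> diamond k" using diamond_color_upper(2)[OF g] ab by auto
  have up: "upper d = dX \<or> upper d = dY \<or> node_le dX (upper d) \<and> node_le dY (upper d)" for d
    by (cases d) (auto simp: upper_def)
  have XY: "c (g dX) \<noteq> c (g dY)"
    using incomparable_color[of "g dX" "g dY"] diamond_map_in[OF g] diamond_map_le[OF g] by auto
  have "node_le dX dX" "node_le dY dY" by auto
  then consider "node_le dX (upper a)" "node_le dX (upper b)" | "node_le dY (upper a)" "node_le dY (upper b)"
    | "upper a = dX" "upper b = dY" | "upper a = dY" "upper b = dX"
    using up[of a] up[of b] by metis
  then show "upper a = upper b"
    using diamond_color_chain[OF g k _ D _ _ eq] XY eq by cases auto
qed

lemma d_interval_color_succ:
  assumes "d_interval P v u"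
  shows "color_succ P c v u"
proof -
  obtain k where k: "k \<ge> 3" "dk_interval P k v u" using assms by (auto simp: d_interval_def)
  then obtain g where g: "diamond_map P k g" "g (dV 1) = v" "g (dU 1) = u" using dk_interval_iff by blast
  have D: "dV 1 \<in> diamond k" "dU 1 \<in> diamond k" using k by auto
  have "v < u" using diamond_map_less[OF g(1) D] g by simp
  moreover have "c w \<noteq> c u" if w: "w \<in> P" "v < w" "w < u" for w
  proof
    assume eq: "c w = c u"
    obtain a where a: "a \<in> diamond k" "w = g a"
      using diamond_map_surj[OF g(1) w(1)] w g less_imp_le by metis
    then have "upper a = dU 1" using diamond_color_eq[OF g(1) k(1) a(1) D(2)] eq g(3) by (simp add: upper_def)
    then have "a = dU 1 \<or> a = dV 1" by (cases a) (auto simp: upper_def)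
    then show False using a w g by auto
  qed
  ultimately show ?thesis
    using k(2) d_interval_color[OF assms] by (auto simp: color_succ_def dk_interval_def)
qed

lemma color_succ_unique: "color_succ P c v u \<Longrightarrow> color_succ P c v u' \<Longrightarrow> u = u'"
  using incomparable_color[of u u'] unfolding color_succ_def by (metis order_le_less)

lemma color_succ_unique_below: "color_succ P c v u \<Longrightarrow> color_succ P c v' u \<Longrightarrow> v = v'"
  using incomparable_color[of v v'] unfolding color_succ_def by (metis order_le_less)

text \<open>An element whose color recurs above it is outside the top forest, hence the bottom of
  some d_k-interval. The top of this interval is the next occurrence of the color, which is
  unique.\<close>

lemma d_interval_iff_color_succ: "d_interval P v u \<longleftrightarrow> color_succ P c v u"
proof
  assume vu: "color_succ P c v u"
  then have "v \<in> P" "v \<notin> \<Gamma>" using top_forest_no_color_above by (auto simp: color_succ_def)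
  then obtain u' where "d_interval P v u'" using bottom_of_d_interval unfolding d_interval_def by blast
  then show "d_interval P v u"
    using d_interval_color_succ[of v u'] color_succ_unique[OF vu] by auto
qed (rule d_interval_color_succ)

lemma color_succ_diamond_map:
  assumes "color_succ P c v u"
  obtains k g where "k \<ge> 3" "diamond_map P k g" "g (dV 1) = v" "g (dU 1) = u"
  using assms unfolding d_interval_iff_color_succ[symmetric] d_interval_def
  using dk_interval_iff by metis

lemma not_top_forest_color_succ:
  "v \<in> P \<Longrightarrow> v \<notin> \<Gamma> \<Longrightarrow> \<exists>u. color_succ P c v u"
  using bottom_of_d_interval unfolding d_interval_iff_color_succ[symmetric] d_interval_def by blast

lemma adj_sym: "adj i j \<Longrightarrow> adj j i"
  unfolding adj_def top_forest_adjacent_def by blast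

lemma adj_rep:
  assumes "adj (c x) (c y)" "x \<in> \<Gamma>" "y \<in> \<Gamma>"
  shows "covers P x y \<or> covers P y x"
  using assms top_forest_color_inj unfolding adj_def top_forest_adjacent_def by blast

lemma adj_irrefl: "\<not> adj i i"
  unfolding adj_def top_forest_adjacent_def using top_forest_color_inj by (auto simp: covers_def)

text \<open>A cover of v outside [v, u] and one inside would span a d_3-interval with bottom v. Its
  top is the next occurrence of the color of v, hence u.\<close>

lemma upper_cover_in_d_interval:
  assumes vu: "color_succ P c v u" and y: "covers P y v"
  shows "y \<le> u"
proof (rule ccontr)
  assume "\<not> y \<le> u"
  have "v \<in> P" "u \<in> P" "v < u" using vu by (auto simp: color_succ_def)
  then obtain x where x: "covers P x v" "x \<le> u" using finite_upper_cover[OF finite] by metis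
  then have "x \<noteq> y" using \<open>\<not> y \<le> u\<close> by auto
  then obtain u' where u': "dk_interval P 3 v u'" "y \<in> interval P v u'"
    using two_covers_d_interval[OF x(1) y] by metis
  then have "d_interval P v u'" by (auto simp: d_interval_def)
  then have "u' = u" using d_interval_color_succ color_succ_unique vu by blast
  with u' \<open>\<not> y \<le> u\<close> show False by (auto simp: interval_def)
qed

text \<open>Descent from the top forest, where adjacency is defined. Elsewhere x is the bottom of a
  diamond containing y, and the cover at the bottom is mirrored by one at the top with the same two
  colors, whose lower element is above x.\<close>

lemma covers_adj:
  assumes "covers P y x"
  shows "adj (c x) (c y)"
  using assms
proof (induction "card {w\<in>P. x < w}" arbitrary: x y rule: less_induct)
  case (less x y)
  have xy: "x \<in> P" "y \<in> P" "x < y" using less.prems by (auto simp: covers_def)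
  have smaller: "adj (c a) (c b)" if "covers P b a" "x < a" for a b
  proof (rule less.hyps[OF _ that(1)])
    show "card {w\<in>P. a < w} < card {w\<in>P. x < w}"
      by (rule psubset_card_mono) (use that finite in \<open>auto simp: covers_def\<close>)
  qed
  show ?case
  proof (cases "x \<in> \<Gamma>")
    case True
    then have "y \<in> \<Gamma>" using top_forest_up xy by auto
    then show ?thesis using True less.prems unfolding adj_def top_forest_adjacent_def by blast
  next
    case False
    then obtain u where u: "color_succ P c x u" using not_top_forest_color_succ xy by blast
    then obtain k g where g: "k \<ge> 3" "diamond_map P k g" "g (dV 1) = x" "g (dU 1) = u"
      using color_succ_diamond_map by metis
    have D: "dV 1 \<in> diamond k" "dU 1 \<in> diamond k" using g by auto
    obtain a where a: "a \<in> diamond k" "y = g a"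
      using diamond_map_surj[OF g(2) xy(2)] upper_cover_in_d_interval[OF u less.prems] xy g less_imp_le by metis
    have cu: "c x = c u" using u by (simp add: color_succ_def)
    have no: "\<not> (x < g b \<and> g b < g a)" if "b \<in> diamond k" for b
      using less.prems diamond_map_in[OF g(2) that] a by (auto simp: covers_def)
    have a_ne: "a \<noteq> dV 1" using a xy g by auto
    have "c y = c (g (upper a))" using diamond_color_upper(1)[OF g(2) a(1)] a by simp
    moreover have "covers P u (g (upper a)) \<and> x < g (upper a)"
    proof (cases "k = 3")
      case True
      then have k3: "diamond k = {dU 1, dX, dY, dV 1}" by (auto simp: diamond_def)
      have "x < g dX" "g dX < g (dU 1)"
        using diamond_map_less[OF g(2) D(1), of dX] diamond_map_less[OF g(2) _ D(2), of dX] g(3) by auto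
      then have "a \<noteq> dU 1" using no[of dX] by auto
      then have "a = dX \<or> a = dY" using a(1) a_ne unfolding k3 by auto
      then have "upper a = a" "covers P (g (dU 1)) (g a)"
        unfolding upper_def by (auto intro!: diamond_map_covers[OF g(2)] simp: k3)
      then show ?thesis using g a xy by simp
    next
      case False
      then have k4: "k \<ge> 4" using g by simp
      have V2: "dV 2 \<in> diamond k" using k4 by simp
      have "x < g (dV 2)" using diamond_map_less[OF g(2) D(1) V2] g(3) by simp
      then have "\<not> node_le (dV 2) a \<or> a = dV 2"
        using no[OF V2] diamond_map_less[OF g(2) V2 a(1)] by auto
      then have "a = dV 2" using a(1) a_ne by (cases a) auto
      then have up: "upper a = dU 2" by (simp add: upper_def)
      have "covers P (g (dU 1)) (g (dU 2))"
      proof (rule diamond_map_covers[OF g(2)])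
        fix d assume "d \<in> diamond k" "node_le (dU 2) d" "node_le d (dU 1)"
        then show "d = dU 2 \<or> d = dU 1" by (cases d) auto
      qed (use k4 in auto)
      moreover have "x < g (dU 2)" using diamond_map_less[OF g(2), of "dV 1" "dU 2"] g k4 by auto
      ultimately show ?thesis using up g by simp
    qed
    ultimately have "adj (c y) (c u)" using smaller by simp
    then show ?thesis using cu adj_sym by simp
  qed
qed

text \<open>A minimal node of a cycle in the top forest would be covered by both its neighbours.\<close>

lemma no_adj_cycle:
  fixes s :: "nat \<Rightarrow> 'i"
  assumes n: "n \<ge> 2" and inj: "inj_on s {..n}" and col: "s ` {..n} \<subseteq> c ` P"
    and path: "\<And>l. l < n \<Longrightarrow> adj (s l) (s (Suc l))"
  shows "\<not> adj (s n) (s 0)"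
proof
  assume close: "adj (s n) (s 0)"
  have "\<exists>t\<in>\<Gamma>. c t = s l" if "l \<le> n" for l
    using color_in_top_forest col that by (metis atMost_iff image_iff image_subset_iff)
  then obtain r where r: "\<And>l. l \<le> n \<Longrightarrow> r l \<in> \<Gamma> \<and> c (r l) = s l" by metis
  obtain m where m: "m \<in> r ` {..n}" "\<And>b. b \<in> r ` {..n} \<Longrightarrow> b \<le> m \<Longrightarrow> m = b"
    using finite_has_minimal[of "r ` {..n}"] by blast
  then obtain l where l: "l \<le> n" "m = r l" by auto
  define nx pv where "nx = (if l = n then 0 else Suc l)" and "pv = (if l = 0 then n else l - 1)"
  have le: "nx \<le> n" "pv \<le> n" using l by (auto simp: nx_def pv_def)
  have a: "adj (s l) (s nx)" "adj (s l) (s pv)"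
    using path[of l] path[of "l - 1"] close adj_sym l by (auto simp: nx_def pv_def)
  have cov: "covers P (r j) (r l)" if "adj (s l) (s j)" "j \<le> n" for j
  proof -
    have "covers P (r l) (r j) \<or> covers P (r j) (r l)" using adj_rep[of "r l" "r j"] r l that by simp
    moreover have "\<not> r j < r l" using m(2)[of "r j", OF _ less_imp_le] that(2) l(2) by auto
    ultimately show ?thesis by (auto simp: covers_def)
  qed
  have "r nx = r pv"
    using top_forest_cover_unique[of "r l" "r nx" "r pv"] cov a le r l by blast
  then have "s nx = s pv" using r le by metis
  then have "nx = pv" using inj le by (auto dest: inj_onD)
  then show False using n l by (auto simp: nx_def pv_def split: if_splits)
qed

end

section \<open>Neighbours inside a diamond and comparability of adjacent colors\<close>

context d_complete_poset
begin

lemma diamond_3_cover: "diamond_map P k g \<Longrightarrow> k = 3 \<Longrightarrow> t = dX \<or> t = dY \<Longrightarrow>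
    covers P (g t) (g (dV 1)) \<and> covers P (g (dU 1)) (g t)"
  by (auto intro!: diamond_map_covers simp: diamond_def)

lemma diamond_cover_side:
  assumes "k \<ge> 3" "diamond_map P k g" "t = dX \<or> t = dY"
  shows "covers P (g (dU (k - 2))) (g t)"
proof (rule diamond_map_covers[OF assms(2)])
  fix d assume "d \<in> diamond k" "node_le t d" "node_le d (dU (k - 2))"
  then show "d = t \<or> d = dU (k - 2)" using assms(3) by (cases d) auto
qed (use assms in auto)

lemma diamond_cover_U:
  assumes "diamond_map P k g" "1 \<le> i" "i < k - 2"
  shows "covers P (g (dU i)) (g (dU (Suc i)))"
proof (rule diamond_map_covers[OF assms(1)])
  fix d assume "d \<in> diamond k" "node_le (dU (Suc i)) d" "node_le d (dU i)"
  then show "d = dU (Suc i) \<or> d = dU i" by (cases d) auto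
qed (use assms in auto)

lemma diamond_cover_V:
  assumes "diamond_map P k g" "1 \<le> i" "i < k - 2"
  shows "covers P (g (dV (Suc i))) (g (dV i))"
proof (rule diamond_map_covers[OF assms(1)])
  fix d assume "d \<in> diamond k" "node_le (dV i) d" "node_le d (dV (Suc i))"
  then show "d = dV i \<or> d = dV (Suc i)" by (cases d) auto
qed (use assms in auto)

text \<open>The colors met on the way from \<open>dU 1\<close> down the upper tail to a side form a
  path of adjacent colors. A further color adjacent to that of \<open>dU 1\<close> would close it to
  a cycle with at least three nodes, against \<open>no_adj_cycle\<close>.\<close>

lemma diamond_adj:
  assumes k: "k \<ge> 3" and g: "diamond_map P k g" and a: "a \<in> diamond k" "adj (c (g a)) (c (g (dU 1)))"
  shows "k = 3 \<and> (a = dX \<or> a = dY) \<or> k \<ge> 4 \<and> (a = dU 2 \<or> a = dV 2)"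
proof -
  have D: "dU 1 \<in> diamond k" using k by simp
  have up: "upper a \<in> diamond k" "adj (c (g (upper a))) (c (g (dU 1)))"
    using diamond_color_upper[OF g a(1)] a(2) by simp_all
  have u1: "upper a \<noteq> dU 1" using up(2) adj_irrefl by auto
  define m where "m = k - 2"
  have no: "\<not> adj (c (g (nd n))) (c (g (nd 0)))"
    if t: "t = dX \<or> t = dY" and nd: "\<And>l. nd l = (if l < m then dU (Suc l) else t)" and n: "n \<ge> 2" "n \<le> m" for t nd n
  proof -
    have ndD: "nd l \<in> diamond k" "upper (nd l) = nd l" for l using t by (auto simp: nd m_def upper_def)
    have "\<not> adj ((\<lambda>l. c (g (nd l))) n) ((\<lambda>l. c (g (nd l))) 0)"
    proof (rule no_adj_cycle[OF n(1)])
      show "inj_on (\<lambda>l. c (g (nd l))) {..n}"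
      proof (rule inj_onI)
        fix x y assume xy: "x \<in> {..n}" "y \<in> {..n}" "c (g (nd x)) = c (g (nd y))"
        then have "nd x = nd y" using diamond_color_eq[OF g k ndD(1) ndD(1)] ndD(2) by simp
        then show "x = y" using xy n t by (auto simp: nd split: if_splits)
      qed
      show "(\<lambda>l. c (g (nd l))) ` {..n} \<subseteq> c ` P" using diamond_map_in[OF g ndD(1)] by auto
      fix l assume l: "l < n"
      have "covers P (g (nd l)) (g (nd (Suc l)))"
      proof (cases "Suc l < m")
        case True
        then show ?thesis using diamond_cover_U[OF g, of "Suc l"] by (simp add: nd m_def)
      next
        case False
        then have "l < m" "Suc l = k - 2" using l n by (auto simp: m_def)
        then show ?thesis using diamond_cover_side[OF k g t] False by (simp add: nd)
      qed
      then show "adj (c (g (nd l))) (c (g (nd (Suc l))))" using covers_adj adj_sym by blast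
    qed
    then show ?thesis by simp
  qed
  show ?thesis
  proof (cases "k = 3")
    case True
    then show ?thesis using a(1) u1 by (auto simp: diamond_def upper_def)
  next
    case False
    then have k4: "k \<ge> 4" "m \<ge> 2" using k by (auto simp: m_def)
    have side: False if "upper a = t" "t = dX \<or> t = dY" for t
      using no[OF that(2), of "\<lambda>l. if l < m then dU (Suc l) else t" m] up(2) that(1) k4 by simp
    have "\<not> 3 \<le> j" if "upper a = dU j" for j
    proof
      assume "3 \<le> j"
      then obtain l where "j = Suc l" by (cases j) auto
      then show False
        using no[of dX "\<lambda>l. if l < m then dU (Suc l) else dX" l] up that k4 \<open>3 \<le> j\<close> by (simp add: m_def)
    qed
    moreover obtain j where j: "upper a = dU j"
      using side by (cases a) (auto simp: upper_def)
    moreover have "1 \<le> j" "j \<noteq> 1" using up(1) u1 j by auto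
    ultimately have "upper a = dU 2" by (cases "j = 2") auto
    then have "a = dU 2 \<or> a = dV 2" by (cases a) (auto simp: upper_def)
    with k4 show ?thesis by simp
  qed
qed

lemma color_succ_card:
  assumes vu: "color_succ P c v u"
  shows "card {n\<in>P. v < n \<and> n < u \<and> adj (c n) (c v)} = 2"
proof -
  obtain k g where g: "k \<ge> 3" "diamond_map P k g" "g (dV 1) = v" "g (dU 1) = u"
    using color_succ_diamond_map[OF vu] by metis
  have cu: "c v = c u" using vu by (simp add: color_succ_def)
  have D: "dV 1 \<in> diamond k" "dU 1 \<in> diamond k" using g by auto
  define T where "T = (if k = 3 then {dX, dY} else {dU 2, dV 2})"
  have T: "T \<subseteq> diamond k" "card T = 2" "dV 1 \<notin> T" "dU 1 \<notin> T" using g(1) by (auto simp: T_def)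
  have "{n\<in>P. v < n \<and> n < u \<and> adj (c n) (c v)} = g ` T"
  proof (intro set_eqI iffI)
    fix n assume n: "n \<in> {n\<in>P. v < n \<and> n < u \<and> adj (c n) (c v)}"
    obtain a where a: "a \<in> diamond k" "n = g a"
      using diamond_map_surj[OF g(2), of n] n g less_imp_le by blast
    then show "n \<in> g ` T" using diamond_adj[OF g(1,2) a(1)] n cu g(4) by (auto simp: T_def)
  next
    fix n assume "n \<in> g ` T"
    then obtain a where a: "a \<in> T" "n = g a" by blast
    then have aD: "a \<in> diamond k" using T by auto
    have "node_le (dV 1) a" "node_le a (dU 1)" using aD by (cases a; simp)+
    then have "v < n" "n < u"
      using diamond_map_less[OF g(2) D(1) aD] diamond_map_less[OF g(2) aD D(2)] g a T by auto
    moreover have "adj (c n) (c u)"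
    proof (cases "k = 3")
      case True
      then show ?thesis using a diamond_3_cover[OF g(2), of a] covers_adj g(4) by (auto simp: T_def)
    next
      case False
      then have "1 < k - 2" using g(1) by simp
      then have "adj (c (g (dU 2))) (c u)"
        using covers_adj[OF diamond_cover_U[OF g(2), of 1]] g(4) by (simp add: numeral_2_eq_2)
      moreover have "c (g (dV 2)) = c (g (dU 2))"
        using diamond_color_UV[OF g(2), of 2] \<open>1 < k - 2\<close> by simp
      ultimately show ?thesis using a False by (auto simp: T_def)
    qed
    ultimately show "n \<in> {n\<in>P. v < n \<and> n < u \<and> adj (c n) (c v)}"
      using diamond_map_in[OF g(2) aD] a cu by simp
  qed
  moreover have "inj_on g T" using diamond_map_eq[OF g(2)] T(1) by (auto intro!: inj_onI)
  ultimately show ?thesis using T(2) by (simp add: card_image)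
qed

lemma D2: "color_succ P c v u \<Longrightarrow> covers P u x \<Longrightarrow> v \<le> x"
  using d_complete_D2[OF d_complete] d_interval_iff_color_succ by (auto simp: interval_def)

text \<open>In the diamond from v to u, y' either covers v or is the node \<open>dU 2\<close>. In
  the first case (D2) puts v into the interval from y to y'. In the second the previous occurrence y
  is \<open>dV 2\<close>, which lies above v.\<close>

lemma color_succ_above_not_adj:
  assumes vu: "color_succ P c v u" and y: "color_succ P c y y'" and y': "v < y'" "y' < u" "adj (c y') (c v)"
  shows "v \<le> y \<or> y \<le> v"
proof -
  obtain k g where g: "k \<ge> 3" "diamond_map P k g" "g (dV 1) = v" "g (dU 1) = u"
    using color_succ_diamond_map[OF vu] by metis
  have cu: "c v = c u" using vu by (simp add: color_succ_def)
  have D: "dV 1 \<in> diamond k" "dU 1 \<in> diamond k" using g by auto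
  have y'P: "y' \<in> P" using y by (simp add: color_succ_def)
  obtain a where a: "a \<in> diamond k" "y' = g a"
    using diamond_map_surj[OF g(2) y'P] y' g less_imp_le by metis
  then consider "k = 3" "a = dX \<or> a = dY" | "k \<ge> 4" "a = dU 2" | "k \<ge> 4" "a = dV 2"
    using diamond_adj[OF g(1,2) a(1)] y' cu g(4) by auto
  then show ?thesis
  proof cases
    case 1
    then have "covers P y' v" using diamond_3_cover[OF g(2)] a g(3) by auto
    then show ?thesis using D2[OF y] by blast
  next
    case 2
    then have k: "2 \<le> k - 2" by simp
    have "color_succ P c (g (dV 2)) y'"
      using d_interval_color_succ[OF diamond_map_d_interval[OF g(2) _ k]] 2 a by simp
    then have "y = g (dV 2)" using color_succ_unique_below[OF y] by blast
    then show ?thesis using diamond_map_le[OF g(2) D(1), of "dV 2"] g(3) k by auto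
  next
    case 3
    then have "covers P y' v" using diamond_cover_V[OF g(2), of 1] a g(3) by (simp add: numeral_2_eq_2)
    then show ?thesis using D2[OF y] by blast
  qed
qed

text \<open>Descent from the top. If x and y were incomparable, the next occurrences u of the color
  of x and y' of the color of y would, by induction, lie above both and be comparable. The lower one
  sits in the diamond of the other, and \<open>color_succ_above_not_adj\<close> compares the
  bottoms. If y is in the top forest, u covers y and (D2) applies.\<close>

lemma adj_comparable:
  assumes "x \<in> P" "y \<in> P" "adj (c x) (c y)"
  shows "x \<le> y \<or> y \<le> x"
  using assms
proof (induction "card {w\<in>P. x < w} + card {w\<in>P. y < w}" arbitrary: x y rule: less_induct)
  case (less x y)
  have IH: "x' \<le> y' \<or> y' \<le> x'"
    if "x' \<in> P" "y' \<in> P" "adj (c x') (c y')" "x \<le> x'" "y \<le> y'" "x < x' \<or> y < y'" for x' y'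
  proof (rule less.hyps[OF _ that(1,2,3)])
    have "card {w\<in>P. x' < w} \<le> card {w\<in>P. x < w}" "card {w\<in>P. y' < w} \<le> card {w\<in>P. y < w}"
      using that finite by (auto intro!: card_mono)
    moreover have "x < x' \<Longrightarrow> card {w\<in>P. x' < w} < card {w\<in>P. x < w}"
      "y < y' \<Longrightarrow> card {w\<in>P. y' < w} < card {w\<in>P. y < w}"
      using that finite by (auto intro!: psubset_card_mono)
    ultimately show "card {w\<in>P. x' < w} + card {w\<in>P. y' < w} < card {w\<in>P. x < w} + card {w\<in>P. y < w}"
      using that(6) by linarith
  qed
  have IH': "x' \<le> y' \<or> y' \<le> x'"
    if "x' \<in> P" "y' \<in> P" "adj (c x') (c y')" "x \<le> y'" "y \<le> x'" "x < y' \<or> y < x'" for x' y'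
    using IH[of y' x'] that adj_sym by blast
  have one: "x \<le> y \<or> y \<le> x"
    if xy: "x \<in> P" "y \<in> P" "adj (c x) (c y)" and x: "x \<notin> \<Gamma>"
      and IH: "\<And>x' y'. x' \<in> P \<Longrightarrow> y' \<in> P \<Longrightarrow> adj (c x') (c y') \<Longrightarrow> x \<le> x' \<Longrightarrow> y \<le> y' \<Longrightarrow>
        x < x' \<or> y < y' \<Longrightarrow> x' \<le> y' \<or> y' \<le> x'" for x y
  proof (rule ccontr)
    assume inc: "\<not> (x \<le> y \<or> y \<le> x)"
    obtain u where u: "color_succ P c x u" using not_top_forest_color_succ xy x by blast
    have uP: "u \<in> P" "x < u" "c u = c x" using u by (auto simp: color_succ_def)
    then have "y < u" using IH[of u y] xy inc by (auto simp: order_le_less dest: order.strict_trans)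
    show False
    proof (cases "y \<in> \<Gamma>")
      case True
      then have "u \<in> \<Gamma>" using top_forest_up uP \<open>y < u\<close> by auto
      then have "covers P u y" using adj_rep[of u y] True xy(3) uP(3) \<open>y < u\<close> by (auto simp: covers_def)
      then show False using D2[OF u] inc by blast
    next
      case False
      then obtain y' where y': "color_succ P c y y'" using not_top_forest_color_succ xy by blast
      have y'P: "y' \<in> P" "y < y'" "c y' = c y" using y' by (auto simp: color_succ_def)
      have xy': "x < y'" using IH[of x y'] y'P xy inc by (auto simp: order_le_less dest: order.strict_trans)
      have "u \<noteq> y'" using adj_irrefl xy(3) uP(3) y'P(3) by auto
      moreover have "u \<le> y' \<or> y' \<le> u" using IH[of u y'] uP y'P xy by auto
      ultimately consider "y' < u" | "u < y'" by (auto simp: order_le_less)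
      then show False
      proof cases
        case 1
        then show False
          using color_succ_above_not_adj[OF u y' xy' 1] adj_sym[OF xy(3)] y'P(3) inc by auto
      next
        case 2
        then show False
          using color_succ_above_not_adj[OF y' u \<open>y < u\<close> 2] xy(3) uP(3) inc by auto
      qed
    qed
  qed
  show ?case
  proof (cases "x \<in> \<Gamma>")
    case False
    then show ?thesis using one[OF less.prems] IH by blast
  next
    case True
    show ?thesis
    proof (cases "y \<in> \<Gamma>")
      case False
      have "y \<le> x \<or> x \<le> y"
        by (rule one) (use False less.prems adj_sym IH' in auto)
      then show ?thesis by blast
    next
      case yG: True
      then show ?thesis using adj_rep[OF less.prems(3) True] by (auto simp: covers_def)
    qed
  qed
qed

text \<open>Such a p lies in the top forest, where a neighbour above is a cover, and covers are
  unique.\<close>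

lemma color_top_card:
  assumes "p \<in> P" "\<And>w. w \<in> P \<Longrightarrow> p < w \<Longrightarrow> c w \<noteq> c p"
  shows "card {n\<in>P. p < n \<and> adj (c n) (c p)} \<le> 1"
proof -
  have "p \<in> \<Gamma>"
    using not_top_forest_color_succ[OF assms(1)] assms(2) unfolding color_succ_def by metis
  then have "covers P n p" if "n \<in> {n\<in>P. p < n \<and> adj (c n) (c p)}" for n
    using adj_rep[of n p] top_forest_up[of p n] that by (auto simp: covers_def)
  then have "x = y" if "x \<in> {n\<in>P. p < n \<and> adj (c n) (c p)}" "y \<in> {n\<in>P. p < n \<and> adj (c n) (c p)}" for x y
    using top_forest_cover_unique[OF \<open>p \<in> \<Gamma>\<close>] that by blast
  then show ?thesis using finite by (simp add: card_le_Suc0_iff_eq)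
qed

sublocale minuscule_heap P c adj
proof
  show "x \<le> y \<or> y \<le> x" if "x \<in> P" "y \<in> P" "c x = c y \<or> adj (c x) (c y)" for x y
    using that incomparable_color adj_comparable by blast
qed (use finite adj_sym adj_irrefl covers_adj color_succ_card color_top_card in auto)

end

section \<open>Hook monomials are roots\<close>

context minuscule_heap
begin

text \<open>Here positivity of the weight sum forces every color of the principal ideal, other than that of
  its top, to have exactly one neighbour above its highest occurrence.\<close>

lemma monomial_reflect_principal:
  fixes z :: "'i \<Rightarrow> 'f::field"
  assumes G: "order_filter P G" and u: "u \<in> G" "\<And>w. w \<in> G \<Longrightarrow> w < u \<Longrightarrow> c w \<noteq> c u"
    and q: "q \<in> minimal_elements G" "q \<noteq> u" and z: "z (c q) \<noteq> 0"
  shows "monomial (reflect (c q) z) {w\<in>G - {q}. w \<le> u} = monomial z {w\<in>G. w \<le> u}"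
proof -
  define i K F where "i = c q" and "K = {w\<in>G. w \<le> u}" and "F = G - K"
  have GP: "G \<subseteq> P" using G order_filter_subset by auto
  have KP: "K \<subseteq> P" and KG: "K \<subseteq> G" and finK: "finite K" using GP finite_sub[of K] by (auto simp: K_def)
  have qG: "q \<in> G" "q \<in> P" and qmin: "\<And>w. w \<in> G \<Longrightarrow> \<not> w < q" using q GP by (auto simp: minimal_elements_def)
  have Kq: "{w\<in>G - {q}. w \<le> u} = K - {q}" by (auto simp: K_def)
  have F: "order_filter P F"
  proof (rule order_filterI)
    fix x y assume "x \<in> F" "y \<in> P" "x < y"
    then show "y \<in> F" using order_filterD[OF G, of x y] by (auto simp: F_def K_def intro: order.trans less_imp_le)
  qed (use GP in \<open>auto simp: F_def\<close>)
  have GF: "G - F = K" using KG by (auto simp: F_def)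
  show ?thesis
  proof (cases "q \<le> u")
    case False
    have "reflect i z (c w) = z (c w)" if w: "w \<in> K" for w
    proof -
      have "\<not> (c w = i \<or> adj (c w) i)"
      proof
        assume "c w = i \<or> adj (c w) i"
        then have "w \<le> q \<or> q \<le> w" using near_comparable[of w q] w KP qG by (auto simp: i_def)
        then have "q \<le> w" using qmin[of w] w KG by (auto simp: order_le_less)
        then show False using w False by (auto simp: K_def)
      qed
      then show ?thesis by (simp add: reflect_def)
    qed
    moreover have "K - {q} = K" using False by (auto simp: K_def)
    ultimately show ?thesis
      unfolding Kq K_def[symmetric] i_def[symmetric] monomial_def by (intro prod.cong) auto
  next
    case True
    then have qK: "q \<in> K" and qu: "q < u" and uK: "u \<in> K" using qG q u by (auto simp: K_def)
    have top_weight: "weight F (c p) = 1 - int (card {n\<in>K. adj (c n) (c p) \<and> p < n})"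
      if p: "p \<in> K" and top: "\<And>x. x \<in> K \<Longrightarrow> c x = c p \<Longrightarrow> x \<le> p" for p
    proof -
      have up: "x \<in> K" if "x \<in> P - F" "p < x" for x
        using order_filterD[OF G, of p x, OF _ _ less_imp_le] that p KG by (auto simp: F_def)
      have "x \<le> p" if "x \<in> P - F" "c x = c p" for x
        using comparable_same[of x p] that up[of x] top[of x] subsetD[OF KP p] by auto
      then have "weight F (c p) = 1 - int (card {n\<in>P - F. adj (c n) (c p) \<and> p < n})"
        by (intro weight_color_top[OF F]) (use p KP in \<open>auto simp: F_def\<close>)
      moreover have "{n\<in>P - F. adj (c n) (c p) \<and> p < n} = {n\<in>K. adj (c n) (c p) \<and> p < n}"
        using up KP by (auto simp: F_def)
      ultimately show ?thesis by simp
    qed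
    \<comment> \<open>If w differs from u, the top occurrence p of its color in K is below u. A
      cover of p on the way to u then has an adjacent color and lies in K, so at least one neighbour
      is counted.\<close>
    have le1: "weight F (c w) \<le> 1" and le0: "w \<noteq> u \<Longrightarrow> weight F (c w) \<le> 0" if w: "w \<in> K" for w
    proof -
      obtain p where p: "p \<in> K" "c p = c w" "\<And>x. x \<in> K \<Longrightarrow> c x = c w \<Longrightarrow> x \<le> p"
        using obtain_color_top[OF KP w] by metis
      note wt = top_weight[OF p(1), unfolded p(2), OF p(3)]
      then show "weight F (c w) \<le> 1" by simp
      assume "w \<noteq> u"
      then have "w < u" using w by (auto simp: K_def)
      then have "p \<noteq> u" using u(2)[of w] w KG p(2) by auto
      then have "p < u" using p(1) by (auto simp: K_def)
      then obtain y where y: "covers P y p" "y \<le> u"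
        using finite_upper_cover[OF finite_P, of p u] p(1) uK KP by blast
      have "y \<in> G" using order_filterD[OF G, of p y] p(1) KG y(1) by (auto simp: covers_def)
      then have "y \<in> {n\<in>K. adj (c n) (c w) \<and> p < n}"
        using y covers_adj[OF y(1)] adj_sym p(2) by (auto simp: K_def covers_def)
      then have "card {n\<in>K. adj (c n) (c w) \<and> p < n} > 0" using finK card_gt_0_iff by fastforce
      then show "weight F (c w) \<le> 0" using wt by linarith
    qed
    obtain p where p: "p \<in> K" "c p = i" "\<And>x. x \<in> K \<Longrightarrow> c x = i \<Longrightarrow> x \<le> p"
      using obtain_color_top[OF KP qK, of i] unfolding i_def by metis
    have "F \<noteq> G" using uK KG by (auto simp: F_def)
    \<comment> \<open>Only the term of u can be positive, and it is at most 1. A positive sum of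
      integers therefore forces the nonpositive term of q to vanish.\<close>
    then have "0 < (\<Sum>w\<in>K. weight F (c w))"
      using sum_weight_pos[OF F G] unfolding GF by (auto simp: F_def)
    also have "(\<Sum>w\<in>K. weight F (c w)) =
        weight F (c u) + (weight F (c q) + (\<Sum>w\<in>K - {u} - {q}. weight F (c w)))"
      using sum.remove[OF finK uK, of "\<lambda>w. weight F (c w)"]
        sum.remove[of "K - {u}" q "\<lambda>w. weight F (c w)"] finK qK q(2) by simp
    finally have "0 < weight F (c u) + (weight F (c q) + (\<Sum>w\<in>K - {u} - {q}. weight F (c w)))" .
    moreover have "(\<Sum>w\<in>K - {u} - {q}. weight F (c w)) \<le> 0"
      by (rule sum_nonpos) (use le0 in auto)
    ultimately have "weight F (c q) = 0" using le1[OF uK] le0[OF qK q(2)] by linarith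
    then have d: "card {n\<in>K. adj (c n) i \<and> p < n} = 1"
      using top_weight[OF p(1)] p by (simp add: i_def)
    have "monomial (reflect (c q) z) (G - F - {q}) * z (c q) =
        z (c q) ^ card {n\<in>G - F. adj (c n) (c q) \<and> p < n} * monomial z (G - F)"
      by (rule monomial_reflect_remove_minimal[where z = z, OF F G _ q(1) _ z])
        (use p qK GF in \<open>auto simp: F_def i_def\<close>)
    then show ?thesis using z d unfolding GF Kq K_def[symmetric] i_def by simp
  qed
qed

end

section \<open>Hook monomials of a filter\<close>

lemma d_interval_filter:
  assumes "order_filter P G"
  shows "d_interval G v u \<longleftrightarrow> d_interval P v u \<and> v \<in> G"
proof -
  have "interval G v u = interval P v u" if "v \<in> G"
    using that assms order_filterD[OF assms that] by (auto simp: interval_def order_filter_def)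
  moreover have "u \<in> G" if "v \<in> G" "v \<le> u" "u \<in> P" using order_filterD[OF assms] that by blast
  moreover have "G \<subseteq> P" using assms order_filter_subset by blast
  ultimately show ?thesis unfolding d_interval_def dk_interval_def by auto
qed

lemma sides_filter:
  assumes "order_filter P G" "v \<in> G"
  shows "sides G v u x y \<longleftrightarrow> sides P v u x y"
  using assms order_filterD[OF assms] order_filter_subset[OF assms(1)]
  by (auto simp: sides_def interval_def)

context d_complete_poset
begin

lemma sides_diamond_map:
  assumes g: "diamond_map P k g"
  shows "sides P (g (dV 1)) (g (dU 1)) x y \<longleftrightarrow> x = g dX \<and> y = g dY \<or> x = g dY \<and> y = g dX"
proof
  assume s: "sides P (g (dV 1)) (g (dU 1)) x y"
  then have xy: "x \<in> g ` diamond k" "y \<in> g ` diamond k" "\<not> x \<le> y" "\<not> y \<le> x"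
    using g by (auto simp: sides_def diamond_map_def incomparable_def)
  then obtain a b where ab: "a \<in> diamond k" "b \<in> diamond k" "x = g a" "y = g b" by blast
  then have "\<not> node_le a b" "\<not> node_le b a" using xy diamond_map_le[OF g] by auto
  then have "a = dX \<and> b = dY \<or> a = dY \<and> b = dX" by (cases a; cases b) auto
  with ab show "x = g dX \<and> y = g dY \<or> x = g dY \<and> y = g dX" by auto
next
  have "g dX \<in> interval P (g (dV 1)) (g (dU 1))" "g dY \<in> interval P (g (dV 1)) (g (dU 1))"
    using g unfolding diamond_map_def by auto
  moreover have "incomparable (g dX) (g dY)"
    using diamond_map_le[OF g] by (simp add: incomparable_def)
  moreover assume "x = g dX \<and> y = g dY \<or> x = g dY \<and> y = g dX"
  ultimately show "sides P (g (dV 1)) (g (dU 1)) x y" by (auto simp: sides_def incomparable_def)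
qed

lemma ex_sides:
  assumes "color_succ P c v u"
  shows "\<exists>x y. sides P v u x y"
proof -
  obtain k g where "diamond_map P k g" "g (dV 1) = v" "g (dU 1) = u"
    using color_succ_diamond_map[OF assms] by metis
  then show ?thesis using sides_diamond_map by metis
qed

lemma sides_unique:
  assumes "color_succ P c v u" "sides P v u x y" "sides P v u x' y'"
  shows "x = x' \<and> y = y' \<or> x = y' \<and> y = x'"
proof -
  obtain k g where "diamond_map P k g" "g (dV 1) = v" "g (dU 1) = u"
    using color_succ_diamond_map[OF assms(1)] by metis
  then show ?thesis using sides_diamond_map assms by metis
qed

lemma sides_commute: "sides P v u x y \<longleftrightarrow> sides P v u y x"
  by (auto simp: sides_def incomparable_def)

text \<open>A diamond repeats the colors of its tails but not those of its sides. The last claim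
  makes the hook monomial of a side a plain product when the filter consists of the elements
  strictly above its new missing bottom v.\<close>

lemma sides_below_color:
  assumes vu: "color_succ P c v u" and s: "sides P v u x y"
  shows "v < x" "x < u" "x \<in> P" "\<And>w. w \<in> P \<Longrightarrow> v \<le> w \<Longrightarrow> w < x \<Longrightarrow> c w \<noteq> c x"
proof -
  obtain k g where g: "k \<ge> 3" "diamond_map P k g" "g (dV 1) = v" "g (dU 1) = u"
    using color_succ_diamond_map[OF vu] by metis
  have D: "dV 1 \<in> diamond k" "dU 1 \<in> diamond k" using g by auto
  obtain t where t: "t = dX \<or> t = dY" "x = g t" using sides_diamond_map[OF g(2)] s g by metis
  have tD: "t \<in> diamond k" using t by auto
  show "v < x" "x < u" "x \<in> P"
    using diamond_map_less[OF g(2) D(1) tD] diamond_map_less[OF g(2) tD D(2)] diamond_map_in[OF g(2) tD] g t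
    by auto
  fix w assume w: "w \<in> P" "v \<le> w" "w < x"
  then have "w \<le> u" using \<open>x < u\<close> by auto
  then obtain a where a: "a \<in> diamond k" "w = g a" using diamond_map_surj[OF g(2) w(1)] w g by metis
  then have "node_le a t" "a \<noteq> t" using diamond_map_less[OF g(2) a(1) tD] w t by auto
  then have "upper a \<noteq> upper t" using t(1) by (cases a) (auto simp: upper_def)
  then show "c w \<noteq> c x" using diamond_color_eq[OF g(2,1) a(1) tD] a t by simp
qed

text \<open>Between v and a side lies only the lower tail. The upper tail repeats its colors and
  \<open>dU 1\<close> repeats that of v, so the two half-open intervals below the sides and one
  factor for v use each color as often as the interval below u.\<close>

lemma sides_prod:
  fixes f :: "'i \<Rightarrow> 'f::comm_monoid_mult"
  assumes vu: "color_succ P c v u" and s: "sides P v u x y"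
  shows "(\<Prod>w\<in>{w\<in>P. v < w \<and> w \<le> u}. f (c w)) =
    f (c v) * (\<Prod>w\<in>{w\<in>P. v < w \<and> w \<le> x}. f (c w)) * (\<Prod>w\<in>{w\<in>P. v < w \<and> w \<le> y}. f (c w))"
proof -
  obtain k g where g: "k \<ge> 3" "diamond_map P k g" "g (dV 1) = v" "g (dU 1) = u"
    using color_succ_diamond_map[OF vu] by metis
  have D: "dV 1 \<in> diamond k" "dU 1 \<in> diamond k" using g by auto
  define m where "m = k - 2"
  have m: "1 \<le> m" using g(1) by (simp add: m_def)
  define h where "h a = f (c (g a))" for a
  have prod_below: "(\<Prod>w\<in>{w\<in>P. v < w \<and> w \<le> g b}. f (c w)) = (\<Prod>a\<in>{a\<in>diamond k. a \<noteq> dV 1 \<and> node_le a b}. h a)"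
    if b: "b \<in> diamond k" "g b \<le> u" for b
  proof -
    have "{w\<in>P. v < w \<and> w \<le> g b} = g ` {a\<in>diamond k. a \<noteq> dV 1 \<and> node_le a b}"
    proof (intro set_eqI iffI)
      fix w assume w: "w \<in> {w\<in>P. v < w \<and> w \<le> g b}"
      then have "w \<in> P" "g (dV 1) \<le> w" "w \<le> g (dU 1)" using b(2) g by auto
      then obtain a where a: "a \<in> diamond k" "w = g a" using diamond_map_surj[OF g(2)] by metis
      then show "w \<in> g ` {a\<in>diamond k. a \<noteq> dV 1 \<and> node_le a b}"
        using w diamond_map_le[OF g(2) a(1) b(1)] g by auto
    next
      fix w assume "w \<in> g ` {a\<in>diamond k. a \<noteq> dV 1 \<and> node_le a b}"
      then obtain a where a: "a \<in> diamond k" "a \<noteq> dV 1" "node_le a b" "w = g a" by blast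
      moreover have "node_le (dV 1) a" using a(1) by (cases a) auto
      ultimately show "w \<in> {w\<in>P. v < w \<and> w \<le> g b}"
        using diamond_map_less[OF g(2) D(1) a(1)] diamond_map_le[OF g(2) a(1) b(1)] diamond_map_in[OF g(2) a(1)] g
        by auto
    qed
    moreover have "inj_on g {a\<in>diamond k. a \<noteq> dV 1 \<and> node_le a b}"
      using diamond_map_eq[OF g(2)] by (auto intro!: inj_onI)
    ultimately show ?thesis by (simp add: prod.reindex h_def)
  qed
  have V: "(\<Prod>a\<in>dV ` {2..m}. h a) = (\<Prod>i\<in>{2..m}. h (dV i))"
    by (subst prod.reindex) (auto simp: inj_on_def)
  have U: "(\<Prod>a\<in>dU ` {2..m}. h a) = (\<Prod>i\<in>{2..m}. h (dV i))"
    by (subst prod.reindex) (auto simp: inj_on_def h_def diamond_color_UV[OF g(2)] m_def)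
  have side: "(\<Prod>a\<in>{a\<in>diamond k. a \<noteq> dV 1 \<and> node_le a t}. h a) = h t * (\<Prod>i\<in>{2..m}. h (dV i))"
    if t: "t = dX \<or> t = dY" for t
  proof -
    have "{a\<in>diamond k. a \<noteq> dV 1 \<and> node_le a t} = insert t (dV ` {2..m})"
    proof (intro set_eqI iffI)
      fix a assume "a \<in> {a\<in>diamond k. a \<noteq> dV 1 \<and> node_le a t}"
      then show "a \<in> insert t (dV ` {2..m})" using t by (cases a) (auto simp: m_def)
    qed (use t in \<open>auto simp: m_def\<close>)
    moreover have "t \<notin> dV ` {2..m}" using t by auto
    ultimately show ?thesis using V by simp
  qed
  have top: "{a\<in>diamond k. a \<noteq> dV 1 \<and> node_le a (dU 1)} =
      insert (dU 1) (insert dX (insert dY (dU ` {2..m} \<union> dV ` {2..m})))"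
  proof (intro set_eqI iffI)
    fix a assume "a \<in> {a\<in>diamond k. a \<noteq> dV 1 \<and> node_le a (dU 1)}"
    then show "a \<in> insert (dU 1) (insert dX (insert dY (dU ` {2..m} \<union> dV ` {2..m})))"
      by (cases a) (auto simp: m_def image_iff)
  qed (use m in \<open>auto simp: m_def\<close>)
  have all: "(\<Prod>a\<in>{a\<in>diamond k. a \<noteq> dV 1 \<and> node_le a (dU 1)}. h a) =
      h (dU 1) * (h dX * (h dY * ((\<Prod>i\<in>{2..m}. h (dV i)) * (\<Prod>i\<in>{2..m}. h (dV i)))))"
  proof -
    have "(\<Prod>a\<in>dU ` {2..m} \<union> dV ` {2..m}. h a) = (\<Prod>i\<in>{2..m}. h (dV i)) * (\<Prod>i\<in>{2..m}. h (dV i))"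
      unfolding U[symmetric] V[symmetric] by (subst prod.union_disjoint) (auto simp: U V)
    moreover have "dU 1 \<notin> insert dX (insert dY (dU ` {2..m} \<union> dV ` {2..m}))"
      "dX \<notin> insert dY (dU ` {2..m} \<union> dV ` {2..m})" "dY \<notin> dU ` {2..m} \<union> dV ` {2..m}" by auto
    moreover have "finite (dU ` {2..m} \<union> dV ` {2..m})" by auto
    ultimately show ?thesis by (simp only: top prod.insert finite_insert not_False_eq_True)
  qed
  have cu: "h (dU 1) = f (c v)" using vu g by (simp add: h_def color_succ_def)
  have XY: "dX \<in> diamond k" "dY \<in> diamond k" "g dX \<le> u" "g dY \<le> u"
    using diamond_map_le[OF g(2) _ D(2)] g(4) by auto
  from sides_diamond_map[OF g(2), of x y] s g consider "x = g dX" "y = g dY" | "x = g dY" "y = g dX" by auto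
  then show ?thesis
    using prod_below[OF D(2)] prod_below[OF XY(1,3)] prod_below[OF XY(2,4)] side[of dX] side[of dY] all cu g(4)
    by cases (simp_all add: mult_ac)
qed

text \<open>The bottom v is determined as the previous occurrence of the color of u, and the sides
  are determined up to order, in which the quotient is symmetric.\<close>

lemma is_hook_monomial_ex1:
  assumes G: "order_filter P G" and u: "u \<in> G"
  shows "\<exists>!h. is_hook_monomial G c z u h"
  using u
proof (induction "card {w\<in>P. w < u}" arbitrary: u rule: less_induct)
  case (less u)
  have GP: "G \<subseteq> P" using G order_filter_subset by blast
  have IH: "\<exists>!h. is_hook_monomial G c z w h" if "w \<in> G" "w < u" for w
  proof (rule less.hyps[OF _ that(1)])
    show "card {x\<in>P. x < w} < card {x\<in>P. x < u}"
      by (rule psubset_card_mono) (use that finite GP in auto)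
  qed
  show ?case
  proof (cases "\<exists>v. d_interval G v u")
    case False
    then have "is_hook_monomial G c z u h \<longleftrightarrow> h = (\<Prod>w\<in>{w\<in>G. w \<le> u}. z (c w))" for h
      using less.prems by (auto elim: is_hook_monomial.cases intro: is_hook_monomial.intros(1))
    then show ?thesis by (intro ex1I[of _ "\<Prod>w\<in>{w\<in>G. w \<le> u}. z (c w)"]) auto
  next
    case True
    then obtain v where v: "d_interval G v u" by blast
    then have vu: "color_succ P c v u" "v \<in> G"
      using d_interval_filter[OF G] d_interval_color_succ by auto
    obtain x y where xy: "sides P v u x y" using ex_sides[OF vu(1)] by blast
    have xyG: "x \<in> G" "y \<in> G" "x < u" "y < u" "v < u"
      using sides_below_color[OF vu(1) xy] sides_below_color[OF vu(1), of y x] xy sides_commute[of v u x y]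
        order_filterD[OF G vu(2), OF _ less_imp_le] vu(1) by (auto simp: color_succ_def)
    obtain hx hy hv where h: "is_hook_monomial G c z x hx" "is_hook_monomial G c z y hy" "is_hook_monomial G c z v hv"
      using IH xyG vu(2) by metis
    have "h' = hx * hy / hv" if "is_hook_monomial G c z u h'" for h'
      using that
    proof cases
      case (2 v' x' y' hx' hy' hv')
      have "color_succ P c v' u" using 2 d_interval_filter[OF G] d_interval_color_succ by auto
      then have v': "v' = v" using color_succ_unique_below[OF vu(1)] by blast
      then have "sides P v u x' y'" using 2 sides_filter[OF G vu(2)] by simp
      then have "x = x' \<and> y = y' \<or> x = y' \<and> y = x'" using sides_unique[OF vu(1) xy] by blast
      moreover have "hv' = hv" using IH[OF vu(2) xyG(5)] h 2 v' by blast
      moreover have "b = hx" if "is_hook_monomial G c z x b" for b using IH[OF xyG(1,3)] h that by blast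
      moreover have "b = hy" if "is_hook_monomial G c z y b" for b using IH[OF xyG(2,4)] h that by blast
      ultimately show ?thesis using 2 by (auto simp: mult.commute)
    qed (use True in auto)
    moreover have "is_hook_monomial G c z u (hx * hy / hv)"
      by (rule is_hook_monomial.intros(2)[OF v]) (use xy sides_filter[OF G vu(2)] h in auto)
    ultimately show ?thesis by blast
  qed
qed

lemma is_hook_monomial_iff:
  assumes "order_filter P G" "u \<in> G"
  shows "is_hook_monomial G c z u h \<longleftrightarrow> hook_monomial G c z u = h"
  using is_hook_monomial_ex1[OF assms, of z] unfolding hook_monomial_def by (metis the_equality)

lemma hook_monomial_principal:
  assumes G: "order_filter P G" "u \<in> G" and no: "\<And>w. w \<in> G \<Longrightarrow> w < u \<Longrightarrow> c w \<noteq> c u"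
  shows "hook_monomial G c z u = monomial z {w\<in>G. w \<le> u}"
proof -
  have "\<not> (\<exists>v. d_interval G v u)"
    using no d_interval_filter[OF G(1)] d_interval_color_succ unfolding color_succ_def by blast
  then have "is_hook_monomial G c z u (\<Prod>w\<in>{w\<in>G. w \<le> u}. z (c w))"
    using G by (intro is_hook_monomial.intros(1)) auto
  then show ?thesis unfolding is_hook_monomial_iff[OF G] by (simp add: monomial_def)
qed

lemma hook_monomial_sides:
  assumes G: "order_filter P G" and v: "v \<in> G" "color_succ P c v u" and s: "sides P v u x y"
  shows "hook_monomial G c z u = hook_monomial G c z x * hook_monomial G c z y / hook_monomial G c z v"
proof -
  have "u \<in> G" "x \<in> G" "y \<in> G"
    using sides_below_color[OF v(2) s] sides_below_color[OF v(2), of y x] s sides_commute[of v u x y]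
      order_filterD[OF G v(1), OF _ less_imp_le] v(2) by (auto simp: color_succ_def)
  note iff = is_hook_monomial_iff[where z = z, OF G this(1)] is_hook_monomial_iff[where z = z, OF G this(2)]
    is_hook_monomial_iff[where z = z, OF G this(3)] is_hook_monomial_iff[where z = z, OF G v(1)]
  have "d_interval G v u" using d_interval_filter[OF G] d_interval_iff_color_succ v by blast
  then show ?thesis unfolding iff(1)[symmetric]
    by (rule is_hook_monomial.intros(2)) (use sides_filter[OF G v(1)] s iff in auto)
qed

lemma hook_monomial_minimal:
  assumes G: "order_filter P G" and q: "q \<in> minimal_elements G"
  shows "hook_monomial G c z q = z (c q)"
proof -
  have "q \<in> G" "\<And>w. w \<in> G \<Longrightarrow> \<not> w < q" using q by (auto simp: minimal_elements_def)
  then have "{w\<in>G. w \<le> q} = {q}" by (auto simp: order_le_less)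
  then show ?thesis
    using hook_monomial_principal[OF G, of q z] \<open>q \<in> G\<close> \<open>\<And>w. w \<in> G \<Longrightarrow> \<not> w < q\<close> by (simp add: monomial_def)
qed

text \<open>The second part is the case in which \<open>u\<close> stops being the top of a \<open>d\<^sub>k\<close>-interval when \<open>q\<close> is
  removed; it is reduced to the filter generated by \<open>q\<close> by removing the other minimal elements.\<close>

lemma hook_monomial_reflect_aux:
  fixes z :: "'i \<Rightarrow> 'f::field"
  assumes G: "order_filter P G" and q: "q \<in> minimal_elements G" and z: "\<And>j. z j \<noteq> 0"
  shows "(\<forall>u\<in>G - {q}. hook_monomial G c z u = hook_monomial (G - {q}) c (reflect (c q) z) u) \<and>
    (\<forall>u x y. color_succ P c q u \<longrightarrow> sides P q u x y \<longrightarrow> monomial z {w\<in>G - {q}. w \<le> u} =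
      z (c q) * hook_monomial (G - {q}) c z x * hook_monomial (G - {q}) c z y)"
  using assms
proof (induction "card G" arbitrary: G q z rule: less_induct)
  case (less G q z)
  have smaller: "card (G' - {r}) < card G'" if "order_filter P G'" "r \<in> minimal_elements G'" for G' r
    using that(2) card_Diff1_less[OF finite_sub[OF order_filter_subset[OF that(1)]], of r]
    by (simp add: minimal_elements_def)
  have IH1: "hook_monomial G' c z u = hook_monomial (G' - {r}) c (reflect (c r) z) u"
    if "card G' < card G" "order_filter P G'" "r \<in> minimal_elements G'" "\<And>j. z j \<noteq> 0" "u \<in> G' - {r}"
    for G' r u and z :: "'i \<Rightarrow> 'f"
    using less.hyps[OF that(1-3), of z] that(4,5) by blast
  have IH2: "monomial z {w\<in>G' - {r}. w \<le> u} =
      z (c r) * hook_monomial (G' - {r}) c z x * hook_monomial (G' - {r}) c z y"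
    if "card G' < card G" "order_filter P G'" "r \<in> minimal_elements G'" "\<And>j. z j \<noteq> 0"
      "color_succ P c r u" "sides P r u x y" for G' r u x y and z :: "'i \<Rightarrow> 'f"
    using less.hyps[OF that(1-3), of z] that(4-6) by blast
  have C: "monomial z {w\<in>G - {q}. w \<le> u} =
      z (c q) * hook_monomial (G - {q}) c z x * hook_monomial (G - {q}) c z y"
    if G: "order_filter P G" and q: "q \<in> minimal_elements G" and z: "\<And>j. z j \<noteq> 0"
      and u: "color_succ P c q u" and s: "sides P q u x y" for q u x y and z :: "'i \<Rightarrow> 'f"
  proof -
    have GP: "G \<subseteq> P" using G order_filter_subset by blast
    have qG: "q \<in> G" "q \<in> P" and qmin: "\<And>w. w \<in> G \<Longrightarrow> \<not> w < q" using q GP by (auto simp: minimal_elements_def)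
    have xy: "q < x" "q < y" "x < u" "y < u" "x \<in> P" "y \<in> P"
      using sides_below_color[OF u s] sides_below_color[OF u, of y x] s sides_commute[of q u x y] by auto
    then have xyG: "x \<in> G" "y \<in> G" using order_filterD[OF G qG(1), OF _ less_imp_le] by auto
    have uG: "u \<in> G" "q < u" "c q = c u"
      using order_filterD[OF G qG(1), of u] u by (auto simp: color_succ_def)
    have Gq: "order_filter P (G - {q})" by (rule order_filter_remove_minimal[OF G q])
    show ?thesis
    proof (cases "\<exists>r\<in>minimal_elements G. r \<noteq> q")
      case True
      \<comment> \<open>Removing another minimal element r reflects all the monomials at its color.
        Both q and r are minimal, so their colors are neither equal nor adjacent and the factor at
        the color of q does not change.\<close>
      then obtain r where r: "r \<in> minimal_elements G" "r \<noteq> q" by blast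
      have rG: "r \<in> G" "r \<in> P" and rmin: "\<And>w. w \<in> G \<Longrightarrow> \<not> w < r" using r GP by (auto simp: minimal_elements_def)
      have r': "r \<in> minimal_elements (G - {q})" and q': "q \<in> minimal_elements (G - {r})"
        using r q by (auto simp: minimal_elements_def)
      have Gr: "order_filter P (G - {r})" by (rule order_filter_remove_minimal[OF G r(1)])
      have comm: "G - {q} - {r} = G - {r} - {q}" by auto
      define y' where "y' = reflect (c r) z"
      have y'0: "y' j \<noteq> 0" for j using reflect_nonzero[of z "c r" j] z by (simp add: y'_def)
      have "\<not> (c q = c r \<or> adj (c q) (c r))"
        using near_comparable[of q r] qG rG qmin[of r] rmin[of q] r(2) by (auto simp: order_le_less)
      then have y'q: "y' (c q) = z (c q)" by (simp add: y'_def reflect_def)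
      have ne: "u \<noteq> r" "x \<noteq> r" "y \<noteq> r" using uG(2) xy rmin qG by auto
      have "monomial y' {w\<in>G - {q} - {r}. w \<le> u} = monomial z {w\<in>G - {q}. w \<le> u}"
        unfolding y'_def
      proof (rule monomial_reflect_principal[OF Gq _ _ r' _ z])
        fix w assume "w \<in> G - {q}" "w < u"
        then have "w \<noteq> q" "w \<in> P" "\<not> w < q" using GP qmin by auto
        show "c w \<noteq> c u"
        proof
          assume "c w = c u"
          then have "q < w" using comparable_same[of q w] uG(3) qG \<open>w \<noteq> q\<close> \<open>w \<in> P\<close> \<open>\<not> w < q\<close> by auto
          then show False using u \<open>w < u\<close> \<open>c w = c u\<close> \<open>w \<in> P\<close> by (auto simp: color_succ_def)
        qed
      qed (use uG ne in auto)
      moreover have "monomial y' {w\<in>G - {r} - {q}. w \<le> u} =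
          y' (c q) * hook_monomial (G - {r} - {q}) c y' x * hook_monomial (G - {r} - {q}) c y' y"
        by (rule IH2[OF smaller[OF G r(1)] Gr q' y'0 u s])
      moreover have "hook_monomial (G - {q}) c z t = hook_monomial (G - {r} - {q}) c y' t"
        if "t = x \<or> t = y" for t
        unfolding y'_def comm[symmetric]
        by (rule IH1[OF smaller[OF G q] Gq r' z]) (use that xy xyG ne in auto)
      ultimately show ?thesis by (simp add: comm y'q)
    next
      case False
      have qle: "q \<le> w" if w: "w \<in> G" for w
      proof -
        have "finite {y\<in>G. y \<le> w}" using finite_sub[OF GP] by auto
        then obtain m where m: "m \<in> {y\<in>G. y \<le> w}" "\<And>b. b \<in> {y\<in>G. y \<le> w} \<Longrightarrow> b \<le> m \<Longrightarrow> m = b"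
          using finite_has_minimal[of "{y\<in>G. y \<le> w}"] w by blast
        have "\<not> b < m" if "b \<in> G" for b
          using m(1) m(2)[of b, OF _ less_imp_le] that by (auto intro: order.trans less_imp_le)
        then have "m \<in> minimal_elements G" using m(1) by (auto simp: minimal_elements_def)
        then show ?thesis using False m(1) by auto
      qed
      \<comment> \<open>Now q is the least element of G. Without q, principal ideals are half-open
        intervals above q, and the claim becomes \<open>sides_prod\<close>.\<close>
      have set: "{w\<in>G - {q}. w \<le> t} = {w\<in>P. q < w \<and> w \<le> t}" for t
        using qle GP order_filterD[OF G qG(1), OF _ less_imp_le] by (auto simp: order_le_less)
      have hk: "hook_monomial (G - {q}) c z t = monomial z {w\<in>P. q < w \<and> w \<le> t}"
        if t: "t = x \<or> t = y" for t
        unfolding set[symmetric]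
      proof (rule hook_monomial_principal[OF Gq])
        show "t \<in> G - {q}" using t xyG xy by auto
        fix w assume "w \<in> G - {q}" "w < t"
        then show "c w \<noteq> c t"
          using t sides_below_color(4)[OF u s, of w] sides_below_color(4)[OF u, of y x w] s
            sides_commute[of q u x y] qle GP by auto
      qed
      show ?thesis using sides_prod[OF u s, of z] unfolding hk[of x, simplified] hk[of y, simplified] set
        by (simp add: monomial_def)
    qed
  qed
  note G = less.prems(1) and q = less.prems(2) and z = less.prems(3)
  have "hook_monomial G c z u = hook_monomial (G - {q}) c (reflect (c q) z) u" if "u \<in> G - {q}" for u
    using that
  proof (induction "card {w\<in>P. w < u}" arbitrary: u rule: less_induct)
    case inner: (less u)
    have GP: "G \<subseteq> P" using G order_filter_subset by blast
    have uG: "u \<in> G" "u \<noteq> q" using inner.prems by auto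
    have qG: "q \<in> G" "q \<in> P" and qmin: "\<And>w. w \<in> G \<Longrightarrow> \<not> w < q" using q GP by (auto simp: minimal_elements_def)
    have Gq: "order_filter P (G - {q})" by (rule order_filter_remove_minimal[OF G q])
    have inIH: "hook_monomial G c z w = hook_monomial (G - {q}) c (reflect (c q) z) w"
      if "w \<in> G - {q}" "w < u" for w
    proof (rule inner.hyps[OF _ that(1)])
      show "card {x\<in>P. x < w} < card {x\<in>P. x < u}"
        by (rule psubset_card_mono) (use that GP finite in auto)
    qed
    have z'0: "reflect (c q) z j \<noteq> 0" for j by (rule reflect_nonzero[OF z])
    show ?case
    proof (cases "\<exists>w\<in>G. w < u \<and> c w = c u")
      case False
      have "hook_monomial G c z u = monomial z {w\<in>G. w \<le> u}"
        by (rule hook_monomial_principal[OF G uG(1)]) (use False in auto)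
      also have "\<dots> = monomial (reflect (c q) z) {w\<in>G - {q}. w \<le> u}"
        by (rule monomial_reflect_principal[symmetric, OF G uG(1) _ q _ z]) (use False uG in auto)
      also have "\<dots> = hook_monomial (G - {q}) c (reflect (c q) z) u"
        by (rule hook_monomial_principal[symmetric, OF Gq]) (use False uG in auto)
      finally show ?thesis .
    next
      case True
      then obtain w where w: "w \<in> G" "w < u" "c w = c u" by blast
      obtain v where v: "color_succ P c v u" "w \<le> v"
        using obtain_color_succ_below[of w u] w uG GP by blast
      have vG: "v \<in> G" "v < u" "c v = c u" using order_filterD[OF G w(1) _ v(2)] v(1) by (auto simp: color_succ_def)
      obtain x y where s: "sides P v u x y" using ex_sides[OF v(1)] by blast
      have xy: "v < x" "v < y" "x < u" "y < u" "x \<in> P" "y \<in> P"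
        using sides_below_color[OF v(1) s] sides_below_color[OF v(1), of y x] s sides_commute[of v u x y] by auto
      then have xyG: "x \<in> G" "y \<in> G" using order_filterD[OF G vG(1), OF _ less_imp_le] by auto
      then have xyq: "x \<in> G - {q}" "y \<in> G - {q}" using xy vG qmin by auto
      have main: "hook_monomial G c z u = hook_monomial G c z x * hook_monomial G c z y / hook_monomial G c z v"
        by (rule hook_monomial_sides[OF G vG(1) v(1) s])
      show ?thesis
      proof (cases "v = q")
        case False
        then have vq: "v \<in> G - {q}" using vG by auto
        show ?thesis
          unfolding main hook_monomial_sides[OF Gq vq v(1) s] inIH[OF xyq(1) xy(3)] inIH[OF xyq(2) xy(4)]
            inIH[OF vq vG(2)] ..
      next
        case True
        \<comment> \<open>The product formula for G - {q} is taken at the reflected point. There the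
          variable of q is inverted, which yields precisely the division by the hook monomial of
          q.\<close>
        have "hook_monomial (G - {q}) c (reflect (c q) z) u = monomial (reflect (c q) z) {w\<in>G - {q}. w \<le> u}"
        proof (rule hook_monomial_principal[OF Gq])
          fix t assume t: "t \<in> G - {q}" "t < u"
          show "c t \<noteq> c u"
          proof
            assume e: "c t = c u"
            then have "q < t" using comparable_same[of q t] True vG(3) qG t GP qmin[of t] by auto
            then show False using v(1) True t e GP by (auto simp: color_succ_def)
          qed
        qed (use uG in auto)
        also have "\<dots> = reflect (c q) z (c q) * hook_monomial (G - {q}) c (reflect (c q) z) x *
            hook_monomial (G - {q}) c (reflect (c q) z) y"
          by (rule C[OF G q z'0]) (use v s True in auto)
        also have "\<dots> = hook_monomial G c z u"
          unfolding main True hook_monomial_minimal[OF G q] inIH[OF xyq(1) xy(3)] inIH[OF xyq(2) xy(4)] reflect_self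
          by (simp add: divide_inverse)
        finally show ?thesis ..
      qed
    qed
  qed
  then show ?case using C[OF G q, of z] z by blast
qed

end

section \<open>Excited peaks and independence\<close>

lemma ex_minimal_element:
  fixes G :: "'a::order set"
  assumes "finite G" "G \<noteq> {}"
  obtains q where "q \<in> minimal_elements G"
proof -
  obtain q where q: "q \<in> G" "\<And>b. b \<in> G \<Longrightarrow> b \<le> q \<Longrightarrow> q = b"
    using finite_has_minimal[OF assms] by blast
  have "\<not> b < q" if "b \<in> G" for b using q(2)[OF that less_imp_le] by auto
  with q(1) that show thesis by (auto simp: minimal_elements_def)
qed

context minuscule_heap
begin

text \<open>An invariant of excitations. In \<open>peaks_excitation\<close> it shows that the target
  v of an excitation was not a peak before.\<close>

definition separated :: "'a set \<Rightarrow> bool" where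
  "separated D \<longleftrightarrow> (\<forall>d\<in>D. \<forall>e\<in>D. d < e \<and> c d = c e \<longrightarrow> (\<exists>n\<in>D. adj (c n) (c e) \<and> d < n \<and> n < e))"

lemma separated_filter:
  assumes F: "order_filter P F"
  shows "separated F"
  unfolding separated_def
proof (intro ballI impI)
  fix d e assume de: "d \<in> F" "e \<in> F" "d < e \<and> c d = c e"
  have FP: "F \<subseteq> P" using F order_filter_subset by blast
  obtain n where n: "covers P n d" "n \<le> e"
    using finite_upper_cover[OF finite_P, of d e] de FP by blast
  have a: "adj (c n) (c e)" using covers_adj[OF n(1)] adj_sym de by simp
  have "n \<in> P" "d < n" using n by (auto simp: covers_def)
  moreover have "n \<in> F" using order_filterD[OF F de(1) \<open>n \<in> P\<close>] \<open>d < n\<close> by auto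
  moreover have "n \<noteq> e" using a adj_irrefl by auto
  ultimately show "\<exists>n\<in>F. adj (c n) (c e) \<and> d < n \<and> n < e" using a n(2) by auto
qed

text \<open>The move from u to v passes no neighbour, so neighbours below u are already below v.
  Where u itself separated two elements, v takes over.\<close>

lemma separated_excitation:
  assumes D: "D \<subseteq> P" "separated D" and vu: "color_succ P c v u" "u \<in> D" "v \<notin> D"
    and free: "\<And>n. n \<in> D \<Longrightarrow> v \<le> n \<Longrightarrow> n \<le> u \<Longrightarrow> \<not> adj (c n) (c u)"
  shows "separated (insert v (D - {u}))"
  unfolding separated_def
proof (intro ballI impI)
  have v: "v \<in> P" "v < u" "c v = c u" using vu by (auto simp: color_succ_def)
  have below: "n < v" if "n \<in> D" "adj (c n) (c u)" "n < u" for n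
    using free[OF that(1) _ less_imp_le[OF that(3)]] comparable_adj[of n v] that v D(1)
    by (auto simp: order_le_less)
  fix d e assume d: "d \<in> insert v (D - {u})" and e: "e \<in> insert v (D - {u})" and de: "d < e \<and> c d = c e"
  show "\<exists>n\<in>insert v (D - {u}). adj (c n) (c e) \<and> d < n \<and> n < e"
  proof (cases "e = v")
    case True
    then have dD: "d \<in> D" "d < u" "c d = c u" using d de v by auto
    then obtain n where n: "n \<in> D" "adj (c n) (c u)" "d < n" "n < u"
      using D(2) vu(2) unfolding separated_def by blast
    then have "n < v" "n \<noteq> u" using below by auto
    then show ?thesis using n True v by (intro bexI[of _ n]) auto
  next
    case False
    then have eD: "e \<in> D" "e \<noteq> u" using e by auto
    show ?thesis
    proof (cases "d = v")
      case True
      have "e < u \<or> u < e" using comparable_same[of e u] eD vu(2) D(1) True de v by auto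
      moreover have "\<not> e < u" using vu(1) True de eD D(1) v by (auto simp: color_succ_def)
      ultimately have "u < e" by auto
      then obtain n where n: "n \<in> D" "adj (c n) (c e)" "u < n" "n < e"
        using D(2) vu(2) eD True de v unfolding separated_def by metis
      then show ?thesis using True v by (intro bexI[of _ n]) auto
    next
      case dv: False
      then have dD: "d \<in> D" using d by auto
      then obtain n where n: "n \<in> D" "adj (c n) (c e)" "d < n" "n < e"
        using D(2) eD de unfolding separated_def by metis
      show ?thesis
      proof (cases "n = u")
        case True
        have "adj (c d) (c u)" using n(2) True de adj_sym by simp
        then have "d < v" using below[OF dD] n(3) True by auto
        then show ?thesis using n True v by (intro bexI[of _ v]) auto
      qed (use n in auto)
    qed
  qed
qed

lemma peaks_filter:
  assumes "order_filter P F"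
  shows "peaks F = {}"
  using order_filterD[OF assms, OF _ _ less_imp_le] unfolding peaks_def by blast

text \<open>After the move v is the next element below u that does not commute with it, and it has
  the same color, so u becomes a peak. A peak of an adjacent color between v and u is destroyed,
  because v now separates it from its witness. For the other peaks v replaces u as witness where u
  was one.\<close>

lemma peaks_excitation:
  assumes D: "D \<subseteq> P" "separated D" and vu: "color_succ P c v u" "u \<in> D" "v \<notin> D"
    and free: "\<And>n. n \<in> D \<Longrightarrow> v \<le> n \<Longrightarrow> n \<le> u \<Longrightarrow> \<not> adj (c n) (c u)"
  shows "peaks (insert v (D - {u})) = insert u (peaks D - {n\<in>P. v \<le> n \<and> n \<le> u \<and> adj (c n) (c u)})"
    (is "peaks ?D' = insert u (peaks D - ?N)")
proof (intro set_eqI iffI)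
  have v: "v \<in> P" "v < u" "c v = c u" and uP: "u \<in> P" using vu by (auto simp: color_succ_def)
  have between: "w = v \<or> w = u" if "w \<in> P" "c w = c u" "v \<le> w" "w \<le> u" for w
    using vu(1) that by (auto simp: color_succ_def order_le_less)
  have below: "n < v" if "n \<in> D" "adj (c n) (c u)" "n < u" for n
    using free[OF that(1) _ less_imp_le[OF that(3)]] comparable_adj[of n v] that v D(1)
    by (auto simp: order_le_less)
  fix b
  {
    assume "b \<in> peaks ?D'"
    then obtain d where b: "b \<in> P" "b \<notin> ?D'" and d: "d \<in> ?D'" "d < b" "c d = c b"
      and all: "\<And>w. w \<in> ?D' \<Longrightarrow> d \<le> w \<Longrightarrow> w \<le> b \<Longrightarrow> c w = c b \<or> adj (c w) (c b) \<Longrightarrow> w = d"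
      unfolding peaks_def by blast
    show "b \<in> insert u (peaks D - ?N)"
    proof (cases "b = u")
      case False
      then have bD: "b \<notin> D" "b \<noteq> v" using b by auto
      have dP: "d \<in> P" using d D(1) v by auto
      have notN: "b \<notin> ?N"
      proof
        assume N: "b \<in> ?N"
        then have "adj (c d) (c u)" using d(3) by simp
        then have dD: "d \<in> D" "d \<noteq> v" using d(1) v adj_irrefl by auto
        have "d < v" using below[OF dD(1) \<open>adj (c d) (c u)\<close>] d(2) N by auto
        then have "v = d" using all[of v] N v adj_sym by auto
        with dD show False by simp
      qed
      have "b \<in> peaks D"
      proof (cases "d = v")
        case True
        have cb: "c b = c u" "v < b" using d True v by auto
        have "u < b" using between[OF b(1) cb(1) less_imp_le[OF cb(2)] less_imp_le] comparable_same[OF b(1) uP cb(1)] False bD by auto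
        moreover have "w = u" if "w \<in> D" "u \<le> w" "w \<le> b" "c w = c b \<or> adj (c w) (c b)" for w
          using all[of w] order.trans[OF less_imp_le[OF v(2)] that(2)] that True vu(3) by auto
        ultimately show ?thesis unfolding peaks_def using b(1) bD(1) vu(2) cb(1) by auto
      next
        case False
        then have dD: "d \<in> D" "d \<noteq> u" using d(1) by auto
        have "\<not> (d \<le> u \<and> u \<le> b \<and> (c u = c b \<or> adj (c u) (c b)))"
        proof
          assume u: "d \<le> u \<and> u \<le> b \<and> (c u = c b \<or> adj (c u) (c b))"
          then have du: "d < u" using dD by auto
          have "d < v"
          proof (cases "c u = c b")
            case True
            then show ?thesis
              using between[OF dP _ less_imp_le less_imp_le[OF du]] comparable_same[of d v] dP v d(3) du False dD by auto
          next
            case False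
            then have "adj (c d) (c u)" using u d(3) adj_sym by simp
            then show ?thesis using below[OF dD(1)] du by auto
          qed
          then have "v = d" using all[of v] u v by auto
          with False show False by simp
        qed
        then show ?thesis unfolding peaks_def using b(1) bD(1) dD(1) d(2,3) all by auto
      qed
      with notN show ?thesis by auto
    qed simp
  next
    assume "b \<in> insert u (peaks D - ?N)"
    then consider "b = u" | "b \<noteq> u" "b \<in> peaks D" "b \<notin> ?N" by blast
    then show "b \<in> peaks ?D'"
    proof cases
      case 1
      have "w = v" if w: "w \<in> ?D'" "v \<le> w" "w \<le> u" "c w = c u \<or> adj (c w) (c u)" for w
        using between[of w] free[of w] w D(1) v adj_irrefl by auto
      then show ?thesis unfolding peaks_def using 1 uP v by auto
    next
      case 2
      then obtain d where b: "b \<in> P" "b \<notin> D" and d: "d \<in> D" "d < b" "c d = c b"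
        and all: "\<And>w. w \<in> D \<Longrightarrow> d \<le> w \<Longrightarrow> w \<le> b \<Longrightarrow> c w = c b \<or> adj (c w) (c b) \<Longrightarrow> w = d"
        unfolding peaks_def by blast
      have dP: "d \<in> P" using d D(1) by auto
      have bv: "b \<noteq> v"
      proof
        assume "b = v"
        then have "d < u" "c d = c u" using d v by auto
        then obtain n where n: "n \<in> D" "adj (c n) (c u)" "d < n" "n < u"
          using D(2) d(1) vu(2) unfolding separated_def by blast
        then have "n = d" using all[of n] below[of n] \<open>b = v\<close> v by auto
        with n show False by simp
      qed
      show ?thesis
      proof (cases "d = u")
        case True
        have cb: "c b = c u" "u < b" using d True by auto
        have "w = v" if w: "w \<in> ?D'" "v \<le> w" "w \<le> b" "c w = c b \<or> adj (c w) (c b)" for w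
        proof (rule ccontr)
          assume "w \<noteq> v"
          then have wD: "w \<in> D" "w \<noteq> u" "w \<in> P" using w D(1) by auto
          then have "\<not> u \<le> w" using all[of w] w True by auto
          then have "w \<le> u" using near_comparable[OF wD(3) uP] w(4) cb(1) by auto
          then show False using between[OF wD(3) _ w(2)] free[OF wD(1) w(2)] w(4) cb(1) wD \<open>w \<noteq> v\<close> by auto
        qed
        moreover have "v < b" using cb v by auto
        ultimately show ?thesis unfolding peaks_def using b bv cb v by auto
      next
        case False
        have "\<not> (d \<le> v \<and> v \<le> b \<and> (c v = c b \<or> adj (c v) (c b)))"
        proof
          assume a: "d \<le> v \<and> v \<le> b \<and> (c v = c b \<or> adj (c v) (c b))"
          moreover have "d \<noteq> v" using d(1) vu(3) by auto
          ultimately have "d < v" by auto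
          have "u < b"
          proof (cases "c b = c u")
            case True
            then show ?thesis
              using between[OF b(1) _ _ less_imp_le] comparable_same[OF b(1) uP True] a bv 2(1) by auto
          next
            case False
            then have bu: "adj (c b) (c u)" using a v adj_sym by auto
            then have "\<not> b \<le> u" using 2(3) b(1) a by auto
            then show ?thesis using comparable_adj[OF b(1) uP bu] by auto
          qed
          then have "u = d" using all[OF vu(2)] \<open>d < v\<close> v a by auto
          with False show False by simp
        qed
        then show ?thesis unfolding peaks_def using b bv d False all by auto
      qed
    qed
  }
qed

text \<open>Integer exponents make the condition stable under reflections, which invert a variable
  and act on exponent vectors by invertible integral matrices.\<close>

definition independent :: "('i \<Rightarrow> 'f::field) \<Rightarrow> bool" where
  "independent z \<longleftrightarrow> (\<forall>e :: 'i \<Rightarrow> int. (\<Prod>j\<in>c ` P. z j powi e j) = 1 \<longrightarrow> (\<forall>j\<in>c ` P. e j = 0))"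

lemma power_int_sum_exponent:
  fixes x :: "'f::field"
  assumes "x \<noteq> 0" "finite A"
  shows "x powi (\<Sum>j\<in>A. e j) = (\<Prod>j\<in>A. x powi e j)"
  using assms(2) by (induction A) (auto simp: power_int_add assms(1))

lemma independent_reflect:
  fixes z :: "'i \<Rightarrow> 'f::field"
  assumes z: "independent z" "\<And>j. z j \<noteq> 0" and i: "i \<in> c ` P"
  shows "independent (reflect i z)"
  unfolding independent_def
proof (intro allI impI)
  fix e :: "'i \<Rightarrow> int"
  let ?J = "c ` P"
  assume one: "(\<Prod>j\<in>?J. reflect i z j powi e j) = 1"
  \<comment> \<open>The vector e' rewrites the product in the original variables: z i receives its
    own exponent with opposite sign and the exponents of all adjacent colors.\<close>
  define s where "s = (\<Sum>j\<in>?J - {i}. if adj j i then e j else 0)"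
  define e' where "e' j = (if j = i then s - e i else e j)" for j
  have fin: "finite ?J" using finite_P by simp
  have "(\<Prod>j\<in>?J. z j powi e' j) = z i powi (s - e i) * (\<Prod>j\<in>?J - {i}. z j powi e j)"
    using prod.remove[OF fin i, of "\<lambda>j. z j powi e' j"] by (simp add: e'_def)
  also have "z i powi (s - e i) = z i powi (- e i) * (\<Prod>j\<in>?J - {i}. z i powi (if adj j i then e j else 0))"
    using power_int_sum_exponent[of "z i" "?J - {i}" "\<lambda>j. if adj j i then e j else 0"] z(2) fin
    by (simp add: s_def[symmetric] power_int_diff power_int_minus divide_inverse mult.commute)
  also have "z i powi (- e i) * (\<Prod>j\<in>?J - {i}. z i powi (if adj j i then e j else 0)) * (\<Prod>j\<in>?J - {i}. z j powi e j) =
      z i powi (- e i) * (\<Prod>j\<in>?J - {i}. z i powi (if adj j i then e j else 0) * z j powi e j)"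
    by (simp add: prod.distrib mult.assoc)
  also have "(\<Prod>j\<in>?J - {i}. z i powi (if adj j i then e j else 0) * z j powi e j) =
      (\<Prod>j\<in>?J - {i}. reflect i z j powi e j)"
    by (rule prod.cong) (auto simp: reflect_def power_int_mult_distrib)
  also have "z i powi (- e i) = reflect i z i powi e i"
    by (simp add: reflect_self power_int_inverse power_int_minus)
  also have "reflect i z i powi e i * (\<Prod>j\<in>?J - {i}. reflect i z j powi e j) = 1"
    using prod.remove[OF fin i, of "\<lambda>j. reflect i z j powi e j"] one by simp
  finally have e'0: "\<And>j. j \<in> ?J \<Longrightarrow> e' j = 0" using z(1) unfolding independent_def by blast
  have e0: "e j = 0" if "j \<in> ?J - {i}" for j
    using e'0[of j] that by (simp add: e'_def)
  then have "s = 0" unfolding s_def by (intro sum.neutral) auto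
  then have "e i = 0" using e'0[OF i] by (simp add: e'_def)
  with e0 show "\<forall>j\<in>?J. e j = 0" by blast
qed

end

context d_complete_poset
begin

lemma hook_monomial_reflect:
  fixes z :: "'i \<Rightarrow> 'f::field"
  assumes "order_filter P G" "q \<in> minimal_elements G" "\<And>j. z j \<noteq> 0" "u \<in> G - {q}"
  shows "hook_monomial G c z u = hook_monomial (G - {q}) c (reflect (c q) z) u"
  using hook_monomial_reflect_aux[of G q z] assms by blast

text \<open>Minimal elements are removed until u itself is minimal. There its hook monomial is a
  single variable at a point that is still independent; in terms of roots, it is conjugate to a
  simple root.\<close>

lemma hook_monomial_neq_1:
  fixes z :: "'i \<Rightarrow> 'f::field"
  assumes "order_filter P G" "u \<in> G" "\<And>j. z j \<noteq> 0" "independent z"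
  shows "hook_monomial G c z u \<noteq> 1"
  using assms
proof (induction "card G" arbitrary: G z rule: less_induct)
  case (less G z)
  have GP: "G \<subseteq> P" using less.prems(1) order_filter_subset by blast
  then have fin: "finite G" using finite_sub by blast
  obtain q where q: "q \<in> minimal_elements G"
    using ex_minimal_element[OF fin] less.prems(2) by blast
  then have qG: "q \<in> G" "q \<in> P" using GP by (auto simp: minimal_elements_def)
  show ?case
  proof (cases "u = q")
    case True
    have "z (c q) \<noteq> 1"
    proof
      assume 1: "z (c q) = 1"
      define e :: "'i \<Rightarrow> int" where "e j = (if j = c q then 1 else 0)" for j
      have "(\<Prod>j\<in>c ` P. z j powi e j) = 1"
        by (rule prod.neutral) (use 1 in \<open>auto simp: e_def\<close>)
      then have "e (c q) = 0"
        using less.prems(4) qG unfolding independent_def by blast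
      then show False by (simp add: e_def)
    qed
    then show ?thesis using hook_monomial_minimal[where z = z, OF less.prems(1) q] True by simp
  next
    case False
    have "hook_monomial (G - {q}) c (reflect (c q) z) u \<noteq> 1"
    proof (rule less.hyps)
      show "card (G - {q}) < card G" by (rule card_Diff1_less[OF fin qG(1)])
      show "order_filter P (G - {q})" by (rule order_filter_remove_minimal[OF less.prems(1) q])
      show "independent (reflect (c q) z)" by (rule independent_reflect) (use less.prems qG in auto)
    qed (use less.prems False reflect_nonzero[of z] in auto)
    then show ?thesis using hook_monomial_reflect[OF less.prems(1) q, of z u] less.prems False by auto
  qed
qed

text \<open>Each removal of a minimal element of G reflects z, so the induction has to cover all
  points without zeros.\<close>

theorem signed_excited_sum:
  fixes z :: "'i \<Rightarrow> 'f::field"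
  assumes "order_filter P G" "order_filter P F" "F \<subseteq> G" "\<And>j. z j \<noteq> 0"
  shows "(\<Sum>A\<in>Pow (maximal_elements (G - F)). (- 1) ^ card A * excited_sum G (hook_monomial G c z) (F \<union> A)) =
    monomial z (G - F) * excited_sum G (hook_monomial G c z) F"
  using assms
proof (induction "card G" arbitrary: G F z rule: less_induct)
  case (less G F z)
  have GP: "G \<subseteq> P" using less.prems(1) order_filter_subset by blast
  then have fin: "finite G" using finite_sub by blast
  show ?case
  proof (cases "G = {}")
    case True
    then show ?thesis using less.prems(3) by (simp add: maximal_elements_def monomial_def)
  next
    case False
    then obtain q where q: "q \<in> minimal_elements G" using ex_minimal_element[OF fin] by blast
    then have qG: "q \<in> G" by (auto simp: minimal_elements_def)
    have Gq: "order_filter P (G - {q})" by (rule order_filter_remove_minimal[OF less.prems(1) q])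
    have z': "reflect (c q) z j \<noteq> 0" for j by (rule reflect_nonzero) (rule less.prems(4))
    have cong: "excited_sum (G - {q}) (hook_monomial G c z) F' =
        excited_sum (G - {q}) (hook_monomial (G - {q}) c (reflect (c q) z)) F'" if "F' \<subseteq> G - {q}" for F'
      by (rule excited_sum_cong[OF Gq that]) (use hook_monomial_reflect[OF less.prems(1) q, of z] less.prems(4) in blast)
    show ?thesis
    proof (rule signed_excited_sum_step[OF less.prems(2,1,3) q less.prems(4)])
      show "hook_monomial G c z q = z (c q)" by (rule hook_monomial_minimal[OF less.prems(1) q])
      fix F' assume F': "order_filter P F'" "F' \<subseteq> G - {q}"
      have "excited_sum (G - {q}) (hook_monomial G c z) (F' \<union> A) =
          excited_sum (G - {q}) (hook_monomial (G - {q}) c (reflect (c q) z)) (F' \<union> A)"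
        if "A \<in> Pow (maximal_elements (G - {q} - F'))" for A
        by (rule cong) (use that F' in \<open>auto simp: maximal_elements_def\<close>)
      then have "(\<Sum>A\<in>Pow (maximal_elements (G - {q} - F')).
            (- 1) ^ card A * excited_sum (G - {q}) (hook_monomial G c z) (F' \<union> A)) =
          (\<Sum>A\<in>Pow (maximal_elements (G - {q} - F')).
            (- 1) ^ card A * excited_sum (G - {q}) (hook_monomial (G - {q}) c (reflect (c q) z)) (F' \<union> A))"
        by (intro sum.cong) auto
      also have "\<dots> = monomial (reflect (c q) z) (G - {q} - F') *
          excited_sum (G - {q}) (hook_monomial (G - {q}) c (reflect (c q) z)) F'"
        by (rule less.hyps[OF card_Diff1_less[OF fin qG] Gq F' z'])
      finally show "(\<Sum>A\<in>Pow (maximal_elements (G - {q} - F')).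
            (- 1) ^ card A * excited_sum (G - {q}) (hook_monomial G c z) (F' \<union> A)) =
          monomial (reflect (c q) z) (G - {q} - F') * excited_sum (G - {q}) (hook_monomial G c z) F'"
        using cong[OF F'(2)] by simp
    qed
  qed
qed

section \<open>Agreement with the original excitations and peaks\<close>

lemma color_nbhd_eq: "color_nbhd P c i = {x\<in>P. adj (c x) i}"
  by (auto simp: color_nbhd_def adj_def)

lemma excitable_iff:
  "D \<subseteq> P \<Longrightarrow> excitable P c D u v \<longleftrightarrow> color_succ P c v u \<and> u \<in> D \<and> v \<in> P - D \<and>
    (\<forall>n\<in>D. v \<le> n \<longrightarrow> n \<le> u \<longrightarrow> \<not> adj (c n) (c u))"
  unfolding excitable_def color_nbhd_eq d_interval_iff_color_succ
  by (auto simp: interval_def color_succ_def)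

lemma excited_diagrams_eq:
  assumes "F \<subseteq> P"
  shows "excited_diagrams P c F = excited P F"
proof (intro set_eqI iffI)
  fix D assume "D \<in> excited_diagrams P c F"
  then show "D \<in> excited P F"
  proof (induction rule: excited_diagrams.induct)
    case (2 D u v)
    then have "D \<subseteq> P" using excited_subset assms by blast
    then have "color_succ P c v u" "u \<in> D" "v \<in> P - D"
      "\<And>n. n \<in> D \<Longrightarrow> v \<le> n \<Longrightarrow> n \<le> u \<Longrightarrow> \<not> adj (c n) (c u)"
      using 2(2) excitable_iff by blast+
    then show ?case unfolding excitation_def by (rule excited.step[OF 2(3)])
  qed (rule excited.base)
next
  fix D assume "D \<in> excited P F"
  then show "D \<in> excited_diagrams P c F"
  proof (induction rule: excited.induct)
    case (step D v u)
    have "D \<subseteq> P" using excited_subset[OF step(1) assms] .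
    then have "excitable P c D u v" using step(2-5) by (subst excitable_iff) auto
    then show ?case using excited_diagrams.intros(2)[OF step.IH] by (simp add: excitation_def)
  qed (rule excited_diagrams.intros(1))
qed

text \<open>\<open>peaks\<close> obeys the recursion for B(D), so every sequence of excitations
  gives the same set. \<open>separated\<close> is carried along to keep
  \<open>peaks_excitation\<close> applicable.\<close>

lemma has_excited_peaks_eq:
  assumes F: "order_filter P F" and "has_excited_peaks P c F D B"
  shows "B = peaks D \<and> separated D \<and> D \<subseteq> P"
  using assms(2)
proof (induction rule: has_excited_peaks.induct)
  case 1
  then show ?case using peaks_filter[OF F] separated_filter[OF F] order_filter_subset[OF F] by simp
next
  case (2 D B u v)
  then have D: "D \<subseteq> P" "separated D" "B = peaks D" by auto
  have e: "color_succ P c v u" "u \<in> D" "v \<notin> D" "v \<in> P"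
    "\<And>n. n \<in> D \<Longrightarrow> v \<le> n \<Longrightarrow> n \<le> u \<Longrightarrow> \<not> adj (c n) (c u)"
    using 2(2) excitable_iff[OF D(1)] by auto
  have "interval P v u \<inter> color_nbhd P c (c u) = {n\<in>P. v \<le> n \<and> n \<le> u \<and> adj (c n) (c u)}"
    unfolding color_nbhd_eq by (auto simp: interval_def)
  then show ?case
    unfolding excitation_def D(3)
    using peaks_excitation[OF D(1,2) e(1-3,5)] separated_excitation[OF D(1,2) e(1-3,5)] D(1) e(4) by auto
qed

lemma excited_peaks_eq:
  assumes F: "order_filter P F" and D: "D \<in> excited_diagrams P c F"
  shows "excited_peaks P c F D = peaks D"
proof -
  have "\<exists>B. has_excited_peaks P c F D B"
    using D by induction (auto intro: has_excited_peaks.intros)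
  then have "has_excited_peaks P c F D (peaks D)" using has_excited_peaks_eq[OF F] by blast
  then show ?thesis
    unfolding excited_peaks_def by (rule the_equality) (use has_excited_peaks_eq[OF F] in blast)
qed

end

section \<open>Generating functions of partitions\<close>

lemma to_fract_power: "to_fract (x ^ n) = to_fract x ^ n"
  by (induction n) auto

lemma to_fract_prod: "to_fract (prod f A) = (\<Prod>x\<in>A. to_fract (f x))"
  by (induction A rule: infinite_finite_induct) auto

definition mfps_monom :: "'i multiset \<Rightarrow> ('i, 'a::comm_ring_1) mfps" where
  "mfps_monom K = Abs_mfps (\<lambda>M. if M = K then 1 else 0)"

lemma mfps_coeff_monom [simp]: "mfps_coeff (mfps_monom K) M = (if M = K then 1 else 0)"
  by (simp add: mfps_monom_def)

lemma mfps_var_monom: "mfps_var i = mfps_monom {#i#}"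
  by (simp add: mfps_var_def mfps_monom_def)

lemma mfps_monom_empty: "mfps_monom {#} = 1"
  by (rule mfps_eqI) simp

lemma mfps_coeff_monom_mult:
  "mfps_coeff (mfps_monom K * f) M = (if K \<subseteq># M then mfps_coeff f (M - K) else 0)"
proof -
  have "mfps_coeff (mfps_monom K * f) M =
      (\<Sum>(A, B)\<in>(if K \<subseteq># M then {(K, M - K)} else {}). mfps_coeff (mfps_monom K) A * mfps_coeff f B)"
    unfolding mfps_coeff_mult
    by (rule sum.mono_neutral_right) (use finite_splittings in \<open>auto split: if_splits\<close>)
  then show ?thesis by simp
qed

lemma mfps_monom_mult: "mfps_monom K * mfps_monom L = mfps_monom (K + L)"
  by (rule mfps_eqI)
     (auto simp: mfps_coeff_monom_mult subset_mset.add_diff_inverse[symmetric] dest: subset_mset.add_diff_inverse)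

lemma mfps_monom_inject:
  "mfps_monom K = (mfps_monom L :: ('i, 'a::comm_ring_1) mfps) \<longleftrightarrow> K = L"
proof
  assume "mfps_monom K = (mfps_monom L :: ('i, 'a) mfps)"
  then have "mfps_coeff (mfps_monom K :: ('i, 'a) mfps) K = mfps_coeff (mfps_monom L) K" by simp
  then show "K = L" by (simp split: if_splits)
qed simp

lemma mfps_var_power: "mfps_var i ^ n = mfps_monom (replicate_mset n i)"
  by (induction n) (auto simp: mfps_var_monom mfps_monom_empty mfps_monom_mult)

lemma prod_mfps_monom: "(\<Prod>x\<in>A. mfps_monom (K x)) = mfps_monom (\<Sum>x\<in>A. K x)"
  by (induction A rule: infinite_finite_induct) (auto simp: mfps_monom_empty mfps_monom_mult)

definition partition_weight :: "('a \<Rightarrow> 'i) \<Rightarrow> 'a set \<Rightarrow> ('a \<Rightarrow> nat) \<Rightarrow> 'i multiset" where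
  "partition_weight c Q \<sigma> = (\<Sum>v\<in>Q. replicate_mset (\<sigma> v) (c v))"

lemma prod_var_power: "(\<Prod>v\<in>Q. mfps_var (c v) ^ \<sigma> v) = mfps_monom (partition_weight c Q \<sigma>)"
  by (simp add: mfps_var_power prod_mfps_monom partition_weight_def)

definition partitions_of :: "('a::order \<Rightarrow> 'i) \<Rightarrow> 'a set \<Rightarrow> 'i multiset \<Rightarrow> ('a \<Rightarrow> nat) set" where
  "partitions_of c Q M = {\<sigma>\<in>P_partitions Q. partition_weight c Q \<sigma> = M}"

lemma finite_partitions_of:
  assumes "finite Q"
  shows "finite (partitions_of c Q M)"
proof (rule finite_subset)
  show "partitions_of c Q M \<subseteq> Q \<rightarrow>\<^sub>E {..size M}"
  proof
    fix \<sigma> assume s: "\<sigma> \<in> partitions_of c Q M"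
    have "\<sigma> v \<le> size M" if "v \<in> Q" for v
    proof -
      have "replicate_mset (\<sigma> v) (c v) \<subseteq># partition_weight c Q \<sigma>"
        unfolding partition_weight_def by (simp add: sum.remove[OF assms that])
      then have "size (replicate_mset (\<sigma> v) (c v)) \<le> size M"
        using s by (intro size_mset_mono) (auto simp: partitions_of_def)
      then show ?thesis by simp
    qed
    then show "\<sigma> \<in> Q \<rightarrow>\<^sub>E {..size M}"
      using s by (auto simp: partitions_of_def P_partitions_def PiE_def Pi_def)
  qed
  show "finite (Q \<rightarrow>\<^sub>E {..size M})" using assms by (intro finite_PiE) auto
qed

definition partition_gf :: "('a::order \<Rightarrow> 'i) \<Rightarrow> 'a set \<Rightarrow> ('i, int) mfps" where
  "partition_gf c Q = mfps_infsum (\<lambda>\<sigma>. \<Prod>v\<in>Q. mfps_var (c v) ^ \<sigma> v) (P_partitions Q)"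

lemma partition_support:
  "{\<sigma>\<in>P_partitions Q. mfps_coeff (\<Prod>v\<in>Q. mfps_var (c v) ^ \<sigma> v) M \<noteq> (0::'a::comm_ring_1)} = partitions_of c Q M"
  by (auto simp: prod_var_power partitions_of_def)

lemma partition_summable:
  "finite Q \<Longrightarrow> mfps_summable (\<lambda>\<sigma>. \<Prod>v\<in>Q. mfps_var (c v) ^ \<sigma> v :: ('i, 'a::comm_ring_1) mfps) (P_partitions Q)"
  unfolding mfps_summable_def partition_support using finite_partitions_of by blast

lemma partition_gf_coeff: "mfps_coeff (partition_gf c Q) M = int (card (partitions_of c Q M))"
proof -
  have "mfps_coeff (partition_gf c Q) M =
      (\<Sum>\<sigma>\<in>partitions_of c Q M. mfps_coeff (\<Prod>v\<in>Q. mfps_var (c v) ^ \<sigma> v) M)"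
    by (simp add: partition_gf_def mfps_infsum_def partition_support)
  also have "\<dots> = (\<Sum>\<sigma>\<in>partitions_of c Q M. 1)"
    by (rule sum.cong) (auto simp: prod_var_power partitions_of_def)
  finally show ?thesis by simp
qed

lemma partition_gf_empty: "partition_gf c {} = 1"
proof (rule mfps_eqI)
  fix M :: "'a multiset"
  have "partitions_of c {} M = (if M = {#} then {\<lambda>_. undefined} else {})"
    by (auto simp: partitions_of_def P_partitions_def partition_weight_def monotone_on_def)
  then show "mfps_coeff (partition_gf c {}) M = mfps_coeff 1 M"
    by (simp add: partition_gf_coeff)
qed

lemma antimono_onD: "antimono_on Q \<sigma> \<Longrightarrow> x \<in> Q \<Longrightarrow> y \<in> Q \<Longrightarrow> x \<le> y \<Longrightarrow> \<sigma> y \<le> \<sigma> x"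
  by (simp add: monotone_on_def)

text \<open>Order-reversing maps are smallest at maximal elements, so zeros there impose nothing on
  the other values. Extension by 0 and restriction are inverse to each other.\<close>

lemma partitions_vanishing:
  assumes "finite Q" "A \<subseteq> maximal_elements Q"
  shows "card (partitions_of c (Q - A) M) = card {\<sigma>\<in>partitions_of c Q M. \<forall>a\<in>A. \<sigma> a = 0}"
proof (rule bij_betw_same_card)
  have AQ: "A \<subseteq> Q" using assms(2) by (auto simp: maximal_elements_def)
  have weight: "partition_weight c Q \<sigma> = partition_weight c (Q - A) \<tau>"
    if "\<And>a. a \<in> A \<Longrightarrow> \<sigma> a = 0" "\<And>v. v \<in> Q - A \<Longrightarrow> \<sigma> v = \<tau> v" for \<sigma> \<tau>
    unfolding partition_weight_def using assms(1) that
    by (intro sum.mono_neutral_cong_right) auto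
  let ?ext = "\<lambda>\<tau> v. if v \<in> A then 0 else \<tau> v"
  show "bij_betw ?ext (partitions_of c (Q - A) M) {\<sigma>\<in>partitions_of c Q M. \<forall>a\<in>A. \<sigma> a = 0}"
  proof (rule bij_betw_byWitness[where f' = "\<lambda>\<sigma>. restrict \<sigma> (Q - A)"])
    show "\<forall>\<tau>\<in>partitions_of c (Q - A) M. restrict (?ext \<tau>) (Q - A) = \<tau>"
      by (auto simp: partitions_of_def P_partitions_def PiE_def extensional_def restrict_def)
    show "\<forall>\<sigma>\<in>{\<sigma>\<in>partitions_of c Q M. \<forall>a\<in>A. \<sigma> a = 0}. ?ext (restrict \<sigma> (Q - A)) = \<sigma>"
      by (auto simp: partitions_of_def P_partitions_def PiE_def extensional_def restrict_def)
    show "?ext ` partitions_of c (Q - A) M \<subseteq> {\<sigma>\<in>partitions_of c Q M. \<forall>a\<in>A. \<sigma> a = 0}"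
    proof
      fix \<sigma> assume "\<sigma> \<in> ?ext ` partitions_of c (Q - A) M"
      then obtain \<tau> where t: "\<tau> \<in> partitions_of c (Q - A) M" "\<sigma> = ?ext \<tau>" by blast
      have "antimono_on Q \<sigma>"
      proof (rule monotone_onI)
        fix x y assume xy: "x \<in> Q" "y \<in> Q" "x \<le> y"
        show "\<sigma> y \<le> \<sigma> x"
        proof (cases "y \<in> A")
          case False
          then have "x \<notin> A" using assms(2) xy by (auto simp: maximal_elements_def order_le_less)
          then show ?thesis
            using antimono_onD[of "Q - A" \<tau> x y] t xy False by (auto simp: partitions_of_def P_partitions_def)
        qed (use t in auto)
      qed
      moreover have "\<sigma> \<in> extensional Q"
        using t AQ by (auto simp: partitions_of_def P_partitions_def PiE_def extensional_def)
      moreover have "partition_weight c Q \<sigma> = M"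
        using weight[of \<sigma> \<tau>] t by (auto simp: partitions_of_def)
      ultimately show "\<sigma> \<in> {\<sigma>\<in>partitions_of c Q M. \<forall>a\<in>A. \<sigma> a = 0}"
        using t by (auto simp: partitions_of_def P_partitions_def PiE_def)
    qed
    show "(\<lambda>\<sigma>. restrict \<sigma> (Q - A)) ` {\<sigma>\<in>partitions_of c Q M. \<forall>a\<in>A. \<sigma> a = 0} \<subseteq> partitions_of c (Q - A) M"
    proof
      fix \<tau> assume "\<tau> \<in> (\<lambda>\<sigma>. restrict \<sigma> (Q - A)) ` {\<sigma>\<in>partitions_of c Q M. \<forall>a\<in>A. \<sigma> a = 0}"
      then obtain \<sigma> where s: "\<sigma> \<in> partitions_of c Q M" "\<forall>a\<in>A. \<sigma> a = 0" "\<tau> = restrict \<sigma> (Q - A)" by blast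
      have "antimono_on (Q - A) \<tau>"
        using s antimono_onD[of Q \<sigma>] by (auto intro!: monotone_onI simp: partitions_of_def P_partitions_def)
      moreover have "partition_weight c (Q - A) \<tau> = M"
        using weight[of \<sigma> \<tau>] s by (auto simp: partitions_of_def)
      ultimately show "\<tau> \<in> partitions_of c (Q - A) M"
        using s(3) by (auto simp: partitions_of_def P_partitions_def)
    qed
  qed
qed

text \<open>Subtracting 1 everywhere keeps the map order-reversing and takes one copy of the color
  of each element out of the weight. The case distinction guards against truncated subtraction of
  multisets.\<close>

lemma partitions_positive:
  assumes "finite Q"
  shows "card {\<sigma>\<in>partitions_of c Q M. \<forall>v\<in>Q. \<sigma> v \<noteq> 0} =
    (if (\<Sum>v\<in>Q. {#c v#}) \<subseteq># M then card (partitions_of c Q (M - (\<Sum>v\<in>Q. {#c v#}))) else 0)"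
proof -
  let ?K = "\<Sum>v\<in>Q. {#c v#}"
  let ?S = "{\<sigma>\<in>partitions_of c Q M. \<forall>v\<in>Q. \<sigma> v \<noteq> 0}"
  have weight: "partition_weight c Q \<sigma> = ?K + partition_weight c Q \<tau>"
    if "\<And>v. v \<in> Q \<Longrightarrow> \<sigma> v = Suc (\<tau> v)" for \<sigma> \<tau>
    unfolding partition_weight_def sum.distrib[symmetric] using that by (intro sum.cong) auto
  have down: "restrict (\<lambda>v. \<sigma> v - 1) Q \<in> P_partitions Q \<and>
      M = ?K + partition_weight c Q (restrict (\<lambda>v. \<sigma> v - 1) Q)" if s: "\<sigma> \<in> ?S" for \<sigma>
  proof
    show "restrict (\<lambda>v. \<sigma> v - 1) Q \<in> P_partitions Q"
      using s antimono_onD[of Q \<sigma>]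
      by (auto intro!: monotone_onI diff_le_mono simp: partitions_of_def P_partitions_def)
    have "partition_weight c Q \<sigma> = ?K + partition_weight c Q (restrict (\<lambda>v. \<sigma> v - 1) Q)"
      by (rule weight) (use s in auto)
    then show "M = ?K + partition_weight c Q (restrict (\<lambda>v. \<sigma> v - 1) Q)"
      using s by (simp add: partitions_of_def)
  qed
  show ?thesis
  proof (cases "?K \<subseteq># M")
    case False
    then have "?S = {}" using down by (metis (no_types, lifting) all_not_in_conv mset_subset_eq_add_left)
    then show ?thesis using False by (simp only: card.empty if_False)
  next
    case True
    have "bij_betw (\<lambda>\<sigma>. restrict (\<lambda>v. \<sigma> v - 1) Q) ?S (partitions_of c Q (M - ?K))"
    proof (rule bij_betw_byWitness[where f' = "\<lambda>\<tau>. restrict (\<lambda>v. Suc (\<tau> v)) Q"])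
      show "\<forall>\<sigma>\<in>?S. restrict (\<lambda>v. Suc (restrict (\<lambda>v. \<sigma> v - 1) Q v)) Q = \<sigma>"
        by (auto simp: partitions_of_def P_partitions_def PiE_def extensional_def restrict_def fun_eq_iff)
      show "\<forall>\<tau>\<in>partitions_of c Q (M - ?K). restrict (\<lambda>v. restrict (\<lambda>v. Suc (\<tau> v)) Q v - 1) Q = \<tau>"
        by (auto simp: partitions_of_def P_partitions_def PiE_def extensional_def restrict_def fun_eq_iff)
      show "(\<lambda>\<sigma>. restrict (\<lambda>v. \<sigma> v - 1) Q) ` ?S \<subseteq> partitions_of c Q (M - ?K)"
      proof
        fix \<tau> assume "\<tau> \<in> (\<lambda>\<sigma>. restrict (\<lambda>v. \<sigma> v - 1) Q) ` ?S"
        then obtain \<sigma> where "\<sigma> \<in> ?S" "\<tau> = restrict (\<lambda>v. \<sigma> v - 1) Q" by blast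
        with down[of \<sigma>] show "\<tau> \<in> partitions_of c Q (M - ?K)"
          by (simp add: partitions_of_def)
      qed
      show "(\<lambda>\<tau>. restrict (\<lambda>v. Suc (\<tau> v)) Q) ` partitions_of c Q (M - ?K) \<subseteq> ?S"
      proof
        fix \<sigma> assume "\<sigma> \<in> (\<lambda>\<tau>. restrict (\<lambda>v. Suc (\<tau> v)) Q) ` partitions_of c Q (M - ?K)"
        then obtain \<tau> where t: "\<tau> \<in> partitions_of c Q (M - ?K)" "\<sigma> = restrict (\<lambda>v. Suc (\<tau> v)) Q" by blast
        have "partition_weight c Q \<sigma> = ?K + partition_weight c Q \<tau>" by (rule weight) (use t in auto)
        then have "partition_weight c Q \<sigma> = M"
          using t(1) subset_mset.add_diff_inverse[OF True] by (simp add: partitions_of_def)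
        moreover have "antimono_on Q \<sigma>"
          using t antimono_onD[of Q \<tau>] by (auto intro!: monotone_onI simp: partitions_of_def P_partitions_def)
        ultimately show "\<sigma> \<in> ?S" using t(2) by (auto simp: partitions_of_def P_partitions_def)
      qed
    qed
    then show ?thesis using True bij_betw_same_card by auto
  qed
qed

lemma sum_signed_Pow:
  assumes "finite M"
  shows "(\<Sum>A\<in>Pow M. (- 1) ^ card A) = (if M = {} then 1 else 0 :: 'b::comm_ring_1)"
proof (cases "M = {}")
  case False
  then obtain p where "p \<in> M" by blast
  then show ?thesis using signed_sum_Pow_split[OF assms, of p "\<lambda>_. 1"] False by simp
qed simp

text \<open>In each coefficient, a partition is counted with the signed number of subsets of its
  zero set among the maximal elements, so only those without such zeros remain. They are positive
  everywhere, since every value is at least that at a maximal element above.\<close>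

lemma partition_gf_signed_sum:
  assumes Q: "finite Q"
  shows "(\<Sum>A\<in>Pow (maximal_elements Q). (- 1) ^ card A * partition_gf c (Q - A)) =
    mfps_monom (\<Sum>v\<in>Q. {#c v#}) * partition_gf c Q"
proof (rule mfps_eqI)
  fix M
  let ?X = "maximal_elements Q"
  let ?S = "partitions_of c Q M"
  have finS: "finite ?S" by (rule finite_partitions_of[OF Q])
  have finX: "finite ?X" using Q by (rule rev_finite_subset) (auto simp: maximal_elements_def)
  have coeff_sum: "mfps_coeff (\<Sum>A\<in>B. f A) M = (\<Sum>A\<in>B. mfps_coeff (f A) M)" if "finite B"
    for B and f :: "'a set \<Rightarrow> ('b, int) mfps"
    using that by (induction B) auto
  have sign: "mfps_coeff ((- 1) ^ n * f) M = (- 1) ^ n * mfps_coeff f M" for n and f :: "('b, int) mfps"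
    by (induction n) auto
  have "mfps_coeff (\<Sum>A\<in>Pow ?X. (- 1) ^ card A * partition_gf c (Q - A)) M =
      (\<Sum>A\<in>Pow ?X. (- 1) ^ card A * int (card {\<sigma>\<in>?S. \<forall>a\<in>A. \<sigma> a = 0}))"
    unfolding coeff_sum[OF finite_Pow_iff[THEN iffD2, OF finX]] sign partition_gf_coeff
    by (rule sum.cong) (auto simp: partitions_vanishing[OF Q])
  also have "\<dots> = (\<Sum>A\<in>Pow ?X. \<Sum>\<sigma>\<in>?S. if \<forall>a\<in>A. \<sigma> a = 0 then (- 1) ^ card A else 0)"
    using finS by (intro sum.cong refl) (simp add: sum.If_cases Int_def conj_commute mult.commute)
  also have "\<dots> = (\<Sum>\<sigma>\<in>?S. \<Sum>A\<in>Pow ?X. if \<forall>a\<in>A. \<sigma> a = 0 then (- 1) ^ card A else 0)"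
    by (rule sum.swap)
  also have "\<dots> = (\<Sum>\<sigma>\<in>?S. if \<forall>v\<in>Q. \<sigma> v \<noteq> 0 then 1 else 0)"
  proof (rule sum.cong[OF refl])
    fix \<sigma> assume s: "\<sigma> \<in> ?S"
    let ?Z = "{a\<in>?X. \<sigma> a = 0}"
    have "(\<Sum>A\<in>Pow ?X. if \<forall>a\<in>A. \<sigma> a = 0 then (- 1) ^ card A else 0) = (\<Sum>A\<in>Pow ?Z. (- 1) ^ card A :: int)"
      using finX by (intro sum.mono_neutral_cong_right) auto
    also have "\<dots> = (if ?Z = {} then 1 else 0)" by (rule sum_signed_Pow) (use finX in auto)
    also have "?Z = {} \<longleftrightarrow> (\<forall>v\<in>Q. \<sigma> v \<noteq> 0)"
    proof
      assume Z: "?Z = {}"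
      show "\<forall>v\<in>Q. \<sigma> v \<noteq> 0"
      proof
        fix v assume v: "v \<in> Q"
        have "finite {w\<in>Q. v \<le> w}" "{w\<in>Q. v \<le> w} \<noteq> {}" using Q v by auto
        then obtain m where m: "m \<in> {w\<in>Q. v \<le> w}" "\<And>b. b \<in> {w\<in>Q. v \<le> w} \<Longrightarrow> m \<le> b \<Longrightarrow> m = b"
          using finite_has_maximal[of "{w\<in>Q. v \<le> w}"] by blast
        have "\<not> m < b" if "b \<in> Q" for b
          using m(1) m(2)[of b, OF _ less_imp_le] that by (auto intro: order.trans less_imp_le)
        then have "m \<in> ?X" using m(1) by (auto simp: maximal_elements_def)
        then have "\<sigma> m \<noteq> 0" using Z by auto
        moreover have "\<sigma> m \<le> \<sigma> v"
          using antimono_onD[of Q \<sigma> v m] s m(1) v by (auto simp: partitions_of_def P_partitions_def)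
        ultimately show "\<sigma> v \<noteq> 0" by simp
      qed
    qed (auto simp: maximal_elements_def)
    finally show "(\<Sum>A\<in>Pow ?X. if \<forall>a\<in>A. \<sigma> a = 0 then (- 1) ^ card A else 0) =
        (if \<forall>v\<in>Q. \<sigma> v \<noteq> 0 then 1 else 0 :: int)" .
  qed
  also have "\<dots> = int (card {\<sigma>\<in>?S. \<forall>v\<in>Q. \<sigma> v \<noteq> 0})"
    using finS by (simp add: sum.If_cases Int_def)
  finally show "mfps_coeff (\<Sum>A\<in>Pow ?X. (- 1) ^ card A * partition_gf c (Q - A)) M =
      mfps_coeff (mfps_monom (\<Sum>v\<in>Q. {#c v#}) * partition_gf c Q) M"
    unfolding partitions_positive[OF Q] mfps_coeff_monom_mult partition_gf_coeff by simp
qed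

lemma zvar_nonzero: "zvar i \<noteq> 0"
proof -
  have "mfps_coeff (mfps_var i :: ('a, int) mfps) {#i#} = 1" by (simp add: mfps_var_monom)
  then have "(mfps_var i :: ('a, int) mfps) \<noteq> 0" by (metis mfps_coeff_simps(1) zero_neq_one)
  then show ?thesis by (simp add: zvar_def)
qed

section \<open>Comparison of the two sides\<close>

context d_complete_poset
begin

lemma monomial_zvar: "monomial zvar Q = to_fract (mfps_monom (\<Sum>v\<in>Q. {#c v#}))"
  by (simp add: monomial_def zvar_def mfps_var_monom to_fract_prod[symmetric] prod_mfps_monom)

text \<open>Splitting each exponent into positive and negative part clears denominators. What
  remains is an equality of two monomials in the power series ring, hence of multisets.\<close>

lemma independent_zvar: "independent (zvar :: 'i \<Rightarrow> ('i, int) mfps fract)"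
  unfolding independent_def
proof (intro allI impI ballI)
  fix e :: "'i \<Rightarrow> int" and i
  let ?J = "c ` P"
  assume one: "(\<Prod>j\<in>?J. zvar j powi e j) = (1 :: ('i, int) mfps fract)" and i: "i \<in> ?J"
  have fin: "finite ?J" using finite by simp
  have z: "(zvar j :: ('i, int) mfps fract) powi e j = zvar j ^ nat (e j) / zvar j ^ nat (- e j)" for j
    by (auto simp: power_int_def divide_inverse power_inverse)
  have "(\<Prod>j\<in>?J. zvar j ^ nat (e j)) = (\<Prod>j\<in>?J. (zvar j :: ('i, int) mfps fract) ^ nat (- e j))"
    using one zvar_nonzero fin unfolding z prod_dividef by (simp add: prod_zero_iff)
  then have "to_fract (\<Prod>j\<in>?J. mfps_var j ^ nat (e j)) =
      to_fract (\<Prod>j\<in>?J. (mfps_var j :: ('i, int) mfps) ^ nat (- e j))"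
    by (simp add: zvar_def to_fract_prod to_fract_power)
  then have "(\<Sum>j\<in>?J. replicate_mset (nat (e j)) j) = (\<Sum>j\<in>?J. replicate_mset (nat (- e j)) j)"
    unfolding to_fract_eq_iff mfps_var_power prod_mfps_monom mfps_monom_inject .
  then have "count (\<Sum>j\<in>?J. replicate_mset (nat (e j)) j) i = count (\<Sum>j\<in>?J. replicate_mset (nat (- e j)) j) i"
    by simp
  moreover have "count (\<Sum>j\<in>?J. replicate_mset (n j) j) i = n i" for n
    using fin i by (simp add: count_sum sum.delta)
  ultimately have "nat (e i) = nat (- e i)" by simp
  then show "e i = 0" by linarith
qed

lemma excited_sum_self:
  "excited_sum P h P = (\<Prod>d\<in>P. 1 - h d)"
proof -
  have "excited P P = {P}"
  proof (intro set_eqI iffI)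
    fix D assume "D \<in> excited P P"
    then show "D \<in> {P}" by induction auto
  qed (auto intro: excited.base)
  moreover have "peaks P = {}" by (auto simp: peaks_def)
  ultimately show ?thesis by (simp add: excited_sum_def excited_weight_def)
qed

text \<open>Induction on the size of P - F, starting at F = P with its single diagram. In the common
  relation only the term A = {} and the right-hand side involve F itself, with coefficients 1 and m
  = z[P - F]. As m differs from 1, the values at larger filters determine the one at F.\<close>

lemma partition_gf_eq_excited_sum:
  assumes "order_filter P F"
  shows "to_fract (partition_gf c (P - F)) =
    excited_sum P (hook_monomial P c zvar) F / (\<Prod>d\<in>P. 1 - hook_monomial P c zvar d)"
  using assms
proof (induction "card (P - F)" arbitrary: F rule: less_induct)
  case (less F)
  define h :: "'a \<Rightarrow> ('i, int) mfps fract" where "h = hook_monomial P c zvar"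
  define H where "H = (\<Prod>d\<in>P. 1 - h d)"
  have "h d \<noteq> 1" if "d \<in> P" for d
    unfolding h_def by (rule hook_monomial_neq_1[OF order_filter_self that zvar_nonzero independent_zvar])
  then have H0: "H \<noteq> 0" using finite by (auto simp: H_def)
  have FP: "F \<subseteq> P" using less.prems order_filter_subset by blast
  have finQ: "finite (P - F)" using finite by simp
  show ?case
  proof (cases "F = P")
    case True
    then show ?thesis using H0 by (simp add: excited_sum_self partition_gf_empty H_def h_def)
  next
    case False
    define X where "X = maximal_elements (P - F)"
    have XQ: "X \<subseteq> P - F" by (auto simp: X_def maximal_elements_def)
    then have finX: "finite X" using finQ finite_subset by blast
    define m :: "('i, int) mfps fract" where "m = monomial zvar (P - F)"
    define r where "r F = excited_sum P h F / H" for F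
    define g where "g A = to_fract (partition_gf c (P - F - A))" for A
    have "(\<Sum>A\<in>Pow X. (- 1) ^ card A * excited_sum P h (F \<union> A)) = m * excited_sum P h F"
      unfolding X_def m_def h_def
      by (rule signed_excited_sum[OF order_filter_self less.prems FP zvar_nonzero])
    then have r: "(\<Sum>A\<in>Pow X. (- 1) ^ card A * r (F \<union> A)) = m * r F"
      unfolding r_def times_divide_eq_right sum_divide_distrib[symmetric] by simp
    have "to_fract (\<Sum>A\<in>Pow X. (- 1) ^ card A * partition_gf c (P - F - A)) =
        to_fract (mfps_monom (\<Sum>v\<in>P - F. {#c v#}) * partition_gf c (P - F))"
      unfolding X_def partition_gf_signed_sum[OF finQ] ..
    then have g: "(\<Sum>A\<in>Pow X. (- 1) ^ card A * g A) = m * g {}"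
      by (simp add: g_def m_def monomial_zvar to_fract_power)
    have IH: "g A = r (F \<union> A)" if A: "A \<in> Pow X - {{}}" for A
    proof -
      have "P - F - A = P - (F \<union> A)" by auto
      moreover have "card (P - (F \<union> A)) < card (P - F)"
        by (rule psubset_card_mono[OF finQ]) (use A XQ in auto)
      moreover have "order_filter P (F \<union> A)"
        by (rule order_filter_union_maximal[OF order_filter_self less.prems]) (use A in \<open>auto simp: X_def\<close>)
      ultimately show ?thesis using less.hyps[of "F \<union> A"] by (simp add: g_def r_def h_def H_def)
    qed
    have split: "(\<Sum>A\<in>Pow X. (- 1) ^ card A * f A) = f {} + (\<Sum>A\<in>Pow X - {{}}. (- 1) ^ card A * f A)"
      for f :: "'a set \<Rightarrow> ('i, int) mfps fract"
      using sum.remove[of "Pow X" "{}" "\<lambda>A. (- 1) ^ card A * f A"] finX by simp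
    have "(\<Sum>A\<in>Pow X - {{}}. (- 1) ^ card A * g A) = (\<Sum>A\<in>Pow X - {{}}. (- 1) ^ card A * r (F \<union> A))"
      using IH by (intro sum.cong) auto
    then have "m * g {} - g {} = m * r F - r F"
      using g r split[of g] split[of "\<lambda>A. r (F \<union> A)"] by (simp add: algebra_simps)
    then have "(m - 1) * (g {} - r F) = 0" by (simp add: algebra_simps)
    moreover have "m \<noteq> 1"
    proof -
      obtain v where v: "v \<in> P - F" using False FP by blast
      then have "(\<Sum>v\<in>P - F. {#c v#}) \<noteq> {#}" using finQ by (auto simp: sum_eq_empty_iff)
      then have "mfps_monom (\<Sum>v\<in>P - F. {#c v#}) \<noteq> (1 :: ('i, int) mfps)"
        unfolding mfps_monom_empty[symmetric] mfps_monom_inject .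
      then show ?thesis unfolding m_def monomial_zvar by (metis to_fract_1 to_fract_eq_iff)
    qed
    ultimately have "g {} = r F" by simp
    then show ?thesis by (simp add: g_def r_def h_def H_def)
  qed
qed

end

theorem theorem1p2:
  fixes P F :: "'a::order set" and I :: "'i set" and c :: "'a \<Rightarrow> 'i"
  assumes "finite P" and "d_complete P" and "d_complete_coloring P I c" and "order_filter P F"
  shows "mfps_summable (\<lambda>\<sigma>. \<Prod>v\<in>P - F. (mfps_var (c v) :: ('i, int) mfps) ^ \<sigma> v)
           (P_partitions (P - F)) \<and>
         to_fract (mfps_infsum (\<lambda>\<sigma>. \<Prod>v\<in>P - F. (mfps_var (c v) :: ('i, int) mfps) ^ \<sigma> v)
           (P_partitions (P - F))) =
         (\<Sum>D\<in>excited_diagrams P c F.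
           (\<Prod>v\<in>excited_peaks P c F D. hook_monomial P c zvar v) /
           (\<Prod>v\<in>P - D. 1 - hook_monomial P c zvar v))"
proof
  interpret d_complete_poset P I c using assms by unfold_locales
  show "mfps_summable (\<lambda>\<sigma>. \<Prod>v\<in>P - F. (mfps_var (c v) :: ('i, int) mfps) ^ \<sigma> v) (P_partitions (P - F))"
    using assms(1) by (intro partition_summable) auto
  let ?h = "hook_monomial P c zvar :: 'a \<Rightarrow> ('i, int) mfps fract"
  have FP: "F \<subseteq> P" using assms(4) order_filter_subset by blast
  have h1: "1 - ?h d \<noteq> 0" if "d \<in> P" for d
    using hook_monomial_neq_1[OF order_filter_self that zvar_nonzero independent_zvar] by simp
  have "to_fract (partition_gf c (P - F)) = (\<Sum>D\<in>excited P F. excited_weight ?h D / (\<Prod>d\<in>P. 1 - ?h d))"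
    unfolding partition_gf_eq_excited_sum[OF assms(4)] by (simp add: excited_sum_def sum_divide_distrib)
  also have "\<dots> = (\<Sum>D\<in>excited_diagrams P c F.
      (\<Prod>v\<in>excited_peaks P c F D. ?h v) / (\<Prod>v\<in>P - D. 1 - ?h v))"
    unfolding excited_diagrams_eq[OF FP]
  proof (rule sum.cong[OF refl])
    fix D assume D: "D \<in> excited P F"
    then have DP: "D \<subseteq> P" using excited_subset FP by blast
    \<comment> \<open>The factors over D in \<open>excited_weight\<close> cancel against the product
      over P and leave the denominator over P - D.\<close>
    have "(\<Prod>d\<in>P. 1 - ?h d) = (\<Prod>d\<in>P - D. 1 - ?h d) * (\<Prod>d\<in>D. 1 - ?h d)"
      by (rule prod.subset_diff[OF DP assms(1)])
    moreover have "(\<Prod>d\<in>D. 1 - ?h d) \<noteq> 0" using h1 DP finite_sub[OF DP] by auto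
    ultimately show "excited_weight ?h D / (\<Prod>d\<in>P. 1 - ?h d) =
        (\<Prod>v\<in>excited_peaks P c F D. ?h v) / (\<Prod>v\<in>P - D. 1 - ?h v)"
      using excited_peaks_eq[OF assms(4)] D excited_diagrams_eq[OF FP] by (simp add: excited_weight_def)
  qed
  finally show "to_fract (mfps_infsum (\<lambda>\<sigma>. \<Prod>v\<in>P - F. (mfps_var (c v) :: ('i, int) mfps) ^ \<sigma> v)
      (P_partitions (P - F))) = (\<Sum>D\<in>excited_diagrams P c F.
      (\<Prod>v\<in>excited_peaks P c F D. ?h v) / (\<Prod>v\<in>P - D. 1 - ?h v))"
    by (simp add: partition_gf_def)
qed

end
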